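(* Let $V_0\subseteq\mathbb{R}^n$ be a closed cone and $V\subseteq\mathbb{R}^n$ an open cone with $V_0\setminus\{0\}\subseteq V$, and let $\psi$ be a smooth cut-off for $(V_0,V)$. If $V_0\setminus\{0\}\neq\emptyset$ and $\operatorname{int}V^*\neq\emptyset$, then there are $f\in L^1_{\mathrm{comp}}(\mathbb{R}^n)$, $g\in L^\infty_{\mathrm{comp}}(\mathbb{R}^n)$ and $\varphi\in\mathcal{K}(\mathbb{R}^n)$ such that $\psi(D)f\notin L^1_{\mathrm{loc}}(\mathbb{R}^n)$, $\psi(D)g\notin L^\infty_{\mathrm{loc}}(\mathbb{R}^n)$ and $\psi(D)\varphi\notin\mathcal{C}(\mathbb{R}^n)$.
   Context: A cone in $\mathbb{R}^n$ is a set stable under multiplication by positive scalars. For a cone $V$, its dual cone is $V^*:=\{x\in\mathbb{R}^n\mid xy\ge0\ \ \forall y\in V\}$, where $xy$ is the Euclidean inner product. $B_R(0)=\{y\in\mathbb{R}^n\mid |y|\le R\}$. A function $\psi:\mathbb{R}^n\to\mathbb{C}$ is positively homogeneous of order $0$ outside of $B_R(0)$, $R>0$, if $\psi(\lambda\xi)=\psi(\xi)$ for all $|\xi|>R$, $\lambda>1$. Smooth cut-off: given a closed cone $V_0$ and an open cone $V$ with $V_0\setminus\{0\}\subseteq V$, a smooth nonnegative function $\psi$ on $\mathbb{R}^n$ is a smooth cut-off for the pair $(V_0,V)$ if $\operatorname{supp}\psi\subseteq V$ and, for some $R>0$, $\psi$ is positively homogeneous of order $0$ outside of $B_R(0)$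 and equals a positive constant on $V_0\setminus B_R(0)$. Fourier transform: $\mathcal{F}f(\xi)=\int_{\mathbb{R}^n}e^{-ix\xi}f(x)\,dx$, extended to $\mathcal{S}'(\mathbb{R}^n)$; $\psi(D):\mathcal{S}'(\mathbb{R}^n)\to\mathcal{S}'(\mathbb{R}^n)$ is $\psi(D)u=\mathcal{F}^{-1}(\psi\,\mathcal{F}u)$. $L^p_{\mathrm{comp}}(\mathbb{R}^n)$ is the space of compactly supported elements of $L^p(\mathbb{R}^n)$, $L^p_{\mathrm{loc}}(\mathbb{R}^n)$ the space of functions locally in $L^p$, $\mathcal{K}(\mathbb{R}^n)$ the space of continuous functions with compact support, and $\mathcal{C}(\mathbb{R}^n)$ the space of continuous functions. Statements such as $\psi(D)f\notin L^1_{\mathrm{loc}}(\mathbb{R}^n)$ mean that the distribution $\psi(D)f$ is not given by an element of that space. *)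

theory Defs
  imports "HOL-Analysis.Analysis"
begin

section \<open>Cones\<close>

text \<open>The library predicate \<^const>\<open>cone\<close> demands stability under multiplication by 0 as well.\<close>

definition pos_cone :: "'a::real_vector set \<Rightarrow> bool" where
  "pos_cone V \<longleftrightarrow> (\<forall>x\<in>V. \<forall>c>0. c *\<^sub>R x \<in> V)"

definition dual_cone :: "'a::real_inner set \<Rightarrow> 'a set" where
  "dual_cone V = {x. \<forall>y\<in>V. x \<bullet> y \<ge> 0}"


section \<open>Smooth functions and cut-offs\<close>

definition partial_deriv :: "'n \<Rightarrow> (real^'n \<Rightarrow> complex) \<Rightarrow> real^'n \<Rightarrow> complex" where
  "partial_deriv i f x = vector_derivative (\<lambda>t. f (x + t *\<^sub>R axis i 1)) (at 0)"

text \<open>Iterated partial derivatives, indexed by lists of coordinates instead of multi-indices.\<close>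

definition partial_derivs :: "'n list \<Rightarrow> (real^'n \<Rightarrow> complex) \<Rightarrow> real^'n \<Rightarrow> complex" where
  "partial_derivs is f = foldr partial_deriv is f"

text \<open>Differentiability below is Frechet differentiability; required of all iterated partial
  derivatives, it amounts to their existence and continuity in every order.\<close>

definition smooth :: "(real^'n \<Rightarrow> complex) \<Rightarrow> bool" where
  "smooth f \<longleftrightarrow> (\<forall>is. partial_derivs is f differentiable_on UNIV)"

definition supp :: "('a::topological_space \<Rightarrow> complex) \<Rightarrow> 'a set" where
  "supp f = closure {x. f x \<noteq> 0}"

definition homogeneous0_outside :: "real \<Rightarrow> (real^'n \<Rightarrow> complex) \<Rightarrow> bool" where
  "homogeneous0_outside R \<psi> \<longleftrightarrow>
     (\<forall>\<xi> l. norm \<xi> > R \<longrightarrow> l > 1 \<longrightarrow> \<psi> (l *\<^sub>R \<xi>) = \<psi> \<xi>)"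

definition smooth_cutoff ::
  "(real^'n) set \<Rightarrow> (real^'n) set \<Rightarrow> (real^'n \<Rightarrow> complex) \<Rightarrow> bool" where
  "smooth_cutoff V\<^sub>0 V \<psi> \<longleftrightarrow>
     smooth \<psi> \<and> (\<forall>\<xi>. \<psi> \<xi> \<in> \<real>\<^sub>\<ge>\<^sub>0) \<and> supp \<psi> \<subseteq> V \<and>
     (\<exists>R>0. homogeneous0_outside R \<psi> \<and>
        (\<exists>c::real. c > 0 \<and> (\<forall>\<xi>\<in>V\<^sub>0 - cball 0 R. \<psi> \<xi> = of_real c)))"


section \<open>Tempered distributions and Fourier multipliers\<close>

definition schwartz_seminorm :: "nat \<Rightarrow> (real^'n \<Rightarrow> complex) \<Rightarrow> real" where
  "schwartz_seminorm N \<phi> =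
     (\<Sum>is | length is \<le> N. SUP x. (1 + norm x) ^ N * norm (partial_derivs is \<phi> x))"

definition schwartz :: "(real^'n \<Rightarrow> complex) set" where
  "schwartz = {\<phi>. smooth \<phi> \<and>
     (\<forall>N is. bounded (range (\<lambda>x. (1 + norm x) ^ N * norm (partial_derivs is \<phi> x))))}"

definition test_functions :: "(real^'n \<Rightarrow> complex) set" where
  "test_functions = {\<phi>. smooth \<phi> \<and> compact (supp \<phi>)}"

text \<open>Distributions are represented by functionals on all functions. Only the values on Schwartz
  functions carry meaning; the operators below use no other values of a tempered distribution
  when they are evaluated at a Schwartz function (and the multiplier is smooth with all
  derivatives of polynomial growth, as is the case for smooth cut-offs).\<close>

type_synonym 'a functional = "('a \<Rightarrow> complex) \<Rightarrow> complex"

definition tempered_distribution :: "(real^'n) functional \<Rightarrow> bool" where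
  "tempered_distribution u \<longleftrightarrow>
     (\<forall>\<phi>\<in>schwartz. \<forall>\<theta>\<in>schwartz. u (\<lambda>x. \<phi> x + \<theta> x) = u \<phi> + u \<theta>) \<and>
     (\<forall>c. \<forall>\<phi>\<in>schwartz. u (\<lambda>x. c * \<phi> x) = c * u \<phi>) \<and>
     (\<exists>C N. \<forall>\<phi>\<in>schwartz. norm (u \<phi>) \<le> C * schwartz_seminorm N \<phi>)"

definition dist_of :: "(real^'n \<Rightarrow> complex) \<Rightarrow> (real^'n) functional" where
  "dist_of f = (\<lambda>\<phi>. LINT x|lebesgue. f x * \<phi> x)"

definition fourier :: "(real^'n \<Rightarrow> complex) \<Rightarrow> real^'n \<Rightarrow> complex" where
  "fourier f \<xi> = (LINT x|lebesgue. exp (- \<i> * of_real (x \<bullet> \<xi>)) * f x)"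

definition inv_fourier :: "(real^'n \<Rightarrow> complex) \<Rightarrow> real^'n \<Rightarrow> complex" where
  "inv_fourier f x =
     of_real (1 / (2 * pi) ^ CARD('n)) * (LINT \<xi>|lebesgue. exp (\<i> * of_real (x \<bullet> \<xi>)) * f \<xi>)"

text \<open>The extensions to tempered distributions, by transposition:
  \<open>\<langle>F u, \<phi>\<rangle> = \<langle>u, F \<phi>\<rangle>\<close>, \<open>\<langle>F\<^sup>-\<^sup>1 u, \<phi>\<rangle> = \<langle>u, F\<^sup>-\<^sup>1 \<phi>\<rangle>\<close> and
  \<open>\<langle>\<psi> u, \<phi>\<rangle> = \<langle>u, \<psi> \<phi>\<rangle>\<close>, with bilinear pairings.\<close>

definition fourier_dist :: "(real^'n) functional \<Rightarrow> (real^'n) functional" where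
  "fourier_dist u = (\<lambda>\<phi>. u (fourier \<phi>))"

definition inv_fourier_dist :: "(real^'n) functional \<Rightarrow> (real^'n) functional" where
  "inv_fourier_dist u = (\<lambda>\<phi>. u (inv_fourier \<phi>))"

definition mult_dist :: "(real^'n \<Rightarrow> complex) \<Rightarrow> (real^'n) functional \<Rightarrow> (real^'n) functional" where
  "mult_dist \<psi> u = (\<lambda>\<phi>. u (\<lambda>\<xi>. \<psi> \<xi> * \<phi> \<xi>))"

definition fourier_multiplier ::
  "(real^'n \<Rightarrow> complex) \<Rightarrow> (real^'n) functional \<Rightarrow> (real^'n) functional" where
  "fourier_multiplier \<psi> u = inv_fourier_dist (mult_dist \<psi> (fourier_dist u))"

text \<open>The distribution \<open>u\<close> is given by an element of the function space \<open>X\<close>.\<close>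

definition given_by_element_of :: "(real^'n) functional \<Rightarrow> (real^'n \<Rightarrow> complex) set \<Rightarrow> bool" where
  "given_by_element_of u X \<longleftrightarrow> (\<exists>h\<in>X. \<forall>\<phi>\<in>test_functions. u \<phi> = dist_of h \<phi>)"


section \<open>Function spaces\<close>

text \<open>Elements of Lebesgue spaces are represented by Lebesgue measurable functions; accordingly,
  compactness of the support is understood up to null sets.\<close>

definition ae_compact_support :: "(real^'n \<Rightarrow> complex) \<Rightarrow> bool" where
  "ae_compact_support f \<longleftrightarrow> (\<exists>K. compact K \<and> (AE x in lebesgue. x \<notin> K \<longrightarrow> f x = 0))"

definition L1_comp :: "(real^'n \<Rightarrow> complex) set" where
  "L1_comp = {f. integrable lebesgue f \<and> ae_compact_support f}"

definition Linf_comp :: "(real^'n \<Rightarrow> complex) set" where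
  "Linf_comp = {f. f \<in> borel_measurable lebesgue \<and>
     (\<exists>C. AE x in lebesgue. norm (f x) \<le> C) \<and> ae_compact_support f}"

definition continuous_comp :: "(real^'n \<Rightarrow> complex) set" where
  "continuous_comp = {f. continuous_on UNIV f \<and> compact (supp f)}"

definition L1_loc :: "(real^'n \<Rightarrow> complex) set" where
  "L1_loc = {f. f \<in> borel_measurable lebesgue \<and>
     (\<forall>K. compact K \<longrightarrow> set_integrable lebesgue K f)}"

definition Linf_loc :: "(real^'n \<Rightarrow> complex) set" where
  "Linf_loc = {f. f \<in> borel_measurable lebesgue \<and>
     (\<forall>K. compact K \<longrightarrow> (\<exists>C. AE x in lebesgue. x \<in> K \<longrightarrow> norm (f x) \<le> C))}"

definition continuous_functions :: "(real^'n \<Rightarrow> complex) set" where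
  "continuous_functions = {f. continuous_on UNIV f}"


section \<open>Compactly supported functions as tempered distributions\<close>

lemma continuous_comp_subset_Linf_comp: "continuous_comp \<subseteq> Linf_comp"
proof
  fix f :: "real^'n \<Rightarrow> complex"
  assume "f \<in> continuous_comp"
  then have cont: "continuous_on UNIV f" and comp: "compact (supp f)"
    by (auto simp: continuous_comp_def)
  have zero: "f x = 0" if "x \<notin> supp f" for x
    using that closure_subset[of "{x. f x \<noteq> 0}"] by (auto simp: supp_def)
  have "bounded (f ` supp f)"
    using cont comp by (intro compact_imp_bounded compact_continuous_image)
      (auto intro: continuous_on_subset)
  then obtain C where C: "\<forall>y\<in>f ` supp f. norm y \<le> C"
    by (auto simp: bounded_iff)
  have "norm (f x) \<le> max 0 C" for x
    using C zero[of x] by (cases "x \<in> supp f") (auto simp: le_max_iff_disj)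
  moreover have "f \<in> borel_measurable lebesgue"
    using borel_measurable_continuous_onI[OF cont] by (simp add: measurable_completion)
  ultimately show "f \<in> Linf_comp"
    using comp zero unfolding Linf_comp_def ae_compact_support_def by blast
qed

lemma Linf_comp_subset_L1_comp: "Linf_comp \<subseteq> L1_comp"
proof
  fix f :: "real^'n \<Rightarrow> complex"
  assume "f \<in> Linf_comp"
  then obtain C K where f [measurable]: "f \<in> borel_measurable lebesgue"
    and C: "AE x in lebesgue. norm (f x) \<le> C"
    and K: "compact K" "AE x in lebesgue. x \<notin> K \<longrightarrow> f x = 0"
    by (auto simp: Linf_comp_def ae_compact_support_def)
  have "integrable lebesgue (\<lambda>x. C * indicat_real K x)"
    using lmeasurable_compact[OF K(1)]
    by (intro integrable_mult_right integrable_real_indicator)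
      (auto simp: fmeasurable_def less_top)
  moreover have "AE x in lebesgue. norm (f x) \<le> norm (C * indicat_real K x)"
    using C K(2) by eventually_elim (auto simp: indicator_def split: if_splits)
  ultimately have "integrable lebesgue f"
    using Bochner_Integration.integrable_bound f by blast
  then show "f \<in> L1_comp"
    using K by (auto simp: L1_comp_def ae_compact_support_def)
qed

lemma schwartz_norm_le_seminorm:
  assumes "\<phi> \<in> schwartz"
  shows "norm (\<phi> x) \<le> schwartz_seminorm 0 \<phi>"
proof -
  have "bounded (range (\<lambda>x. (1 + norm x) ^ 0 * norm (partial_derivs [] \<phi> x)))"
    using assms unfolding schwartz_def by blast
  then have "bdd_above (range (\<lambda>x. norm (\<phi> x)))"
    by (auto simp: partial_derivs_def intro: bounded_imp_bdd_above)
  then show ?thesis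
    by (auto simp: schwartz_seminorm_def partial_derivs_def intro: cSUP_upper)
qed

lemma schwartz_measurable:
  assumes "\<phi> \<in> schwartz"
  shows "\<phi> \<in> borel_measurable lebesgue"
proof -
  have "partial_derivs [] \<phi> differentiable_on UNIV"
    using assms unfolding schwartz_def smooth_def by blast
  then have "continuous_on UNIV \<phi>"
    by (simp add: partial_derivs_def differentiable_imp_continuous_on)
  then show ?thesis
    using borel_measurable_continuous_onI[of \<phi>] by (simp add: measurable_completion)
qed

lemma integrable_mult_schwartz:
  assumes "integrable lebesgue f" and "\<phi> \<in> schwartz"
  shows "integrable lebesgue (\<lambda>x. f x * \<phi> x)"
proof (rule Bochner_Integration.integrable_bound)
  show "integrable lebesgue (\<lambda>x. schwartz_seminorm 0 \<phi> * norm (f x))"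
    using assms(1) by simp
  show "(\<lambda>x. f x * \<phi> x) \<in> borel_measurable lebesgue"
    using assms(1) schwartz_measurable[OF assms(2)]
    by (intro borel_measurable_times) auto
  have "norm (f x * \<phi> x) \<le> norm (schwartz_seminorm 0 \<phi> * norm (f x))" for x
  proof -
    have "norm (f x * \<phi> x) \<le> schwartz_seminorm 0 \<phi> * norm (f x)"
      using mult_right_mono[OF schwartz_norm_le_seminorm[OF assms(2), of x], of "norm (f x)"]
      by (simp add: norm_mult mult.commute)
    then show ?thesis by simp
  qed
  then show "AE x in lebesgue. norm (f x * \<phi> x) \<le> norm (schwartz_seminorm 0 \<phi> * norm (f x))"
    by simp
qed

lemma tempered_distribution_dist_of:
  fixes f :: "real^'n \<Rightarrow> complex"
  assumes f: "integrable lebesgue f"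
  shows "tempered_distribution (dist_of f)"
  unfolding tempered_distribution_def
proof (intro conjI ballI allI)
  fix \<phi> \<theta> :: "real^'n \<Rightarrow> complex" assume "\<phi> \<in> schwartz" "\<theta> \<in> schwartz"
  then show "dist_of f (\<lambda>x. \<phi> x + \<theta> x) = dist_of f \<phi> + dist_of f \<theta>"
    using integrable_mult_schwartz[OF f] by (simp add: dist_of_def distrib_left)
next
  fix c and \<phi> :: "real^'n \<Rightarrow> complex"
  show "dist_of f (\<lambda>x. c * \<phi> x) = c * dist_of f \<phi>"
    by (simp add: dist_of_def mult.left_commute[of _ c])
next
  have "norm (dist_of f \<phi>) \<le> (LINT x|lebesgue. norm (f x)) * schwartz_seminorm 0 \<phi>"
    if \<phi>: "\<phi> \<in> schwartz" for \<phi>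
  proof -
    have "norm (dist_of f \<phi>) \<le> (LINT x|lebesgue. norm (f x * \<phi> x))"
      unfolding dist_of_def by (rule integral_norm_bound)
    also have "\<dots> \<le> (LINT x|lebesgue. norm (f x) * schwartz_seminorm 0 \<phi>)"
      using integrable_norm[OF integrable_mult_schwartz[OF f \<phi>]] f schwartz_norm_le_seminorm[OF \<phi>]
      by (intro integral_mono) (simp_all add: norm_mult mult_left_mono)
    finally show ?thesis by simp
  qed
  then show "\<exists>C N. \<forall>\<phi>\<in>schwartz. norm (dist_of f \<phi>) \<le> C * schwartz_seminorm N \<phi>"
    by blast
qed

end

theory Submission
  imports Defs "HOL-Probability.Characteristic_Functions" "HOL-Probability.Sinc_Integral"
begin

text \<open>
Testing \<open>\<psi>(D) f\<close> reduces the claim to the failure of the projection onto frequencies of one sign on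
\<open>L\<^sup>1\<close> and on continuous functions, in a single direction \<open>e\<close>.

Let \<open>e\<close> be a unit vector at which \<open>\<psi>\<close>, at large distance from the origin, attains its maximum
\<open>c > 0\<close>. Since the dual cone of \<open>V\<close> has interior points, \<open>V\<close> does not contain \<open>- e\<close>, so \<open>\<psi>\<close> vanishes
far out in the direction \<open>- e\<close>. As both values are extremal, homogeneity and a Taylor estimate give
\<open>\<psi> (\<zeta> + m e) = c + O((1 + (norm \<zeta>)\<^sup>2) / m\<^sup>2)\<close> and \<open>\<psi> (\<zeta> - m e) = O((1 + (norm \<zeta>)\<^sup>2) / m\<^sup>2)\<close>
(lemma \<open>smooth_cutoff_asymptotics\<close>).

Let \<open>\<chi>\<close> be a smooth bump and let \<open>p (x) = \<Sum>\<^sub>k a\<^sub>k exp (i k x \<bullet> e)\<close> be a trigonometric polynomial with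
\<open>norm a\<^sub>k \<le> 1\<close>; write \<open>p\<^sub>-\<close> for the part of \<open>p\<close> with negative frequencies. The transposed operator
maps \<open>\<chi> p\<close> to \<open>c \<chi> p\<^sub>-\<close> up to an error that is bounded by \<open>\<Sum>\<^sub>k O(1 / (1 + k\<^sup>2))\<close>, uniformly in the
degree of \<open>p\<close>. Thus \<open>\<langle>\<psi>(D) f, \<chi> p\<rangle>\<close> equals \<open>c \<integral> f \<chi> p\<^sub>-\<close> up to a multiple of the \<open>L\<^sup>1\<close> norm of \<open>f\<close>
(lemma \<open>fourier_multiplier_pairing\<close>). It remains to find \<open>f\<close> and polynomials \<open>p\<close> for which the left
side would be bounded if \<open>\<psi>(D) f\<close> were a function of the class in question, whereas the integral on
the right is unbounded. Put \<open>\<theta> = x \<bullet> e\<close>.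

For \<open>L\<^sup>1\<close>, take \<open>p\<close> close to \<open>Ln (1 - z) - Ln (1 - cnj z)\<close> with \<open>z = r exp (i \<theta>)\<close>. It is uniformly bounded
as \<open>r\<close> tends to 1, but \<open>Re p\<^sub>-\<close> behaves like \<open>- ln (1 - r + \<bar>\<theta>\<bar>)\<close>; hence any \<open>f \<ge> 0\<close> that is
concentrated near the hyperplane \<open>\<theta> = 0\<close> so strongly that \<open>f ln \<bar>\<theta>\<bar>\<close> is not integrable will do (lemma
\<open>ex_L1_large_negative_pairings\<close>).

For continuous and for bounded functions, take \<open>p\<close> close to the Poisson kernel. Its \<open>L\<^sup>1\<close> norm
against \<open>\<chi>\<close> is bounded, but \<open>Im p\<^sub>-\<close> behaves like \<open>- \<theta> / (1 - r + \<bar>\<theta>\<bar>)\<^sup>2\<close>; hence a continuous function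
that equals \<open>sgn \<theta> / (1 - ln \<bar>\<theta>\<bar>)\<close> near the origin, up to a cut-off, will do, because its product
with \<open>1 / \<theta>\<close> is not integrable (lemma \<open>ex_log_ridge_large_negative_pairings\<close>).
\<close>

section \<open>An algebra of smooth functions\<close>

text \<open>A ridge function depends on its argument only through \<open>x \<bullet> v\<close>; the sequence \<open>H\<close> lists its
profile and all derivatives of the profile. The algebra generated by smooth ridge functions
contains every test function used below, and directional derivatives do not leave it, so that
membership controls all iterated partial derivatives at once.\<close>

inductive_set ridge_algebra :: "('a::real_inner \<Rightarrow> complex) set" where
  ridge: "(\<And>k t. (H k has_vector_derivative H (Suc k) t) (at t)) \<Longrightarrow>
    (\<lambda>x. H (0::nat) (a + x \<bullet> v)) \<in> ridge_algebra"
| add: "f \<in> ridge_algebra \<Longrightarrow> g \<in> ridge_algebra \<Longrightarrow> (\<lambda>x. f x + g x) \<in> ridge_algebra"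
| mult: "f \<in> ridge_algebra \<Longrightarrow> g \<in> ridge_algebra \<Longrightarrow> (\<lambda>x. f x * g x) \<in> ridge_algebra"

lemma ridge_algebra_const: "(\<lambda>x. c) \<in> ridge_algebra"
proof -
  have "(\<lambda>x. (if (0::nat) = 0 then c else 0)) \<in> ridge_algebra"
    by (rule ridge_algebra.ridge[where H = "\<lambda>k t. if k = 0 then c else 0" and a = 0 and v = 0])
      (auto intro!: derivative_eq_intros)
  then show ?thesis by simp
qed

lemma ridge_algebra_prod:
  assumes "finite I" "\<And>i. i \<in> I \<Longrightarrow> f i \<in> ridge_algebra"
  shows "(\<lambda>x. \<Prod>i\<in>I. f i x) \<in> ridge_algebra"
  using assms by (induction I rule: finite_induct)
    (auto intro: ridge_algebra_const ridge_algebra.mult)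

lemma ridge_algebra_sum:
  assumes "finite I" "\<And>i. i \<in> I \<Longrightarrow> f i \<in> ridge_algebra"
  shows "(\<lambda>x. \<Sum>i\<in>I. f i x) \<in> ridge_algebra"
  using assms by (induction I rule: finite_induct)
    (auto intro: ridge_algebra_const ridge_algebra.add)

lemma ridge_algebra_exp: "(\<lambda>x. exp (\<i> * of_real (s * (x \<bullet> v)))) \<in> ridge_algebra"
proof -
  have "(\<lambda>x. (\<i> * of_real s) ^ 0 * exp (\<i> * of_real s * of_real (0 + x \<bullet> v))) \<in> ridge_algebra"
  proof (rule ridge_algebra.ridge[where H = "\<lambda>k t. (\<i> * of_real s) ^ k * exp (\<i> * of_real s * of_real t)"])
    fix k t
    have "((\<lambda>z. exp (\<i> * of_real s * z)) has_field_derivative \<i> * of_real s * exp (\<i> * of_real s * of_real t))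
       (at (complex_of_real t))"
      by (auto intro!: derivative_eq_intros)
    from has_vector_derivative_real_field[OF this]
    have "((\<lambda>t. exp (\<i> * of_real s * of_real t)) has_vector_derivative
       \<i> * of_real s * exp (\<i> * of_real s * of_real t)) (at t)" by simp
    from has_vector_derivative_mult_right[OF this, of "(\<i> * of_real s) ^ k"]
    show "((\<lambda>t. (\<i> * of_real s) ^ k * exp (\<i> * of_real s * of_real t)) has_vector_derivative
      (\<i> * of_real s) ^ Suc k * exp (\<i> * of_real s * of_real t)) (at t)"
      by (simp add: mult_ac)
  qed
  then show ?thesis by (simp add: mult_ac)
qed

text \<open>Differentiating a ridge function shifts its derivative sequence by one, and the sum and product
rules stay inside the algebra.\<close>

lemma ridge_algebra_has_derivative:
  fixes f :: "'a::real_inner \<Rightarrow> complex"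
  assumes "f \<in> ridge_algebra"
  shows "\<exists>D. (\<forall>x. (f has_derivative (\<lambda>w. D w x)) (at x)) \<and> (\<forall>w. D w \<in> ridge_algebra)"
  using assms
proof induction
  case (ridge H a v)
  have 1: "((\<lambda>x. H 0 (a + x \<bullet> v)) has_derivative (\<lambda>w. of_real (w \<bullet> v) * H (Suc 0) (a + x \<bullet> v))) (at x)" for x
  proof -
    have "(H 0 has_derivative (\<lambda>t. t *\<^sub>R H (Suc 0) (a + x \<bullet> v))) (at (a + x \<bullet> v))"
      using ridge[of 0] by (simp add: has_vector_derivative_def)
    moreover have "((\<lambda>x. a + x \<bullet> v) has_derivative (\<lambda>w. w \<bullet> v)) (at x)"
      by (auto intro!: derivative_eq_intros)
    ultimately show ?thesis
      using has_derivative_compose by (fastforce simp: scaleR_conv_of_real)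
  qed
  have 2: "(\<lambda>x. of_real (w \<bullet> v) * H (Suc 0) (a + x \<bullet> v)) \<in> ridge_algebra" for w
    using ridge by (intro ridge_algebra.mult ridge_algebra_const
        ridge_algebra.ridge[where H = "\<lambda>k. H (Suc k)"]) auto
  show ?case
    by (rule exI[of _ "\<lambda>w x. of_real (w \<bullet> v) * H (Suc 0) (a + x \<bullet> v)"]) (use 1 2 in auto)
next
  case (add f g)
  then obtain D E where "\<forall>x. (f has_derivative (\<lambda>w. D w x)) (at x)" "\<forall>w. D w \<in> ridge_algebra"
    "\<forall>x. (g has_derivative (\<lambda>w. E w x)) (at x)" "\<forall>w. E w \<in> ridge_algebra"
    by blast
  then show ?case
    by (intro exI[of _ "\<lambda>w x. D w x + E w x"])
      (auto intro: ridge_algebra.add has_derivative_add)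
next
  case (mult f g)
  then obtain D E where "\<forall>x. (f has_derivative (\<lambda>w. D w x)) (at x)" "\<forall>w. D w \<in> ridge_algebra"
    "\<forall>x. (g has_derivative (\<lambda>w. E w x)) (at x)" "\<forall>w. E w \<in> ridge_algebra"
    by blast
  with mult.hyps show ?case
    by (intro exI[of _ "\<lambda>w x. f x * E w x + D w x * g x"])
      (auto intro!: ridge_algebra.add ridge_algebra.mult has_derivative_mult)
qed

lemma ridge_algebra_continuous:
  assumes "f \<in> ridge_algebra" shows "continuous_on UNIV f"
  using ridge_algebra_has_derivative[OF assms]
  by (meson continuous_at_imp_continuous_on has_derivative_continuous)

lemma partial_deriv_eq_derivative:
  assumes D: "(f has_derivative D) (at x)"
  shows "partial_deriv i f x = D (axis i 1)"
proof -
  have lin: "linear D" using D by (rule has_derivative_linear)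
  have "((\<lambda>t::real. x + t *\<^sub>R axis i 1) has_derivative (\<lambda>t. t *\<^sub>R axis i 1)) (at 0)"
    by (auto intro!: derivative_eq_intros)
  moreover have "(f has_derivative D) (at (x + (0::real) *\<^sub>R axis i 1))"
    using D by simp
  ultimately have "((\<lambda>t::real. f (x + t *\<^sub>R axis i 1)) has_derivative (\<lambda>t. D (t *\<^sub>R axis i 1))) (at 0)"
    by (rule has_derivative_compose)
  then have "((\<lambda>t::real. f (x + t *\<^sub>R axis i 1)) has_vector_derivative D (axis i 1)) (at 0)"
    by (simp add: has_vector_derivative_def linear_scale[OF lin])
  then show ?thesis
    unfolding partial_deriv_def by (rule vector_derivative_at)
qed

lemma ridge_algebra_smooth:
  fixes f :: "real^'n \<Rightarrow> complex"
  assumes "f \<in> ridge_algebra" shows "smooth f"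
proof -
  have pd: "partial_deriv i g \<in> ridge_algebra" if g: "g \<in> ridge_algebra" for g :: "real^'n \<Rightarrow> complex" and i
  proof -
    obtain D where D: "\<And>x. (g has_derivative (\<lambda>w. D w x)) (at x)" "\<And>w. D w \<in> ridge_algebra"
      using ridge_algebra_has_derivative[OF g] by blast
    have "partial_deriv i g x = D (axis i 1) x" for x
      using D(1) by (rule partial_deriv_eq_derivative)
    then have "partial_deriv i g = D (axis i 1)" by blast
    with D(2) show ?thesis by simp
  qed
  have "partial_derivs is f \<in> ridge_algebra" for "is"
    using assms by (induction "is") (auto simp: partial_derivs_def pd)
  then show ?thesis
    unfolding smooth_def differentiable_on_def differentiable_def
    using ridge_algebra_has_derivative by (metis has_derivative_at_withinI)
qed

section \<open>A smooth bump function\<close>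

text \<open>On \<open>t > 0\<close> the \<open>k\<close>-th derivative of \<open>exp (- 1 / t)\<close> is \<open>P\<^sub>k (1 / t) exp (- 1 / t)\<close>: writing
\<open>u = 1 / t\<close>, the derivative of \<open>P(u) exp (- u)\<close> in \<open>t\<close> is \<open>u\<^sup>2 (P(u) - P'(u)) exp (- u)\<close>, because
\<open>u' = - u\<^sup>2\<close>.\<close>

fun flat_poly :: "nat \<Rightarrow> real poly" where
  "flat_poly 0 = 1"
| "flat_poly (Suc k) = [:0, 0, 1:] * (flat_poly k - pderiv (flat_poly k))"

definition flat :: "nat \<Rightarrow> real \<Rightarrow> real" where
  "flat k t = (if t > 0 then poly (flat_poly k) (1 / t) * exp (- (1 / t)) else 0)"

lemma poly_times_exp_minus_tendsto_0:
  "((\<lambda>x::real. poly p x * exp (- x)) \<longlongrightarrow> 0) at_top"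
proof -
  have "((\<lambda>x::real. coeff p i * (x ^ i / exp x)) \<longlongrightarrow> coeff p i * 0) at_top" for i
    by (intro tendsto_intros tendsto_power_div_exp_0)
  then have "((\<lambda>x::real. \<Sum>i\<le>degree p. coeff p i * (x ^ i / exp x)) \<longlongrightarrow> (\<Sum>i\<le>degree p. coeff p i * 0)) at_top"
    by (intro tendsto_sum)
  then show ?thesis
    by (simp add: poly_altdef sum_distrib_right exp_minus divide_inverse mult.assoc)
qed

text \<open>Only the origin needs an argument: there the difference quotient is a polynomial in \<open>1 / t\<close> times
\<open>exp (- 1 / t)\<close>, and the exponential wins.\<close>

lemma flat_has_derivative: "(flat k has_real_derivative flat (Suc k) t) (at t)"
proof -
  consider "t > 0" | "t < 0" | "t = 0" by linarith
  then show ?thesis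
  proof cases
    case 1
    have "((\<lambda>t. poly (flat_poly k) (1 / t) * exp (- (1 / t))) has_real_derivative flat (Suc k) t) (at t)"
      using 1 by (auto intro!: derivative_eq_intros simp: flat_def field_simps power2_eq_square)
    then show ?thesis
      by (rule has_field_derivative_transform_within_open[where S = "{0<..}"])
        (use 1 in \<open>auto simp: flat_def\<close>)
  next
    case 2
    have "((\<lambda>t. 0) has_real_derivative flat (Suc k) t) (at t)"
      using 2 by (auto simp: flat_def)
    then show ?thesis
      by (rule has_field_derivative_transform_within_open[where S = "{..<0}"])
        (use 2 in \<open>auto simp: flat_def\<close>)
  next
    case 3
    have "((\<lambda>h. poly (pCons 0 (flat_poly k)) (inverse h) * exp (- inverse h)) \<longlongrightarrow> 0) (at_right 0)"
      by (rule filterlim_compose[OF poly_times_exp_minus_tendsto_0 filterlim_inverse_at_top_right])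
    moreover have "\<forall>\<^sub>F h in at_right 0. poly (pCons 0 (flat_poly k)) (inverse h) * exp (- inverse h) = flat k h / h"
      using eventually_at_right_less[of 0]
      by eventually_elim (auto simp: flat_def field_simps)
    ultimately have R: "((\<lambda>h. flat k h / h) \<longlongrightarrow> 0) (at_right 0)"
      by (rule Lim_transform_eventually)
    have "\<forall>\<^sub>F h in at_left 0. 0 = flat k h / h"
      by (auto simp: flat_def eventually_at_filter)
    from Lim_transform_eventually[OF tendsto_const this]
    have "((\<lambda>h. flat k h / h) \<longlongrightarrow> 0) (at 0)"
      using R by (simp add: filterlim_at_split)
    then show ?thesis
      using 3 by (simp add: has_field_derivative_iff flat_def)
  qed
qed

definition bump :: "real \<Rightarrow> real" where
  "bump t = flat 0 (1 - t) * flat 0 (1 + t)"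

lemma flat_0_bounds: "0 \<le> flat 0 t" "flat 0 t \<le> 1"
  by (auto simp: flat_def)

lemma bump_bounds: "0 \<le> bump t" "bump t \<le> 1"
  by (auto simp: bump_def flat_0_bounds intro!: mult_le_one)

lemma bump_eq_0: "1 \<le> \<bar>t\<bar> \<Longrightarrow> bump t = 0"
  by (auto simp: bump_def flat_def abs_if split: if_splits)

lemma bump_lower: assumes "\<bar>t\<bar> \<le> 1/2" shows "exp (-4) \<le> bump t"
proof -
  have *: "exp (-2) \<le> flat 0 u" if "u \<ge> 1/2" for u
    using that by (auto simp: flat_def field_simps)
  have "exp (-4) = exp (-2) * (exp (-2) :: real)"
    by (simp flip: exp_add)
  also have "\<dots> \<le> bump t"
    unfolding bump_def using assms by (intro mult_mono *) (auto simp: flat_0_bounds)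
  finally show ?thesis .
qed

lemma flat_ridge: "(\<lambda>x. of_real (flat 0 (a + x \<bullet> v))) \<in> ridge_algebra"
  by (rule ridge_algebra.ridge[where H = "\<lambda>k t. of_real (flat k t)"])
    (rule has_vector_derivative_of_real, simp add: flat_has_derivative flip: has_real_derivative_iff_has_vector_derivative)

lemma bump_ridge: "(\<lambda>x. of_real (bump (x \<bullet> v))) \<in> ridge_algebra"
  using ridge_algebra.mult[OF flat_ridge[of 1 "-v"] flat_ridge[of 1 v]]
  by (simp add: bump_def)

section \<open>The Fourier transform of the bump function in one dimension\<close>

lemma integrable_one_over_one_plus_square: "integrable lborel (\<lambda>t::real. 1 / (1 + t\<^sup>2))"
  using integrable_inverse_1_plus_square by (simp add: set_integrable_def inverse_eq_divide)

lemma integrable_continuous_vanishing: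
  fixes f :: "real \<Rightarrow> complex"
  assumes "continuous_on UNIV f" "\<And>x. 1 < \<bar>x\<bar> \<Longrightarrow> f x = 0"
  shows "integrable lborel f"
proof -
  have "set_integrable lborel {-1..1} f"
    unfolding set_integrable_def
    using assms by (intro borel_integrable_compact) (auto intro: continuous_on_subset)
  moreover have "indicat_real {-1..1} x *\<^sub>R f x = f x" for x
    using assms(2)[of x] by (auto simp: indicator_def abs_if split: if_splits)
  ultimately show ?thesis by (simp add: set_integrable_def)
qed

lemma bounded_phase_integrable:
  fixes f g :: "'a \<Rightarrow> complex"
  assumes f: "integrable M f" and g: "g \<in> borel_measurable M" "\<And>x. norm (g x) \<le> B"
  shows "integrable M (\<lambda>x. g x * f x)"
proof (rule Bochner_Integration.integrable_bound)
  show "integrable M (\<lambda>x. B * norm (f x))" using f by simp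
  show "(\<lambda>x. g x * f x) \<in> borel_measurable M" using f g(1) by measurable
  show "AE x in M. norm (g x * f x) \<le> norm (B * norm (f x))"
  proof (rule AE_I2)
    fix x
    have "0 \<le> B" using g(2)[of x] norm_ge_zero order_trans by blast
    then show "norm (g x * f x) \<le> norm (B * norm (f x))"
      using g(2)[of x] by (simp add: norm_mult mult_right_mono)
  qed
qed

text \<open>Each factor of \<open>t\<close> is traded for a derivative by an integration by parts; there are no boundary
terms because the function vanishes near the ends of \<open>[- 2, 2]\<close>.\<close>

lemma ridge_algebra_fourier_decay:
  fixes f :: "real \<Rightarrow> complex"
  assumes "f \<in> ridge_algebra" "\<And>x. 1 < \<bar>x\<bar> \<Longrightarrow> f x = 0"
  shows "\<exists>M. \<forall>t. \<bar>t\<bar> ^ k * norm (LINT x|lborel. iexp (t * x) * f x) \<le> M"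
  using assms
proof (induction k arbitrary: f)
  case 0
  have int: "integrable lborel f"
    using 0 by (intro integrable_continuous_vanishing ridge_algebra_continuous)
  have "norm (LINT x|lborel. iexp (t * x) * f x) \<le> (LINT x|lborel. norm (f x))" for t
  proof -
    have "norm (LINT x|lborel. iexp (t * x) * f x) \<le> (LINT x|lborel. norm (iexp (t * x) * f x))"
      by (rule integral_norm_bound)
    then show ?thesis by (simp add: norm_mult)
  qed
  then show ?case by auto
next
  case (Suc k)
  obtain D where D: "\<And>x. (f has_derivative (\<lambda>w. D w x)) (at x)" "\<And>w. D w \<in> ridge_algebra"
    using ridge_algebra_has_derivative[OF Suc.prems(1)] by blast
  define f' where "f' = D 1"
  have f': "(f has_vector_derivative f' x) (at x)" for x
  proof -
    have "D w x = w *\<^sub>R D 1 x" for w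
    proof -
      have "D (w *\<^sub>R 1) x = w *\<^sub>R D 1 x"
        by (rule linear_scale[OF has_derivative_linear[OF D(1)]])
      then show ?thesis by simp
    qed
    then have "(\<lambda>w. D w x) = (\<lambda>w. w *\<^sub>R D 1 x)" by (rule ext)
    then show ?thesis
      using D(1)[of x] by (simp only: has_vector_derivative_def f'_def)
  qed
  have f'0: "f' x = 0" if "1 < \<bar>x\<bar>" for x
  proof -
    have "open {x::real. 1 < \<bar>x\<bar>}" by (intro open_Collect_less continuous_intros)
    moreover have "((\<lambda>x. 0) has_vector_derivative 0) (at x)" by simp
    ultimately have "(f has_vector_derivative 0) (at x)"
      using has_vector_derivative_transform_within_open[of "\<lambda>x. 0" 0 x "{x. 1 < \<bar>x\<bar>}" f] that Suc.prems(2)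
      by auto
    with f' show ?thesis by (rule vector_derivative_unique_at)
  qed
  obtain M where M: "\<And>t. \<bar>t\<bar> ^ k * norm (LINT x|lborel. iexp (t * x) * f' x) \<le> M"
    using Suc.IH[of f'] D(2) f'0 f'_def by blast
  have int: "integrable lborel f" "integrable lborel f'"
    using integrable_continuous_vanishing[OF ridge_algebra_continuous[OF Suc.prems(1)]] Suc.prems(2)
      integrable_continuous_vanishing[OF ridge_algebra_continuous[OF D(2)[of 1]]] f'0
    unfolding f'_def by blast+
  have parts: "(LINT x|lborel. iexp (t * x) * f' x) = - (\<i> * t) * (LINT x|lborel. iexp (t * x) * f x)" for t
  proof -
    let ?g = "\<lambda>x. iexp (t * x) * f' x + \<i> * t * (iexp (t * x) * f x)"
    have cf: "continuous_on A f" "continuous_on A f'" for A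
      using ridge_algebra_continuous[OF Suc.prems(1)] ridge_algebra_continuous[OF D(2)[of 1]]
      by (auto simp: f'_def intro: continuous_on_subset)
    have "((\<lambda>x. iexp (t * x)) has_vector_derivative \<i> * t * iexp (t * x)) (at x)" for x
    proof -
      have "((\<lambda>z. exp (\<i> * of_real t * z)) has_field_derivative \<i> * t * exp (\<i> * of_real t * of_real x))
         (at (complex_of_real x))"
        by (auto intro!: derivative_eq_intros)
      from has_vector_derivative_real_field[OF this] show ?thesis by (simp add: mult_ac)
    qed
    from has_vector_derivative_mult[OF this f']
    have der: "((\<lambda>x. iexp (t * x) * f x) has_vector_derivative ?g x) (at x)" for x
      by (simp only: mult.assoc)
    have "has_bochner_integral lborel (\<lambda>x. indicator {-2..2} x *\<^sub>R ?g x)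
        (iexp (t * 2) * f 2 - iexp (t * (-2)) * f (-2))"
    proof (rule has_bochner_integral_FTC_Icc)
      show "((\<lambda>x. iexp (t * x) * f x) has_vector_derivative ?g x) (at x within {-2..2})" for x
        using der by (rule has_vector_derivative_at_within)
      show "continuous_on {-2..2} ?g"
        by (intro continuous_intros cf)
    qed simp
    moreover have "indicator {-2..2} x *\<^sub>R ?g x = ?g x" for x
      using Suc.prems(2)[of x] f'0[of x] by (auto simp: indicator_def)
    ultimately have "(LINT x|lborel. ?g x) = 0"
      using Suc.prems(2) by (simp add: has_bochner_integral_iff)
    moreover have "integrable lborel (\<lambda>x. iexp (t * x) * f' x)" "integrable lborel (\<lambda>x. iexp (t * x) * f x)"
      using int by (auto intro!: bounded_phase_integrable[where B = 1])
    ultimately have "(LINT x|lborel. iexp (t * x) * f' x) + \<i> * t * (LINT x|lborel. iexp (t * x) * f x) = 0"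
      by simp
    then show ?thesis
      by (metis eq_neg_iff_add_eq_0 mult_minus_left)
  qed
  have "\<bar>t\<bar> ^ Suc k * norm (LINT x|lborel. iexp (t * x) * f x) \<le> M" for t
    using M[of t] unfolding parts by (simp add: norm_mult mult_ac)
  then show ?case by blast
qed

text \<open>Gaussian regularisation. Inserting \<open>exp (- (\<epsilon> t)\<^sup>2 / 2)\<close> makes Fubini applicable; after the
substitution \<open>s = \<epsilon> t\<close> the weight is a standard normal density, whose characteristic function is
again Gaussian, and a second substitution turns the integral into \<open>2 \<pi>\<close> times the mean of
\<open>g (x + \<epsilon> u)\<close> over a standard normal \<open>u\<close>. This mean tends to \<open>g x\<close>.\<close>

lemma fourier_inversion_1d:
  fixes g :: "real \<Rightarrow> complex"
  defines "ghat \<equiv> \<lambda>t. LINT y|lborel. iexp (t * y) * g y"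
  assumes cont: "continuous_on UNIV g" and bdd: "\<And>y. norm (g y) \<le> B"
    and int: "integrable lborel g" and int_hat: "integrable lborel ghat"
  shows "(LINT t|lborel. iexp (- (t * x)) * ghat t) = of_real (2 * pi) * g x"
proof -
  let ?N = "std_normal_distribution"
  interpret N: real_distribution ?N by (rule real_dist_normal_dist)
  interpret P: pair_sigma_finite ?N "lborel :: real measure"
    by unfold_locales
  have gm [measurable]: "g \<in> borel_measurable borel" using int by auto
  have hm [measurable]: "ghat \<in> borel_measurable borel" using int_hat by auto
  define e where "e n = 1 / real (Suc n)" for n
  have e: "e n > 0" for n by (simp add: e_def)
  have e0: "e \<longlonglongrightarrow> 0" unfolding e_def by (rule LIMSEQ_Suc[OF lim_1_over_n])
  define J where "J n = (LINT t|lborel. exp (- ((e n * t)\<^sup>2) / 2) *\<^sub>R (iexp (- (t * x)) * ghat t))" for n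
  have lim1: "J \<longlonglongrightarrow> (LINT t|lborel. iexp (- (t * x)) * ghat t)"
    unfolding J_def
  proof (rule integral_dominated_convergence[where w = "\<lambda>t. norm (ghat t)"])
    show "AE t in lborel. (\<lambda>n. exp (- ((e n * t)\<^sup>2) / 2) *\<^sub>R (iexp (- (t * x)) * ghat t))
      \<longlonglongrightarrow> iexp (- (t * x)) * ghat t"
    proof (rule AE_I2)
      fix t
      have "(\<lambda>n. exp (- ((e n * t)\<^sup>2) / 2)) \<longlonglongrightarrow> exp (- ((0 * t)\<^sup>2) / 2)"
        by (intro tendsto_intros e0) simp
      then have "(\<lambda>n. exp (- ((e n * t)\<^sup>2) / 2) *\<^sub>R (iexp (- (t * x)) * ghat t))
          \<longlonglongrightarrow> exp (- ((0 * t)\<^sup>2) / 2) *\<^sub>R (iexp (- (t * x)) * ghat t)"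
        by (intro tendsto_scaleR tendsto_const)
      then show "(\<lambda>n. exp (- ((e n * t)\<^sup>2) / 2) *\<^sub>R (iexp (- (t * x)) * ghat t))
          \<longlonglongrightarrow> iexp (- (t * x)) * ghat t" by simp
    qed
  qed (use int_hat in \<open>auto simp: norm_mult intro!: mult_left_le_one_le\<close>)
  have J: "J n = of_real (2 * pi) * (LINT u|?N. g (x + e n * u))" for n
  proof -
    have "J n = (1 / e n) *\<^sub>R (LINT s|lborel. exp (- (s\<^sup>2) / 2) *\<^sub>R (iexp (- (s / e n * x)) * ghat (s / e n)))"
      unfolding J_def using e[of n]
      by (subst lborel_integral_real_affine[where c = "1 / e n" and t = 0]) auto
    also have "\<dots> = (1 / e n) *\<^sub>R (LINT s|lborel. sqrt (2 * pi) *\<^sub>R (std_normal_density s *\<^sub>R (iexp (- (s / e n * x)) * ghat (s / e n))))"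
      by (simp add: std_normal_density_def)
    also have "\<dots> = (sqrt (2 * pi) / e n) *\<^sub>R (LINT s|?N. iexp (- (s / e n * x)) * ghat (s / e n))"
      by (subst integral_density, simp, simp, simp, subst integral_scaleR_right)
        (simp only: scaleR_scaleR times_divide_eq_left mult_1)
    also have "(LINT s|?N. iexp (- (s / e n * x)) * ghat (s / e n)) =
        (LINT s|?N. LINT y|lborel. iexp (s * ((y - x) / e n)) * g y)"
    proof (rule Bochner_Integration.integral_cong)
      fix s
      have "iexp (- (s / e n * x)) * ghat (s / e n) =
          (LINT y|lborel. iexp (- (s / e n * x)) * (iexp (s / e n * y) * g y))"
        unfolding ghat_def by simp
      also have "\<dots> = (LINT y|lborel. iexp (s * ((y - x) / e n)) * g y)"
      proof (rule Bochner_Integration.integral_cong)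
        fix y
        have "s * ((y - x) / e n) = - (s / e n * x) + s / e n * y"
          by (simp add: diff_divide_distrib right_diff_distrib)
        then show "iexp (- (s / e n * x)) * (iexp (s / e n * y) * g y) = iexp (s * ((y - x) / e n)) * g y"
          by (simp only: of_real_add distrib_left exp_add mult.assoc)
      qed simp
      finally show "iexp (- (s / e n * x)) * ghat (s / e n) = (LINT y|lborel. iexp (s * ((y - x) / e n)) * g y)" .
    qed simp
    \<comment> \<open>The inner integral on the right is the characteristic function of the normal distribution.\<close>
    also have "\<dots> = (LINT y|lborel. LINT s|?N. iexp (s * ((y - x) / e n)) * g y)"
    proof (rule P.Fubini_integral[symmetric])
      show "integrable (?N \<Otimes>\<^sub>M lborel) (\<lambda>(s, y). iexp (s * ((y - x) / e n)) * g y)"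
      proof (rule P.Fubini_integrable)
        show "(\<lambda>(s, y). iexp (s * ((y - x) / e n)) * g y) \<in> borel_measurable (?N \<Otimes>\<^sub>M lborel)"
          by measurable
        show "integrable ?N (\<lambda>s. LINT y|lborel. norm (case (s, y) of (s, y) \<Rightarrow> iexp (s * ((y - x) / e n)) * g y))"
          by (simp add: norm_mult)
        show "AE s in ?N. integrable lborel (\<lambda>y. case (s, y) of (s, y) \<Rightarrow> iexp (s * ((y - x) / e n)) * g y)"
          using int by (auto intro!: bounded_phase_integrable[where B = 1])
      qed
    qed
    also have "\<dots> = (LINT y|lborel. char ?N ((y - x) / e n) * g y)"
      by (simp add: char_def mult.commute)
    also have "\<dots> = e n *\<^sub>R (LINT u|lborel. of_real (exp (- (u\<^sup>2) / 2)) * g (x + e n * u))"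
      unfolding char_std_normal_distribution using e[of n]
      by (subst lborel_integral_real_affine[where c = "e n" and t = x]) auto
    also have "(sqrt (2 * pi) / e n) *\<^sub>R \<dots> = sqrt (2 * pi) *\<^sub>R (LINT u|lborel. of_real (exp (- (u\<^sup>2) / 2)) * g (x + e n * u))"
      using e[of n] by simp
    also have "(LINT u|lborel. of_real (exp (- (u\<^sup>2) / 2)) * g (x + e n * u)) =
        (LINT u|lborel. sqrt (2 * pi) *\<^sub>R (std_normal_density u *\<^sub>R g (x + e n * u)))"
      by (simp add: std_normal_density_def scaleR_conv_of_real)
    also have "\<dots> = sqrt (2 * pi) *\<^sub>R (LINT u|?N. g (x + e n * u))"
      by (subst integral_density, simp, simp, simp, subst integral_scaleR_right) (rule refl)
    finally show ?thesis
      by (simp add: scaleR_conv_of_real mult.assoc[symmetric] flip: of_real_mult)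
  qed
  have "(\<lambda>n. LINT u|?N. g (x + e n * u)) \<longlonglongrightarrow> (LINT u|?N. g x)"
  proof (rule integral_dominated_convergence[where w = "\<lambda>_. B"])
    have "isCont g x" using cont by (simp add: continuous_on_eq_continuous_at)
    moreover have "(\<lambda>n. x + e n * u) \<longlonglongrightarrow> x" for u
      using tendsto_add[OF tendsto_const tendsto_mult[OF e0 tendsto_const], of x u] by simp
    ultimately show "AE u in ?N. (\<lambda>n. g (x + e n * u)) \<longlonglongrightarrow> g x"
      by (intro AE_I2 isCont_tendsto_compose[of _ g])
  qed (auto simp: bdd)
  then have "J \<longlonglongrightarrow> of_real (2 * pi) * g x"
    unfolding J using N.prob_space by (intro tendsto_mult tendsto_const) simp
  with lim1 show ?thesis by (rule LIMSEQ_unique)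
qed

definition bump_hat :: "real \<Rightarrow> complex" where
  "bump_hat t = (LINT x|lborel. iexp (t * x) * of_real (bump x))"

lemma bump_ridge_real: "(\<lambda>x. of_real (bump x)) \<in> ridge_algebra"
  using bump_ridge[of "1::real"] by simp

lemma bump_integrable: "integrable lborel (\<lambda>x. complex_of_real (bump x))"
  by (intro integrable_continuous_vanishing ridge_algebra_continuous bump_ridge_real)
    (simp add: bump_eq_0)

lemma bump_hat_decay: "\<exists>M\<ge>0. \<forall>t. norm (bump_hat t) \<le> M / (1 + t\<^sup>2)\<^sup>2"
proof -
  have *: "\<exists>M. \<forall>t. \<bar>t\<bar> ^ k * norm (bump_hat t) \<le> M" for k
    unfolding bump_hat_def
    by (rule ridge_algebra_fourier_decay[OF bump_ridge_real]) (simp add: bump_eq_0)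
  obtain A where A: "\<And>t. \<bar>t\<bar> ^ 0 * norm (bump_hat t) \<le> A" using *[of 0] by blast
  obtain B where B: "\<And>t. \<bar>t\<bar> ^ 4 * norm (bump_hat t) \<le> B" using *[of 4] by blast
  have "norm (bump_hat t) * (1 + t\<^sup>2)\<^sup>2 \<le> 2 * A + 2 * B" for t
  proof -
    have "(1 + t\<^sup>2)\<^sup>2 \<le> 2 + 2 * \<bar>t\<bar> ^ 4"
      using sum_squares_ge_zero[of "1 - t\<^sup>2" 0] by (simp add: power2_eq_square power4_eq_xxxx algebra_simps)
    then have "norm (bump_hat t) * (1 + t\<^sup>2)\<^sup>2 \<le> norm (bump_hat t) * (2 + 2 * \<bar>t\<bar> ^ 4)"
      by (intro mult_left_mono) auto
    also have "\<dots> \<le> 2 * A + 2 * B"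
      using A[of t] B[of t] by (simp add: algebra_simps)
    finally show ?thesis .
  qed
  then have "\<forall>t. norm (bump_hat t) \<le> (2 * A + 2 * B) / (1 + t\<^sup>2)\<^sup>2"
  proof (intro allI)
    fix t :: real
    assume *: "\<And>t. norm (bump_hat t) * (1 + t\<^sup>2)\<^sup>2 \<le> 2 * A + 2 * B"
    have "0 < 1 + t\<^sup>2" by (simp add: add_pos_nonneg)
    then show "norm (bump_hat t) \<le> (2 * A + 2 * B) / (1 + t\<^sup>2)\<^sup>2"
      using *[of t] by (simp add: pos_le_divide_eq)
  qed
  moreover have "0 \<le> 2 * A + 2 * B" using A[of 0] B[of 0] norm_ge_zero[of "bump_hat 0"] by (simp del: norm_ge_zero)
  ultimately show ?thesis by blast
qed

lemma bump_hat_measurable [measurable]: "bump_hat \<in> borel_measurable borel"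
proof -
  have [measurable]: "(\<lambda>x. complex_of_real (bump x)) \<in> borel_measurable borel"
    using bump_integrable by auto
  show ?thesis unfolding bump_hat_def by measurable
qed

lemma bump_hat_weighted_integrable: "integrable lborel (\<lambda>t. of_real (1 + t\<^sup>2) * bump_hat t)"
proof -
  obtain M where M: "M \<ge> 0" "\<And>t. norm (bump_hat t) \<le> M / (1 + t\<^sup>2)\<^sup>2"
    using bump_hat_decay by blast
  show ?thesis
  proof (rule Bochner_Integration.integrable_bound)
    show "integrable lborel (\<lambda>t::real. M * (1 / (1 + t\<^sup>2)))"
      by (intro integrable_mult_right integrable_one_over_one_plus_square)
    show "AE t in lborel. norm (of_real (1 + t\<^sup>2) * bump_hat t) \<le> norm (M * (1 / (1 + t\<^sup>2)))"
    proof (rule AE_I2)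
      fix t :: real
      have p: "1 + t\<^sup>2 > 0" by (simp add: add_pos_nonneg)
      have "norm (of_real (1 + t\<^sup>2) * bump_hat t) = (1 + t\<^sup>2) * norm (bump_hat t)"
        using p by (simp only: norm_mult norm_of_real abs_of_pos)
      also have "\<dots> \<le> (1 + t\<^sup>2) * (M / (1 + t\<^sup>2)\<^sup>2)"
        using p M(2)[of t] by (intro mult_left_mono) auto
      also have "\<dots> = M * (1 / (1 + t\<^sup>2))"
        using p by (simp add: power2_eq_square)
      finally show "norm (of_real (1 + t\<^sup>2) * bump_hat t) \<le> norm (M * (1 / (1 + t\<^sup>2)))"
        using M(1) p by simp
    qed
  qed simp
qed

lemma bump_hat_integrable: "integrable lborel bump_hat"
proof (rule Bochner_Integration.integrable_bound[OF bump_hat_weighted_integrable])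
  have "norm (of_real (1 + t\<^sup>2) * bump_hat t) = (1 + t\<^sup>2) * norm (bump_hat t)" for t
    by (simp only: norm_mult norm_of_real) (simp add: abs_of_nonneg)
  then show "AE t in lborel. norm (bump_hat t) \<le> norm (of_real (1 + t\<^sup>2) * bump_hat t)"
    by (intro AE_I2) (simp add: distrib_right)
qed simp

lemma bump_hat_inversion: "(LINT t|lborel. iexp (- (t * x)) * bump_hat t) = of_real (2 * pi * bump x)"
proof -
  have "(LINT t|lborel. iexp (- (t * x)) * (LINT y|lborel. iexp (t * y) * of_real (bump y)))
      = of_real (2 * pi) * of_real (bump x)"
    using bump_hat_integrable unfolding bump_hat_def
    by (intro fourier_inversion_1d[where B = 1] ridge_algebra_continuous bump_ridge_real bump_integrable)
      (simp add: abs_of_nonneg bump_bounds)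
  then show ?thesis by (simp add: bump_hat_def)
qed

section \<open>The bump function in several dimensions\<close>

text \<open>Lebesgue measure on \<open>\<real>\<^sup>n\<close> is the image of the product measure on the coordinates, so integrals of
tensor products factor. This transports the one-dimensional Fourier analysis of the bump to
\<open>\<real>\<^sup>n\<close>.\<close>

lemma
  fixes f :: "'n::finite \<Rightarrow> real \<Rightarrow> complex"
  assumes f: "\<And>i. integrable lborel (f i)"
  shows integrable_tensor: "integrable lborel (\<lambda>x::real^'n. \<Prod>i\<in>UNIV. f i (x $ i))"
    and integral_tensor:
      "(LINT x|lborel. (\<Prod>i\<in>UNIV. f i ((x::real^'n) $ i))) = (\<Prod>i\<in>UNIV. integral\<^sup>L lborel (f i))"
proof -
  interpret product_sigma_finite "\<lambda>b::real^'n. lborel :: real measure"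
    by standard
  let ?u = "\<lambda>i::'n. axis i (1::real)"
  have inj: "inj ?u" by (auto simp: inj_on_def axis_eq_axis)
  have B: "(Basis :: (real^'n) set) = range ?u" by (auto simp: Basis_vec_def)
  define f' where "f' b = f (inv ?u b)" for b
  have f': "f' (?u i) = f i" for i by (simp add: f'_def inv_f_f[OF inj])
  have [measurable]: "f i \<in> borel_measurable borel" for i using f[of i] by auto
  have [measurable]: "(\<lambda>x::real^'n. \<Prod>i\<in>UNIV. f i (x $ i)) \<in> borel_measurable borel"
    by measurable
  let ?s = "\<lambda>w::real^'n \<Rightarrow> real. \<Sum>b\<in>Basis. w b *\<^sub>R b"
  have eq: "(\<Prod>i\<in>UNIV. f i (?s w $ i)) = (\<Prod>b\<in>Basis. f' b (w b))" for w
  proof -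
    have "?s w $ i = w (?u i)" for i
      using inner_sum_left_Basis[of "?u i" w] B by (simp add: inner_axis)
    then show ?thesis
      unfolding B by (subst prod.reindex[OF inj]) (simp add: f')
  qed
  have int': "integrable lborel (f' b)" for b unfolding f'_def by (rule f)
  have "integrable (distr (\<Pi>\<^sub>M b\<in>Basis. lborel) borel ?s) (\<lambda>x::real^'n. \<Prod>i\<in>UNIV. f i (x $ i))"
    by (subst integrable_distr_eq, simp, simp, simp only: eq)
      (auto intro!: product_integrable_prod int')
  then show "integrable lborel (\<lambda>x::real^'n. \<Prod>i\<in>UNIV. f i (x $ i))"
    by (simp flip: lborel_eq)
  have "(LINT x|distr (\<Pi>\<^sub>M b\<in>Basis. lborel) borel ?s. (\<Prod>i\<in>UNIV. f i ((x::real^'n) $ i)))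
      = (LINT w|(\<Pi>\<^sub>M b\<in>Basis. lborel). (\<Prod>b\<in>Basis. f' b (w b)))"
    by (subst integral_distr, simp, simp, simp only: eq)
  also have "\<dots> = (\<Prod>b\<in>Basis. integral\<^sup>L lborel (f' b))"
    by (rule product_integral_prod) (auto intro: int')
  also have "\<dots> = (\<Prod>i\<in>UNIV. integral\<^sup>L lborel (f i))"
    unfolding B by (subst prod.reindex[OF inj]) (simp add: f')
  finally show "(LINT x|lborel. (\<Prod>i\<in>UNIV. f i ((x::real^'n) $ i))) = (\<Prod>i\<in>UNIV. integral\<^sup>L lborel (f i))"
    by (simp flip: lborel_eq)
qed

lemma one_plus_norm_square_le_prod:
  fixes x :: "real^'n"
  shows "1 + (norm x)\<^sup>2 \<le> (\<Prod>i\<in>UNIV. 1 + (x $ i)\<^sup>2)"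
proof -
  have "1 + (\<Sum>i\<in>I. (x $ i)\<^sup>2) \<le> (\<Prod>i\<in>I. 1 + (x $ i)\<^sup>2)" for I :: "'n set"
  proof (induction I rule: infinite_finite_induct)
    case (insert j I)
    have "1 + (\<Sum>i\<in>insert j I. (x $ i)\<^sup>2) \<le> (1 + (x $ j)\<^sup>2) * (1 + (\<Sum>i\<in>I. (x $ i)\<^sup>2))"
      using insert.hyps by (simp add: algebra_simps sum_nonneg)
    also have "\<dots> \<le> (1 + (x $ j)\<^sup>2) * (\<Prod>i\<in>I. 1 + (x $ i)\<^sup>2)"
      using insert.IH by (intro mult_left_mono) auto
    finally show ?case using insert.hyps by simp
  qed auto
  moreover have "(norm x)\<^sup>2 = (\<Sum>i\<in>UNIV. (x $ i)\<^sup>2)"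
    unfolding power2_norm_eq_inner inner_vec_def by (simp add: power2_eq_square)
  ultimately show ?thesis by simp
qed

lemma exp_inner_eq_prod:
  fixes x y :: "real^'n"
  shows "exp (\<i> * of_real (x \<bullet> y)) = (\<Prod>i\<in>UNIV. iexp (x $ i * y $ i))"
  by (simp add: inner_vec_def sum_distrib_left exp_sum)

definition cube_bump :: "real^'n \<Rightarrow> real" where
  "cube_bump x = (\<Prod>i\<in>UNIV. bump (x $ i))"

text \<open>The inverse Fourier transform of the cube bump in closed form: it factors over the coordinates.\<close>

definition cube_bump_hat :: "real^'n \<Rightarrow> complex" where
  "cube_bump_hat y = of_real (1 / (2 * pi) ^ CARD('n)) * (\<Prod>i\<in>UNIV. bump_hat (y $ i))"

lemma cube_bump_bounds: "0 \<le> cube_bump x" "cube_bump x \<le> 1"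
  unfolding cube_bump_def by (auto intro!: prod_nonneg prod_le_1 bump_bounds)

lemma cube_bump_eq_0:
  fixes x :: "real^'n"
  assumes "x \<notin> cball 0 (real CARD('n))" shows "cube_bump x = 0"
proof -
  have "\<exists>i. 1 \<le> \<bar>x $ i\<bar>"
  proof (rule ccontr)
    assume "\<nexists>i. 1 \<le> \<bar>x $ i\<bar>"
    then have "\<bar>x $ i\<bar> \<le> 1" for i by (meson linorder_not_le nle_le)
    then have "(\<Sum>i\<in>UNIV. \<bar>x $ i\<bar>) \<le> (\<Sum>i\<in>(UNIV::'n set). 1)"
      by (intro sum_mono)
    then have "norm x \<le> real CARD('n)"
      using norm_le_l1_cart[of x] by simp
    with assms show False by simp
  qed
  then show ?thesis
    unfolding cube_bump_def by (metis UNIV_I bump_eq_0 finite prod_zero_iff)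
qed

lemma cube_bump_lower:
  fixes x :: "real^'n"
  assumes "norm x \<le> 1/2" shows "exp (-4) ^ CARD('n) \<le> cube_bump x"
proof -
  have "\<bar>x $ i\<bar> \<le> 1/2" for i
    using component_le_norm_cart[of x i] assms by linarith
  then have "(\<Prod>i\<in>(UNIV::'n set). exp (-4)) \<le> cube_bump x"
    unfolding cube_bump_def by (intro prod_mono) (auto intro: bump_lower)
  then show ?thesis by simp
qed

lemma cube_bump_ridge: "(\<lambda>x::real^'n. of_real (cube_bump x)) \<in> ridge_algebra"
proof -
  have "(\<lambda>x::real^'n. of_real (bump (x $ i))) \<in> ridge_algebra" for i
    using bump_ridge[of "axis i 1 :: real^'n"] by (simp add: inner_axis)
  then have "(\<lambda>x::real^'n. \<Prod>i\<in>UNIV. of_real (bump (x $ i))) \<in> ridge_algebra"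
    by (intro ridge_algebra_prod) auto
  then show ?thesis by (simp add: cube_bump_def)
qed

lemma cube_bump_measurable [measurable]: "(cube_bump :: real^'n \<Rightarrow> real) \<in> borel_measurable borel"
proof -
  have "(\<lambda>x::real^'n. Re (of_real (cube_bump x))) \<in> borel_measurable borel"
    by (intro borel_measurable_continuous_onI continuous_intros ridge_algebra_continuous cube_bump_ridge)
  then show ?thesis by simp
qed

lemma cube_bump_hat_measurable [measurable]:
  "(cube_bump_hat :: real^'n \<Rightarrow> complex) \<in> borel_measurable borel"
  unfolding cube_bump_hat_def by measurable

lemma cube_bump_integrable: "integrable lborel (\<lambda>x::real^'n. complex_of_real (cube_bump x))"
  using integrable_tensor[OF bump_integrable] by (simp add: cube_bump_def)

lemma cube_bump_fourier:
  fixes y :: "real^'n"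
  shows "(LINT x|lborel. exp (\<i> * of_real (y \<bullet> x)) * of_real (cube_bump x))
    = of_real ((2 * pi) ^ CARD('n)) * cube_bump_hat y"
proof -
  have int: "integrable lborel (\<lambda>t. iexp (y $ i * t) * of_real (bump t))" for i
    by (intro bounded_phase_integrable[where B = 1] bump_integrable) auto
  have "(LINT x|lborel. exp (\<i> * of_real (y \<bullet> x)) * of_real (cube_bump x))
      = (LINT x|lborel. (\<Prod>i\<in>UNIV. iexp (y $ i * ((x::real^'n) $ i)) * of_real (bump (x $ i))))"
    by (simp only: exp_inner_eq_prod cube_bump_def prod.distrib of_real_prod)
  also have "\<dots> = (\<Prod>i\<in>UNIV. bump_hat (y $ i))"
    unfolding bump_hat_def by (rule integral_tensor[OF int])
  finally show ?thesis
    by (simp add: cube_bump_hat_def)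
qed

text \<open>The quadratic weight is needed because the multiplier is later compared with a constant up to an
error that grows quadratically in the frequency.\<close>

lemma cube_bump_hat_weighted_integrable:
  "integrable lborel (\<lambda>y::real^'n. of_real (1 + (norm y)\<^sup>2) * cube_bump_hat y)"
proof (rule Bochner_Integration.integrable_bound)
  show "integrable lborel (\<lambda>y::real^'n. of_real (1 / (2 * pi) ^ CARD('n)) *
      (\<Prod>i\<in>UNIV. of_real (1 + (y $ i)\<^sup>2) * bump_hat (y $ i)))"
    by (intro integrable_mult_right integrable_tensor bump_hat_weighted_integrable)
  show "AE y in lborel. norm (of_real (1 + (norm y)\<^sup>2) * cube_bump_hat (y::real^'n)) \<le>
    norm (of_real (1 / (2 * pi) ^ CARD('n)) *
      (\<Prod>i\<in>UNIV. of_real (1 + (y $ i)\<^sup>2) * bump_hat (y $ i)))"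
  proof (rule AE_I2)
    fix y :: "real^'n"
    have n: "norm (complex_of_real (1 + t\<^sup>2)) = 1 + t\<^sup>2" for t :: real
      by (simp only: norm_of_real) (simp add: abs_of_nonneg)
    show "norm (of_real (1 + (norm y)\<^sup>2) * cube_bump_hat (y::real^'n)) \<le>
      norm (of_real (1 / (2 * pi) ^ CARD('n)) *
        (\<Prod>i\<in>UNIV. of_real (1 + (y $ i)\<^sup>2) * bump_hat (y $ i)))"
      unfolding cube_bump_hat_def prod.distrib norm_mult prod_norm[symmetric] n
      using mult_right_mono[OF one_plus_norm_square_le_prod[of y],
        of "norm (complex_of_real (1 / (2 * pi) ^ CARD('n))) * (\<Prod>i\<in>UNIV. norm (bump_hat (y $ i)))"]
      by (simp only: mult.left_commute mult.assoc)
        (simp add: prod_nonneg mult_ac)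
  qed
qed simp

lemma cube_bump_hat_integrable: "integrable lborel (cube_bump_hat :: real^'n \<Rightarrow> complex)"
proof (rule Bochner_Integration.integrable_bound[OF cube_bump_hat_weighted_integrable])
  have "norm (of_real (1 + (norm y)\<^sup>2) * cube_bump_hat y) = (1 + (norm y)\<^sup>2) * norm (cube_bump_hat y)"
    for y :: "real^'n"
    by (simp only: norm_mult norm_of_real) (simp add: abs_of_nonneg)
  then show "AE y in lborel. norm (cube_bump_hat (y::real^'n)) \<le> norm (of_real (1 + (norm y)\<^sup>2) * cube_bump_hat y)"
    by (intro AE_I2) (simp add: distrib_right)
qed simp

lemma cube_bump_inversion:
  fixes x :: "real^'n"
  shows "(LINT y|lborel. exp (- \<i> * of_real (x \<bullet> y)) * cube_bump_hat y) = of_real (cube_bump x)"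
proof -
  have int: "integrable lborel (\<lambda>t. iexp (- (t * x $ i)) * bump_hat t)" for i
    by (intro bounded_phase_integrable[where B = 1] bump_hat_integrable) auto
  have "exp (- \<i> * of_real (x \<bullet> y)) * cube_bump_hat y = of_real (1 / (2 * pi) ^ CARD('n)) *
      (\<Prod>i\<in>UNIV. iexp (- (y $ i * (x $ i))) * bump_hat (y $ i))" for y :: "real^'n"
  proof -
    have "exp (- \<i> * of_real (x \<bullet> y)) = exp (\<i> * of_real ((- x) \<bullet> y))" by simp
    also have "\<dots> = (\<Prod>i\<in>UNIV. iexp (- (y $ i * (x $ i))))"
      unfolding exp_inner_eq_prod by (simp add: mult.commute)
    finally show ?thesis
      by (simp only: cube_bump_hat_def prod.distrib mult_ac)
  qed
  then have "(LINT y|lborel. exp (- \<i> * of_real (x \<bullet> y)) * cube_bump_hat y) =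
      of_real (1 / (2 * pi) ^ CARD('n)) *
      (LINT y|lborel. (\<Prod>i\<in>UNIV. iexp (- (y $ i * (x $ i))) * bump_hat ((y::real^'n) $ i)))"
    by (simp only: integral_mult_right_zero)
  also have "\<dots> = of_real (1 / (2 * pi) ^ CARD('n)) * (\<Prod>i\<in>UNIV. of_real (2 * pi * bump (x $ i)))"
    by (simp only: integral_tensor[OF int] bump_hat_inversion)
  also have "\<dots> = of_real (cube_bump x)"
    by (simp add: cube_bump_def prod.distrib)
  finally show ?thesis .
qed

lemma cube_bump_hat_decay: "\<exists>C\<ge>0. \<forall>y::real^'n. norm (cube_bump_hat y) \<le> C / (1 + (norm y)\<^sup>2)"
proof -
  obtain M where M: "M \<ge> 0" "\<And>t. norm (bump_hat t) \<le> M / (1 + t\<^sup>2)\<^sup>2"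
    using bump_hat_decay by blast
  define c where "c = norm (complex_of_real (1 / (2 * pi) ^ CARD('n)))"
  have "norm (cube_bump_hat y) \<le> (c * M ^ CARD('n)) / (1 + (norm y)\<^sup>2)" for y :: "real^'n"
  proof -
    have p: "1 + t\<^sup>2 > 0" for t :: real by (simp add: add_pos_nonneg)
    have b: "norm (bump_hat t) \<le> M / (1 + t\<^sup>2)" for t
    proof -
      have "M / (1 + t\<^sup>2)\<^sup>2 \<le> M / (1 + t\<^sup>2)"
        using M(1) p[of t] by (intro divide_left_mono) (auto simp: power2_eq_square)
      with M(2)[of t] show ?thesis by linarith
    qed
    have "norm (cube_bump_hat y) = c * (\<Prod>i\<in>UNIV. norm (bump_hat (y $ i)))"
      unfolding cube_bump_hat_def norm_mult prod_norm c_def ..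
    also have "\<dots> \<le> c * (\<Prod>i\<in>(UNIV::'n set). M / (1 + (y $ i)\<^sup>2))"
      by (intro mult_left_mono prod_mono) (auto simp: b c_def)
    also have "\<dots> = c * M ^ CARD('n) / (\<Prod>i\<in>UNIV. 1 + (y $ i)\<^sup>2)"
      by (simp add: prod_dividef)
    also have "\<dots> \<le> c * M ^ CARD('n) / (1 + (norm y)\<^sup>2)"
      using M(1) p by (intro divide_left_mono one_plus_norm_square_le_prod mult_pos_pos prod_pos)
        (auto simp: c_def)
    finally show ?thesis .
  qed
  moreover have "0 \<le> c * M ^ CARD('n)" using M(1) by (simp add: c_def)
  ultimately show ?thesis by blast
qed

section \<open>Asymptotics of the cut-off in a critical direction\<close>

lemma has_derivative_eventually_lipschitz:
  assumes "(f has_derivative f') (at x)"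
  shows "\<exists>K\<ge>0. \<forall>\<^sub>F v in nhds 0. norm (f (x + v) - f x) \<le> K * norm v"
proof -
  have bl: "bounded_linear f'" using assms by (rule has_derivative_bounded_linear)
  obtain d where d: "d > 0" "\<And>y. norm (y - x) < d \<Longrightarrow> norm (f y - f x - f' (y - x)) \<le> 1 * norm (y - x)"
    using assms unfolding has_derivative_at_alt by (meson zero_less_one)
  have "norm (f (x + v) - f x) \<le> (1 + onorm f') * norm v" if "norm v < d" for v
  proof -
    have "norm (f (x + v) - f x) \<le> norm (f (x + v) - f x - f' v) + norm (f' v)"
      by norm
    also have "\<dots> \<le> 1 * norm v + onorm f' * norm v"
      using d(2)[of "x + v"] that by (intro add_mono onorm[OF bl]) simp
    finally show ?thesis by (simp add: algebra_simps)
  qed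
  then have "\<forall>\<^sub>F v in nhds 0. norm (f (x + v) - f x) \<le> (1 + onorm f') * norm v"
    using d(1) by (auto simp: eventually_nhds_metric dist_norm intro!: exI[of _ d])
  then show ?thesis using onorm_pos_le[OF bl] by (intro exI[of _ "1 + onorm f'"]) auto
qed

lemma smooth_has_derivative:
  fixes f :: "real^'n \<Rightarrow> complex"
  assumes "smooth f"
  shows "(f has_derivative (\<lambda>v. \<Sum>i\<in>UNIV. v $ i *\<^sub>R partial_deriv i f x)) (at x)"
proof -
  have "partial_derivs [] f differentiable_on UNIV" using assms unfolding smooth_def by blast
  then obtain D where D: "(f has_derivative D) (at x)"
    by (auto simp: partial_derivs_def differentiable_on_def differentiable_def)
  have lin: "linear D" using D by (rule has_derivative_linear)
  have pd: "partial_deriv i f x = D (axis i 1)" for i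
    using D by (rule partial_deriv_eq_derivative)
  have "D v = (\<Sum>i\<in>UNIV. v $ i *\<^sub>R partial_deriv i f x)" for v
  proof -
    have "D v = D (\<Sum>i\<in>UNIV. v $ i *\<^sub>R axis i 1)"
      using basis_expansion[of v] by (simp add: scalar_mult_eq_scaleR)
    also have "\<dots> = (\<Sum>i\<in>UNIV. v $ i *\<^sub>R D (axis i 1))"
      by (simp add: linear_sum[OF lin] linear_scale[OF lin])
    finally show ?thesis by (simp add: pd)
  qed
  then have "D = (\<lambda>v. \<Sum>i\<in>UNIV. v $ i *\<^sub>R partial_deriv i f x)" by (rule ext)
  with D show ?thesis by simp
qed

text \<open>At an extremum the gradient vanishes, and since the partial derivatives are differentiable there,
the gradient grows at most linearly near that point. The mean value inequality on balls then gives a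
quadratic bound.\<close>

lemma smooth_extremum_quadratic:
  fixes f :: "real^'n \<Rightarrow> complex"
  assumes f: "smooth f" "\<And>x. f x \<in> \<real>"
    and S: "open S" "x0 \<in> S"
    and ext: "(\<forall>y\<in>S. Re (f y) \<le> Re (f x0)) \<or> (\<forall>y\<in>S. Re (f x0) \<le> Re (f y))"
  shows "\<exists>d>0. \<exists>C\<ge>0. \<forall>v. norm v \<le> d \<longrightarrow> norm (f (x0 + v) - f x0) \<le> C * (norm v)\<^sup>2"
proof -
  let ?g = "\<lambda>i x. Re (partial_deriv i f x)"
  have der: "((\<lambda>x. Re (f x)) has_derivative (\<lambda>v. \<Sum>i\<in>UNIV. v $ i * ?g i x)) (at x)" for x
    using has_derivative_Re[OF smooth_has_derivative[OF f(1)]] by simp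
  have "(\<lambda>v. \<Sum>i\<in>UNIV. v $ i * ?g i x0) = (\<lambda>v. 0)"
    by (rule differential_zero_maxmin[OF S(2,1) der ext])
  then have z: "(\<Sum>i\<in>UNIV. v $ i * ?g i x0) = 0" for v :: "real^'n" by meson
  have g0: "?g i x0 = 0" for i
    using z[of "axis i 1"] by (simp add: axis_def if_distrib if_distribR cong: if_cong)
  have "\<exists>K\<ge>0. \<forall>\<^sub>F v in nhds 0. \<bar>?g i (x0 + v)\<bar> \<le> K * norm v" for i
  proof -
    have "partial_derivs [i] f differentiable_on UNIV" using f(1) unfolding smooth_def by blast
    then obtain D where "(partial_deriv i f has_derivative D) (at x0)"
      by (auto simp: partial_derivs_def differentiable_on_def differentiable_def)
    from has_derivative_eventually_lipschitz[OF has_derivative_Re[OF this]]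
    show ?thesis by (simp add: g0)
  qed
  then obtain K where K: "\<And>i. K i \<ge> 0" "\<And>i. \<forall>\<^sub>F v in nhds 0. \<bar>?g i (x0 + v)\<bar> \<le> K i * norm v"
    by metis
  have "\<forall>\<^sub>F v in nhds 0. \<forall>i\<in>UNIV. \<bar>?g i (x0 + v)\<bar> \<le> K i * norm v"
    using K(2) by (intro eventually_ball_finite) auto
  then obtain d where d: "d > 0" "\<And>v i. norm v < d \<Longrightarrow> \<bar>?g i (x0 + v)\<bar> \<le> K i * norm v"
    by (auto simp: eventually_nhds_metric dist_norm)
  define C where "C = (\<Sum>i\<in>UNIV. K i)"
  have "norm (f (x0 + v) - f x0) \<le> C * (norm v)\<^sup>2" if v: "norm v \<le> d / 2" for v
  proof -
    have "norm (Re (f (x0 + v)) - Re (f x0)) \<le> C * norm v * norm ((x0 + v) - x0)"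
    proof (rule differentiable_bound[where S = "cball x0 (norm v)"])
      fix x assume x: "x \<in> cball x0 (norm v)"
      show "((\<lambda>x. Re (f x)) has_derivative (\<lambda>v. \<Sum>i\<in>UNIV. v $ i * ?g i x)) (at x within cball x0 (norm v))"
        using der by (rule has_derivative_at_withinI)
      have nx: "norm (x - x0) \<le> norm v" using x by (simp add: dist_norm norm_minus_commute)
      show "onorm (\<lambda>v. \<Sum>i\<in>UNIV. v $ i * ?g i x) \<le> C * norm v"
      proof (rule onorm_bound)
        show "0 \<le> C * norm v" using K(1) by (auto simp: C_def intro!: mult_nonneg_nonneg sum_nonneg)
        fix w :: "real^'n"
        have "norm (\<Sum>i\<in>UNIV. w $ i * ?g i x) \<le> (\<Sum>i\<in>UNIV. norm (w $ i * ?g i x))"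
          by (rule norm_sum)
        also have "\<dots> \<le> (\<Sum>i\<in>UNIV. norm w * (K i * norm v))"
        proof (rule sum_mono)
          fix i
          have "\<bar>?g i x\<bar> \<le> K i * norm (x - x0)"
            using d(2)[of "x - x0" i] nx v d(1) by simp
          also have "\<dots> \<le> K i * norm v" using nx K(1) by (rule mult_left_mono)
          finally show "norm (w $ i * ?g i x) \<le> norm w * (K i * norm v)"
            using component_le_norm_cart[of w i] by (simp add: abs_mult mult_mono)
        qed
        also have "\<dots> = C * norm v * norm w"
          by (simp add: C_def sum_distrib_left sum_distrib_right mult_ac)
        finally show "norm (\<Sum>i\<in>UNIV. w $ i * ?g i x) \<le> C * norm v * norm w" .
      qed
    qed (auto simp: dist_norm)
    moreover have "norm (f (x0 + v) - f x0) = \<bar>Re (f (x0 + v)) - Re (f x0)\<bar>"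
    proof -
      have "f (x0 + v) - f x0 = of_real (Re (f (x0 + v)) - Re (f x0))"
        using f(2)[of "x0 + v"] f(2)[of x0] by (simp add: complex_is_Real_iff complex_eq_iff)
      then show ?thesis by (simp only: norm_of_real)
    qed
    ultimately show ?thesis by (simp add: power2_eq_square mult_ac)
  qed
  moreover have "C \<ge> 0" using K(1) by (auto simp: C_def sum_nonneg)
  ultimately show ?thesis using d(1) by (intro exI[of _ "d / 2"]) auto
qed

text \<open>Homogeneity replaces the point \<open>\<zeta> + m e\<close> by \<open>2 R e + (2 R / m) \<zeta>\<close>, a perturbation of size
\<open>O(norm \<zeta> / m)\<close> of a critical point, so the multiplier deviates from its value there by
\<open>O((norm \<zeta> / m)\<^sup>2)\<close>. When the perturbation is not small, or \<open>m\<close> is bounded, the bound on the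
multiplier alone suffices. The square is what matters: \<open>1 / m\<^sup>2\<close> is summable whereas \<open>1 / m\<close>, the
rate at a point that is not critical, is not.\<close>

lemma homogeneous_extremum_asymptotics:
  fixes \<psi> :: "real^'n \<Rightarrow> complex"
  assumes \<psi>: "smooth \<psi>" "\<And>\<xi>. \<psi> \<xi> \<in> \<real>" "homogeneous0_outside R \<psi>"
    and R: "R > 0" and M: "\<And>\<xi>. norm (\<psi> \<xi>) \<le> M" and e: "norm e = 1"
    and ext: "(\<forall>\<xi>. R < norm \<xi> \<longrightarrow> Re (\<psi> \<xi>) \<le> Re (\<psi> ((2 * R) *\<^sub>R e))) \<or>
      (\<forall>\<xi>. R < norm \<xi> \<longrightarrow> Re (\<psi> ((2 * R) *\<^sub>R e)) \<le> Re (\<psi> \<xi>))"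
  shows "\<exists>C\<ge>0. \<forall>m>0. \<forall>\<zeta>. norm (\<psi> (\<zeta> + m *\<^sub>R e) - \<psi> ((2 * R) *\<^sub>R e)) \<le> C * (1 + (norm \<zeta>)\<^sup>2) / m\<^sup>2"
proof -
  let ?x = "(2 * R) *\<^sub>R e"
  have "open {\<xi>::real^'n. R < norm \<xi>}" by (intro open_Collect_less continuous_intros)
  then obtain d C where d: "d > 0" and C: "C \<ge> 0"
    and q: "\<And>v. norm v \<le> d \<Longrightarrow> norm (\<psi> (?x + v) - \<psi> ?x) \<le> C * (norm v)\<^sup>2"
    using smooth_extremum_quadratic[OF \<psi>(1,2), of "{\<xi>. R < norm \<xi>}" ?x] R e ext by auto
  \<comment> \<open>The cap \<open>R / 2\<close> keeps the perturbed point outside the ball of radius \<open>R\<close>.\<close>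
  define \<delta> where "\<delta> = min d (R / 2)"
  have \<delta>: "\<delta> > 0" "\<delta> \<le> d" "\<delta> \<le> R / 2" using d R by (auto simp: \<delta>_def)
  have M0: "M \<ge> 0" using M norm_ge_zero order_trans by blast
  define A where "A = max (4 * R\<^sup>2 * C) (max (2 * M * (4 * R\<^sup>2) / \<delta>\<^sup>2) (2 * M * (16 * R\<^sup>2)))"
  have A: "A \<ge> 0" "4 * R\<^sup>2 * C \<le> A" "2 * M * (4 * R\<^sup>2) / \<delta>\<^sup>2 \<le> A" "2 * M * (16 * R\<^sup>2) \<le> A"
    using C by (auto simp: A_def le_max_iff_disj)
  have crude: "norm (\<psi> a - \<psi> b) \<le> 2 * M" for a b
    using norm_triangle_ineq4[of "\<psi> a" "\<psi> b"] M[of a] M[of b] by linarith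
  have "norm (\<psi> (\<zeta> + m *\<^sub>R e) - \<psi> ?x) \<le> A * (1 + (norm \<zeta>)\<^sup>2) / m\<^sup>2" if m: "m > 0" for m \<zeta>
  proof -
    let ?v = "(2 * R / m) *\<^sub>R \<zeta>"
    have nv: "norm ?v = 2 * R * norm \<zeta> / m" using R m by simp
    have nv2: "(norm ?v)\<^sup>2 = 4 * R\<^sup>2 * (norm \<zeta>)\<^sup>2 / m\<^sup>2"
      unfolding nv by (simp add: power_divide power_mult_distrib)
    consider "m < 4 * R" | "norm ?v > \<delta>" | "m \<ge> 4 * R" "norm ?v \<le> \<delta>" by linarith
    then show ?thesis
    proof cases
      case 1
      have "2 * M * m\<^sup>2 \<le> 2 * M * (16 * R\<^sup>2)"
        using 1 m M0 power_mono[of m "4 * R" 2] by (intro mult_left_mono) (auto simp: power_mult_distrib)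
      also have "\<dots> \<le> A * (1 + (norm \<zeta>)\<^sup>2)"
        using A(1,4) mult_left_mono[of 1 "1 + (norm \<zeta>)\<^sup>2" A] by simp
      finally have "2 * M \<le> A * (1 + (norm \<zeta>)\<^sup>2) / m\<^sup>2"
        using m by (simp add: pos_le_divide_eq)
      with crude[of "\<zeta> + m *\<^sub>R e" ?x] show ?thesis by linarith
    next
      case 2
      have "\<delta>\<^sup>2 \<le> (norm ?v)\<^sup>2" using 2 \<delta> by (intro power_mono) auto
      then have "2 * M \<le> 2 * M * ((norm ?v)\<^sup>2 / \<delta>\<^sup>2)"
        using M0 \<delta>(1) mult_left_mono[of 1 "(norm ?v)\<^sup>2 / \<delta>\<^sup>2" "2 * M"] by simp
      also have "\<dots> = (2 * M * (4 * R\<^sup>2) / \<delta>\<^sup>2) * (norm \<zeta>)\<^sup>2 / m\<^sup>2"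
        unfolding nv2 by (simp add: mult_ac)
      also have "\<dots> \<le> A * (1 + (norm \<zeta>)\<^sup>2) / m\<^sup>2"
        using A(1,3) by (intro divide_right_mono mult_mono) auto
      finally show ?thesis using crude[of "\<zeta> + m *\<^sub>R e" ?x] by linarith
    next
      case 3
      have eq: "\<zeta> + m *\<^sub>R e = (m / (2 * R)) *\<^sub>R (?x + ?v)"
        using R m by (simp add: scaleR_add_right)
      have "norm (?x + ?v) \<ge> norm ?x - norm ?v"
        using norm_triangle_ineq2[of ?x "- ?v"] by simp
      moreover have "norm ?x = 2 * R" using R e by simp
      ultimately have "norm (?x + ?v) > R" using 3(2) \<delta>(3) R by linarith
      moreover have "m / (2 * R) > 1" using 3(1) R by (simp add: field_simps)
      ultimately have hom: "\<psi> (\<zeta> + m *\<^sub>R e) = \<psi> (?x + ?v)"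
        using \<psi>(3) unfolding homogeneous0_outside_def eq by blast
      have "norm ?v \<le> d" using 3(2) \<delta>(2) by linarith
      then have "norm (\<psi> (\<zeta> + m *\<^sub>R e) - \<psi> ?x) \<le> C * (norm ?v)\<^sup>2"
        unfolding hom by (rule q)
      also have "\<dots> = (4 * R\<^sup>2 * C) * (norm \<zeta>)\<^sup>2 / m\<^sup>2"
        unfolding nv2 by simp
      also have "\<dots> \<le> A * (1 + (norm \<zeta>)\<^sup>2) / m\<^sup>2"
        using A(1,2) by (intro divide_right_mono mult_mono) auto
      finally show ?thesis .
    qed
  qed
  with A(1) show ?thesis by blast
qed

text \<open>If both \<open>x\<close> and \<open>- x\<close> lie in \<open>V\<close>, the dual cone is contained in the hyperplane orthogonal to \<open>x\<close>,
which has empty interior unless \<open>x = 0\<close>.\<close>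

lemma open_cone_disjoint_uminus:
  fixes V :: "'a::euclidean_space set"
  assumes "interior (dual_cone V) \<noteq> {}" "x \<in> V" "- x \<in> V"
  shows "x = 0"
proof -
  have orth: "y \<bullet> x = 0" if "y \<in> dual_cone V" for y
  proof -
    have "0 \<le> y \<bullet> x" "0 \<le> y \<bullet> (- x)"
      using that assms(2,3) unfolding dual_cone_def by blast+
    then show ?thesis by simp
  qed
  obtain y r where "r > 0" "ball y r \<subseteq> dual_cone V"
    using assms(1) by (auto simp: mem_interior)
  then have y: "y \<in> dual_cone V" "\<And>z. norm z < r \<Longrightarrow> y + z \<in> dual_cone V"
    by (auto simp: subset_iff dist_norm)
  show "x = 0"
  proof (rule ccontr)
    assume "x \<noteq> 0"
    let ?z = "(r / (2 * norm x)) *\<^sub>R x"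
    have "y + ?z \<in> dual_cone V" using \<open>x \<noteq> 0\<close> \<open>r > 0\<close> by (intro y(2)) simp
    from orth[OF this] orth[OF y(1)] have "?z \<bullet> x = 0" by (simp add: inner_add_left)
    with \<open>x \<noteq> 0\<close> \<open>r > 0\<close> show False by simp
  qed
qed

lemma homogeneous0_radial:
  assumes "homogeneous0_outside R \<psi>" "R > 0" "norm \<xi> > R"
  shows "\<psi> \<xi> = \<psi> ((2 * R / norm \<xi>) *\<^sub>R \<xi>)"
proof -
  let ?\<eta> = "(2 * R / norm \<xi>) *\<^sub>R \<xi>"
  have n: "norm ?\<eta> = 2 * R" using assms(2,3) by auto
  have h: "\<And>\<xi> l. norm \<xi> > R \<Longrightarrow> l > 1 \<Longrightarrow> \<psi> (l *\<^sub>R \<xi>) = \<psi> \<xi>"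
    using assms(1) by (auto simp: homogeneous0_outside_def)
  consider "norm \<xi> < 2 * R" | "norm \<xi> = 2 * R" | "norm \<xi> > 2 * R" by linarith
  then show ?thesis
  proof cases
    case 1
    moreover have "0 < norm \<xi>" using assms(2,3) by linarith
    ultimately have "2 * R / norm \<xi> > 1" by (simp add: pos_less_divide_eq)
    then show ?thesis using h[OF assms(3)] by simp
  next
    case 2
    then show ?thesis using assms by simp
  next
    case 3
    then have l: "norm \<xi> / (2 * R) > 1" using assms by (simp add: field_simps)
    have "(norm \<xi> / (2 * R)) *\<^sub>R ?\<eta> = \<xi>" using assms by simp
    with h[of ?\<eta>, OF _ l] n assms(2) show ?thesis by simp
  qed
qed

text \<open>The direction \<open>e\<close> is chosen where the cut-off is maximal on a sphere. The maximum \<open>c\<close> is positive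
because the cut-off is a positive constant on the far part of \<open>V\<^sub>0\<close>. Hence \<open>e\<close> points into \<open>V\<close>, so
that \<open>- e\<close> does not, and the cut-off takes its minimum 0 in the direction \<open>- e\<close>. Both directions are
therefore critical, which is not guaranteed for a direction taken from \<open>V\<^sub>0\<close>.\<close>

lemma smooth_cutoff_asymptotics:
  fixes V\<^sub>0 V :: "(real^'n) set" and \<psi> :: "real^'n \<Rightarrow> complex"
  assumes V0: "pos_cone V\<^sub>0" "V\<^sub>0 - {0} \<noteq> {}"
    and cut: "smooth_cutoff V\<^sub>0 V \<psi>"
    and dual: "interior (dual_cone V) \<noteq> {}"
  obtains e c C where "norm e = 1" "(c::real) > 0" "C \<ge> 0"
    "\<And>\<xi>. norm (\<psi> \<xi>) \<le> C"
    "\<And>m \<zeta>. m > 0 \<Longrightarrow> norm (\<psi> (\<zeta> + m *\<^sub>R e) - of_real c) \<le> C * (1 + (norm \<zeta>)\<^sup>2) / m\<^sup>2"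
    "\<And>m \<zeta>. m > 0 \<Longrightarrow> norm (\<psi> (\<zeta> - m *\<^sub>R e)) \<le> C * (1 + (norm \<zeta>)\<^sup>2) / m\<^sup>2"
proof -
  obtain R c0 where sm: "smooth \<psi>" and nonneg: "\<And>\<xi>. \<psi> \<xi> \<in> \<real>\<^sub>\<ge>\<^sub>0" and supp: "supp \<psi> \<subseteq> V"
    and R: "R > 0" and hom: "homogeneous0_outside R \<psi>" and c0: "c0 > 0"
    and const: "\<And>\<xi>. \<xi> \<in> V\<^sub>0 - cball 0 R \<Longrightarrow> \<psi> \<xi> = of_real c0"
    using cut unfolding smooth_cutoff_def by auto
  have real: "\<psi> \<xi> \<in> \<real>" and Re0: "0 \<le> Re (\<psi> \<xi>)" for \<xi>
    using nonneg[of \<xi>] by (auto elim: nonneg_Reals_cases)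
  have psi_Re: "\<psi> \<xi> = of_real (Re (\<psi> \<xi>))" for \<xi> using real[of \<xi>] by simp
  have cont: "continuous_on A \<psi>" for A
    using smooth_has_derivative[OF sm]
    by (meson continuous_at_imp_continuous_on has_derivative_continuous)
  let ?S = "sphere (0::real^'n) (2 * R)"
  have rad: "(2 * R / norm \<xi>) *\<^sub>R \<xi> \<in> ?S" if "\<xi> \<noteq> 0" for \<xi> :: "real^'n"
    using that R by simp
  obtain v where v: "v \<in> V\<^sub>0" "v \<noteq> 0" using V0(2) by blast
  have "?S \<noteq> {}" using rad[OF v(2)] by blast
  moreover have "continuous_on ?S (\<lambda>y. Re (\<psi> y))" by (intro continuous_intros cont)
  ultimately have "\<exists>x\<in>?S. \<forall>y\<in>?S. Re (\<psi> y) \<le> Re (\<psi> x)"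
    by (intro continuous_attains_sup compact_sphere)
  then obtain x where x: "x \<in> ?S" and max: "\<And>y. y \<in> ?S \<Longrightarrow> Re (\<psi> y) \<le> Re (\<psi> x)"
    by blast
  define e where "e = (1 / (2 * R)) *\<^sub>R x"
  define c where "c = Re (\<psi> x)"
  have e: "norm e = 1" and xe: "(2 * R) *\<^sub>R e = x" using x R by (auto simp: e_def)
  have "(2 * R / norm v) *\<^sub>R v \<in> V\<^sub>0" using V0(1) v R by (simp add: pos_cone_def)
  then have "\<psi> ((2 * R / norm v) *\<^sub>R v) = of_real c0"
    using const rad[OF v(2)] R by auto
  then have c: "c > 0" using max[OF rad[OF v(2)]] c0 by (simp add: c_def)
  have max': "Re (\<psi> \<xi>) \<le> c" if "R < norm \<xi>" for \<xi>
    using homogeneous0_radial[OF hom R that] max[OF rad[of \<xi>]] that R by (force simp: c_def)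
  have "bounded (\<psi> ` cball 0 (2 * R))"
    by (intro compact_imp_bounded compact_continuous_image cont compact_cball)
  then obtain B where "\<forall>z \<in> \<psi> ` cball 0 (2 * R). norm z \<le> B"
    unfolding bounded_iff by blast
  then have B: "norm (\<psi> y) \<le> B" if "y \<in> cball 0 (2 * R)" for y using that by blast
  have bd: "norm (\<psi> \<xi>) \<le> max B c" for \<xi>
  proof (cases "norm \<xi> \<le> 2 * R")
    case True
    then show ?thesis using B[of \<xi>] by simp
  next
    case False
    then have "Re (\<psi> \<xi>) \<le> c" using max' R by simp
    moreover have "norm (\<psi> \<xi>) = Re (\<psi> \<xi>)"
      using psi_Re[of \<xi>] Re0[of \<xi>] by (metis abs_of_nonneg norm_of_real)
    ultimately show ?thesis by simp
  qed
  have in_V: "y \<in> V" if "\<psi> y \<noteq> 0" for y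
    using that supp closure_subset[of "{\<xi>. \<psi> \<xi> \<noteq> 0}"] unfolding supp_def by blast
  have "\<psi> x \<noteq> 0" using c by (auto simp: c_def)
  then have "x \<in> V" by (rule in_V)
  moreover have "x \<noteq> 0" using x R by auto
  ultimately have "- x \<notin> V" using open_cone_disjoint_uminus[OF dual] by blast
  then have neg: "\<psi> (- x) = 0" using in_V by blast
  obtain C1 where C1: "C1 \<ge> 0" "\<And>m \<zeta>. m > 0 \<Longrightarrow> norm (\<psi> (\<zeta> + m *\<^sub>R e) - \<psi> x) \<le> C1 * (1 + (norm \<zeta>)\<^sup>2) / m\<^sup>2"
    using homogeneous_extremum_asymptotics[OF sm real hom R bd e] max' unfolding xe c_def by blast
  have "norm (- e) = 1" "(2 * R) *\<^sub>R (- e) = - x" using e xe by auto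
  from homogeneous_extremum_asymptotics[OF sm real hom R bd this(1), unfolded this(2)]
  obtain C2 where C2: "C2 \<ge> 0" "\<And>m \<zeta>. m > 0 \<Longrightarrow> norm (\<psi> (\<zeta> - m *\<^sub>R e)) \<le> C2 * (1 + (norm \<zeta>)\<^sup>2) / m\<^sup>2"
    using Re0 neg by auto
  define C where "C = max (max B c) (max C1 C2)"
  have up: "norm z \<le> C * (1 + (norm \<zeta>)\<^sup>2) / m\<^sup>2"
    if "norm z \<le> D * (1 + (norm \<zeta>)\<^sup>2) / m\<^sup>2" "D \<le> C" "m > 0" for z :: complex and D m and \<zeta> :: "real^'n"
  proof -
    have "D * (1 + (norm \<zeta>)\<^sup>2) / m\<^sup>2 \<le> C * (1 + (norm \<zeta>)\<^sup>2) / m\<^sup>2"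
      using that by (intro divide_right_mono mult_right_mono) auto
    with that show ?thesis by linarith
  qed
  have CC: "max B c \<le> C" "C1 \<le> C" "C2 \<le> C" by (auto simp: C_def)
  show ?thesis
  proof (rule that[of e c C])
    show "norm (\<psi> \<xi>) \<le> C" for \<xi> using bd[of \<xi>] CC by linarith
    show "norm (\<psi> (\<zeta> + m *\<^sub>R e) - of_real c) \<le> C * (1 + (norm \<zeta>)\<^sup>2) / m\<^sup>2" if "m > 0" for m \<zeta>
      using up[OF C1(2)[OF that] CC(2) that] psi_Re[of x] by (simp add: c_def)
    show "norm (\<psi> (\<zeta> - m *\<^sub>R e)) \<le> C * (1 + (norm \<zeta>)\<^sup>2) / m\<^sup>2" if "m > 0" for m \<zeta>
      using up[OF C2(2)[OF that] CC(3) that] .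
  qed (use e c C1(1) CC in auto)
qed

section \<open>Action of the multiplier on localised waves\<close>

lemma integral_lborel_translate:
  fixes f :: "'a::euclidean_space \<Rightarrow> 'b::{banach, second_countable_topology}"
  assumes "f \<in> borel_measurable borel"
  shows "(LINT x|lborel. f x) = (LINT x|lborel. f (c + x))"
  by (subst lborel_distr_plus[of c, symmetric], subst integral_distr) (use assms in auto)

definition wave :: "real^'n \<Rightarrow> int \<Rightarrow> real^'n \<Rightarrow> complex" where
  "wave e k x = exp (\<i> * of_real (of_int k * (x \<bullet> e)))"

definition wave_sum :: "real^'n \<Rightarrow> int set \<Rightarrow> (int \<Rightarrow> complex) \<Rightarrow> real^'n \<Rightarrow> complex" where
  "wave_sum e I a x = (\<Sum>k\<in>I. a k * wave e k x)"

lemma norm_wave [simp]: "norm (wave e k x) = 1"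
  unfolding wave_def by (rule norm_exp_i_times)

lemma wave_measurable [measurable]: "wave e k \<in> borel_measurable borel"
  unfolding wave_def by measurable

lemma wave_sum_measurable [measurable]: "wave_sum e I a \<in> borel_measurable borel"
  unfolding wave_sum_def by measurable

text \<open>Trigonometric polynomials in the direction \<open>e\<close>, localised by the bump, are the only test functions
that the proof uses.\<close>

definition test_wave :: "real^'n \<Rightarrow> int set \<Rightarrow> (int \<Rightarrow> complex) \<Rightarrow> real^'n \<Rightarrow> complex" where
  "test_wave e I a x = of_real (cube_bump x) * wave_sum e I a x"

lemma test_wave_measurable [measurable]: "test_wave e I a \<in> borel_measurable borel"
  unfolding test_wave_def by measurable

lemma norm_test_wave_le:
  assumes a: "\<And>k. norm (a k) \<le> 1"
  shows "norm (test_wave e I a x) \<le> real (card I)"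
proof -
  have "norm (wave_sum e I a x) \<le> (\<Sum>k\<in>I. 1)"
    unfolding wave_sum_def by (rule sum_norm_le) (simp add: norm_mult a)
  then have "norm (complex_of_real (cube_bump x)) * norm (wave_sum e I a x) \<le> 1 * real (card I)"
    using cube_bump_bounds[of x] by (intro mult_mono) auto
  then show ?thesis by (simp add: test_wave_def norm_mult)
qed

lemma test_wave_integrable:
  fixes e :: "real^'n"
  assumes a: "\<And>k. norm (a k) \<le> 1"
  shows "integrable lborel (test_wave e I a)"
proof -
  have "norm (wave_sum e I a x) \<le> (\<Sum>k\<in>I. 1)" for x
    unfolding wave_sum_def by (rule sum_norm_le) (simp add: norm_mult a)
  then have "integrable lborel (\<lambda>x. wave_sum e I a x * of_real (cube_bump x))"
    by (intro bounded_phase_integrable[OF cube_bump_integrable]) auto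
  then show ?thesis by (simp add: test_wave_def[abs_def] mult.commute)
qed

lemma test_wave_test_function:
  fixes e :: "real^'n"
  assumes "finite I" shows "test_wave e I a \<in> test_functions"
proof -
  have "(\<lambda>x. wave_sum e I a x) \<in> ridge_algebra"
    unfolding wave_sum_def wave_def
    by (intro ridge_algebra_sum ridge_algebra.mult ridge_algebra_const ridge_algebra_exp assms)
  then have "(\<lambda>x. test_wave e I a x) \<in> ridge_algebra"
    unfolding test_wave_def by (intro ridge_algebra.mult cube_bump_ridge)
  then have "smooth (test_wave e I a)" by (intro ridge_algebra_smooth) simp
  moreover have "supp (test_wave e I a) \<subseteq> cball 0 (real CARD('n))"
    unfolding supp_def
  proof (rule closure_minimal)
    show "{x. test_wave e I a x \<noteq> 0} \<subseteq> cball 0 (real CARD('n))"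
      using cube_bump_eq_0[where 'n = 'n] unfolding test_wave_def by fastforce
  qed simp
  then have "compact (supp (test_wave e I a))"
    by (auto simp: compact_eq_bounded_closed supp_def intro: bounded_subset[OF bounded_cball])
  ultimately show ?thesis by (simp add: test_functions_def)
qed

lemma inv_fourier_test_wave:
  fixes e :: "real^'n"
  assumes "finite I"
  shows "inv_fourier (test_wave e I a) y = (\<Sum>k\<in>I. a k * cube_bump_hat (y + of_int k *\<^sub>R e))"
proof -
  let ?E = "\<lambda>k x. exp (\<i> * of_real ((y + of_int k *\<^sub>R e) \<bullet> x)) * complex_of_real (cube_bump x)"
  have eq: "exp (\<i> * of_real (y \<bullet> x)) * test_wave e I a x = (\<Sum>k\<in>I. a k * ?E k x)" for x
    unfolding test_wave_def wave_sum_def wave_def sum_distrib_left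
  proof (intro sum.cong refl)
    fix k
    have "exp (\<i> * of_real ((y + of_int k *\<^sub>R e) \<bullet> x)) =
        exp (\<i> * of_real (y \<bullet> x)) * exp (\<i> * of_real (of_int k * (x \<bullet> e)))"
    proof -
      have "(y + of_int k *\<^sub>R e) \<bullet> x = y \<bullet> x + of_int k * (x \<bullet> e)"
        by (simp add: inner_add_left inner_commute[of e x])
      then show ?thesis by (simp only: of_real_add distrib_left exp_add)
    qed
    then show "exp (\<i> * of_real (y \<bullet> x)) * (of_real (cube_bump x) *
        (a k * exp (\<i> * of_real (of_int k * (x \<bullet> e))))) = a k * ?E k x"
      by (simp only: mult_ac)
  qed
  have int: "integrable lborel (\<lambda>x. a k * ?E k x)" for k
  proof (intro integrable_mult_right bounded_phase_integrable[where B = 1] cube_bump_integrable)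
    show "(\<lambda>x. exp (\<i> * of_real ((y + of_int k *\<^sub>R e) \<bullet> x))) \<in> borel_measurable lborel" by measurable
  qed (simp only: norm_exp_i_times order_refl)
  have "(LINT x|lebesgue. exp (\<i> * of_real (y \<bullet> x)) * test_wave e I a x)
      = (LINT x|lborel. exp (\<i> * of_real (y \<bullet> x)) * test_wave e I a x)"
    unfolding test_wave_def by (intro integral_completion) measurable
  also have "\<dots> = (\<Sum>k\<in>I. a k * (LINT x|lborel. ?E k x))"
    unfolding eq by (subst Bochner_Integration.integral_sum[OF int]) simp
  also have "\<dots> = (\<Sum>k\<in>I. a k * (of_real ((2 * pi) ^ CARD('n)) * cube_bump_hat (y + of_int k *\<^sub>R e)))"
    unfolding cube_bump_fourier ..
  finally show ?thesis
    by (simp add: inv_fourier_def sum_distrib_left mult_ac)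
qed

text \<open>This is the transposed multiplier, with the symbol shifted by \<open>b\<close>, applied to the bump: multiplying
the bump by a wave of frequency \<open>k\<close> amounts to shifting the symbol by \<open>k e\<close>.\<close>

definition symbol_mean :: "(real^'n \<Rightarrow> complex) \<Rightarrow> real^'n \<Rightarrow> real^'n \<Rightarrow> complex" where
  "symbol_mean \<psi> b x = (LINT z|lborel. exp (- \<i> * of_real (x \<bullet> z)) * (\<psi> (z - b) * cube_bump_hat z))"

lemma symbol_mean_integrable:
  fixes \<psi> :: "real^'n \<Rightarrow> complex"
  assumes \<psi> [measurable]: "\<psi> \<in> borel_measurable borel" and C: "\<And>\<xi>. norm (\<psi> \<xi>) \<le> C"
  shows "integrable lborel (\<lambda>z. exp (- \<i> * of_real (x \<bullet> z)) * (\<psi> (z - b) * cube_bump_hat z))"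
proof (rule bounded_phase_integrable[where B = 1])
  show "integrable lborel (\<lambda>z. \<psi> (z - b) * cube_bump_hat z)"
    by (rule bounded_phase_integrable[OF cube_bump_hat_integrable _ C]) measurable
  show "norm (exp (- \<i> * of_real (x \<bullet> z))) \<le> 1" for z
    using norm_exp_i_times[of "- (x \<bullet> z)"] by simp
qed measurable

lemma symbol_mean_measurable [measurable]:
  fixes \<psi> :: "real^'n \<Rightarrow> complex"
  assumes \<psi> [measurable]: "\<psi> \<in> borel_measurable borel"
  shows "symbol_mean \<psi> b \<in> borel_measurable borel"
  unfolding symbol_mean_def by measurable

lemma fourier_multiplier_test_wave:
  fixes \<psi> :: "real^'n \<Rightarrow> complex"
  assumes I: "finite I" and \<psi> [measurable]: "\<psi> \<in> borel_measurable borel"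
    and C: "\<And>\<xi>. norm (\<psi> \<xi>) \<le> C"
  shows "fourier (\<lambda>\<xi>. \<psi> \<xi> * inv_fourier (test_wave e I a) \<xi>) x =
    (\<Sum>k\<in>I. a k * (wave e k x * symbol_mean \<psi> (of_int k *\<^sub>R e) x))"
proof -
  let ?F = "\<lambda>k z. exp (- \<i> * of_real (z \<bullet> x)) * (\<psi> z * cube_bump_hat (z + of_int k *\<^sub>R e))"
  have eq: "exp (- \<i> * of_real (z \<bullet> x)) * (\<psi> z * inv_fourier (test_wave e I a) z) = (\<Sum>k\<in>I. a k * ?F k z)" for z
    unfolding inv_fourier_test_wave[OF I] sum_distrib_left
    by (intro sum.cong refl) (simp only: mult_ac)
  let ?G = "\<lambda>k z. exp (- \<i> * of_real (x \<bullet> z)) * (\<psi> (z - of_int k *\<^sub>R e) * cube_bump_hat z)"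
  have shift: "?F k (- (of_int k *\<^sub>R e) + z) = wave e k x * ?G k z" for k z
  proof -
    have "exp (- \<i> * of_real ((- (of_int k *\<^sub>R e) + z) \<bullet> x)) = exp (\<i> * of_real (of_int k * (x \<bullet> e))) * exp (- \<i> * of_real (x \<bullet> z))"
    proof -
      have "- ((- (of_int k *\<^sub>R e) + z) \<bullet> x) = of_int k * (x \<bullet> e) + - (x \<bullet> z)"
        by (simp add: inner_commute[of _ x] inner_diff_right)
      then have "exp (\<i> * of_real (- ((- (of_int k *\<^sub>R e) + z) \<bullet> x))) =
          exp (\<i> * of_real (of_int k * (x \<bullet> e))) * exp (\<i> * of_real (- (x \<bullet> z)))"
        by (simp only: of_real_add distrib_left exp_add)
      then show ?thesis by (simp only: of_real_minus mult_minus_right mult_minus_left)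
    qed
    then show ?thesis by (simp add: wave_def)
  qed
  have m: "?F k \<in> borel_measurable borel" for k by measurable
  have int: "integrable lborel (?F k)" for k
  proof -
    have "integrable lborel (\<lambda>z. wave e k x * ?G k z)"
      using C by (intro integrable_mult_right symbol_mean_integrable \<psi>)
    then have "integrable lborel (\<lambda>z. ?F k (- (of_int k *\<^sub>R e) + z))" by (simp only: shift)
    then have "integrable (distr lborel borel ((+) (- (of_int k *\<^sub>R e)))) (?F k)"
      by (subst integrable_distr_eq) (use m in auto)
    then show ?thesis by (simp only: lborel_distr_plus)
  qed
  have val: "(LINT z|lborel. ?F k z) = wave e k x * symbol_mean \<psi> (of_int k *\<^sub>R e) x" for k
    by (subst integral_lborel_translate[OF m, of k "- (of_int k *\<^sub>R e)"])
      (simp only: shift symbol_mean_def integral_mult_right_zero)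
  have "fourier (\<lambda>\<xi>. \<psi> \<xi> * inv_fourier (test_wave e I a) \<xi>) x = (LINT z|lebesgue. (\<Sum>k\<in>I. a k * ?F k z))"
    unfolding fourier_def eq ..
  also have "\<dots> = (LINT z|lborel. (\<Sum>k\<in>I. a k * ?F k z))"
    by (intro integral_completion) measurable
  also have "\<dots> = (\<Sum>k\<in>I. LINT z|lborel. a k * ?F k z)"
    by (intro Bochner_Integration.integral_sum integrable_mult_right int)
  also have "\<dots> = (\<Sum>k\<in>I. a k * (wave e k x * symbol_mean \<psi> (of_int k *\<^sub>R e) x))"
    by (simp only: integral_mult_right_zero val)
  finally show ?thesis .
qed

lemma sum_int_interval_inverse_square_bounded:
  "\<exists>L. \<forall>K. (\<Sum>k\<in>{- int K..int K}. 1 / (1 + (real_of_int k)\<^sup>2)) \<le> L"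
proof -
  let ?s = "\<lambda>k::nat. 1 / (1 + (real (Suc k))\<^sup>2)"
  have eq: "(\<Sum>k\<in>{- int K..int K}. 1 / (1 + (real_of_int k)\<^sup>2)) = 1 + 2 * (\<Sum>k<K. ?s k)" for K
  proof (induction K)
    case (Suc K)
    have "{- int (Suc K)..int (Suc K)} = insert (int (Suc K)) (insert (- int (Suc K)) {- int K..int K})"
      by auto
    then have "(\<Sum>k\<in>{- int (Suc K)..int (Suc K)}. 1 / (1 + (real_of_int k)\<^sup>2)) =
        ?s K + (?s K + (\<Sum>k\<in>{- int K..int K}. 1 / (1 + (real_of_int k)\<^sup>2)))"
      by (simp add: power2_eq_square algebra_simps)
    then show ?case using Suc by simp
  qed simp
  have "summable (\<lambda>k. inverse (real (Suc k) ^ 2))"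
    using inverse_power_summable[of 2, where 'a = real] by (subst summable_Suc_iff) simp
  then have sum: "summable ?s"
    by (rule summable_comparison_test'[where N = 0])
      (auto simp: inverse_eq_divide intro!: divide_left_mono mult_pos_pos add_pos_nonneg)
  have "(\<Sum>k<K. ?s k) \<le> suminf ?s" for K
    using sum by (intro sum_le_suminf) auto
  then show ?thesis unfolding eq by (intro exI[of _ "1 + 2 * suminf ?s"]) auto
qed

lemma norm_integral_le:
  fixes f :: "'a \<Rightarrow> 'b::{banach, second_countable_topology}"
  assumes "integrable M f" "integrable M g" "\<And>x. norm (f x) \<le> g x"
  shows "norm (LINT x|M. f x) \<le> (LINT x|M. g x)"
proof -
  have "norm (LINT x|M. f x) \<le> (LINT x|M. norm (f x))" by (rule integral_norm_bound)
  also have "\<dots> \<le> (LINT x|M. g x)"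
    using assms by (intro Bochner_Integration.integral_mono integrable_norm) auto
  finally show ?thesis .
qed

text \<open>If the shifted symbol were exactly the constant \<open>d\<close>, Fourier inversion would return \<open>d\<close> times the
bump.\<close>

lemma symbol_mean_error:
  fixes \<psi> :: "real^'n \<Rightarrow> complex"
  assumes \<psi> [measurable]: "\<psi> \<in> borel_measurable borel" and C: "\<And>\<xi>. norm (\<psi> \<xi>) \<le> C"
    and d: "\<And>z. norm (\<psi> (z - b) - d) \<le> D * (1 + (norm z)\<^sup>2)"
  shows "norm (symbol_mean \<psi> b x - d * of_real (cube_bump x)) \<le>
    D * (LINT z|lborel. norm (of_real (1 + (norm z)\<^sup>2) * cube_bump_hat (z::real^'n)))"
proof -
  let ?E = "\<lambda>z. exp (- \<i> * of_real (x \<bullet> z))"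
  have E: "norm (?E z) = 1" for z
    using norm_exp_i_times[of "- (x \<bullet> z)"] by simp
  have int: "integrable lborel (\<lambda>z. ?E z * cube_bump_hat z)"
  proof (rule bounded_phase_integrable[OF cube_bump_hat_integrable, where B = 1])
    show "norm (?E z) \<le> 1" for z by (simp only: E order_refl)
  qed measurable
  have "symbol_mean \<psi> b x - d * of_real (cube_bump x)
      = (LINT z|lborel. ?E z * (\<psi> (z - b) * cube_bump_hat z)) - (LINT z|lborel. d * (?E z * cube_bump_hat z))"
    unfolding symbol_mean_def cube_bump_inversion[symmetric] integral_mult_right_zero ..
  also have "\<dots> = (LINT z|lborel. ?E z * (\<psi> (z - b) * cube_bump_hat z) - d * (?E z * cube_bump_hat z))"
    using C by (intro Bochner_Integration.integral_diff[symmetric] symbol_mean_integrable \<psi> integrable_mult_right int)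
  finally have eq: "symbol_mean \<psi> b x - d * of_real (cube_bump x) =
    (LINT z|lborel. ?E z * (\<psi> (z - b) * cube_bump_hat z) - d * (?E z * cube_bump_hat z))" .
  have "norm (symbol_mean \<psi> b x - d * of_real (cube_bump x)) \<le>
      (LINT z|lborel. D * norm (of_real (1 + (norm z)\<^sup>2) * cube_bump_hat (z::real^'n)))"
    unfolding eq
  proof (rule norm_integral_le)
    show "integrable lborel (\<lambda>z. ?E z * (\<psi> (z - b) * cube_bump_hat z) - d * (?E z * cube_bump_hat z))"
      using C by (intro Bochner_Integration.integrable_diff symbol_mean_integrable \<psi> integrable_mult_right int)
    show "integrable lborel (\<lambda>z. D * norm (of_real (1 + (norm z)\<^sup>2) * cube_bump_hat (z::real^'n)))"
      using cube_bump_hat_weighted_integrable by (intro integrable_mult_right integrable_norm)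
    fix z :: "real^'n"
    have "?E z * (\<psi> (z - b) * cube_bump_hat z) - d * (?E z * cube_bump_hat z) = ?E z * ((\<psi> (z - b) - d) * cube_bump_hat z)"
      by (simp only: ring_distribs mult_ac)
    then have "norm (?E z * (\<psi> (z - b) * cube_bump_hat z) - d * (?E z * cube_bump_hat z)) = norm (\<psi> (z - b) - d) * norm (cube_bump_hat z)"
      by (simp only: norm_mult E mult_1)
    also have "\<dots> \<le> D * (1 + (norm z)\<^sup>2) * norm (cube_bump_hat z)"
      using d by (intro mult_right_mono) auto
    also have "\<dots> = D * norm (of_real (1 + (norm z)\<^sup>2) * cube_bump_hat z)"
      by (simp only: norm_mult norm_of_real) (simp add: abs_of_nonneg)
    finally show "norm (?E z * (\<psi> (z - b) * cube_bump_hat z) - d * (?E z * cube_bump_hat z)) \<le>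
      D * norm (of_real (1 + (norm z)\<^sup>2) * cube_bump_hat z)" .
  qed
  then show ?thesis by (simp only: integral_mult_right_zero)
qed

text \<open>The multiplier acts on localised waves almost as a projection. Transposition reverses the
sign of the frequency, so waves of negative frequency are multiplied by \<open>c\<close> and those of positive
frequency are annihilated, with an error \<open>O(1 / k\<^sup>2)\<close> at frequency \<open>k\<close>. These errors are summable;
hence the total error is bounded uniformly in the length of the polynomial as long as the
coefficients stay bounded.\<close>

lemma fourier_multiplier_pairing:
  fixes \<psi> :: "real^'n \<Rightarrow> complex" and e :: "real^'n"
  assumes \<psi> [measurable]: "\<psi> \<in> borel_measurable borel" and C: "\<And>\<xi>. norm (\<psi> \<xi>) \<le> C"
    and plus: "\<And>m \<zeta>. m > 0 \<Longrightarrow> norm (\<psi> (\<zeta> + m *\<^sub>R e) - of_real c) \<le> C * (1 + (norm \<zeta>)\<^sup>2) / m\<^sup>2"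
    and minus: "\<And>m \<zeta>. m > 0 \<Longrightarrow> norm (\<psi> (\<zeta> - m *\<^sub>R e)) \<le> C * (1 + (norm \<zeta>)\<^sup>2) / m\<^sup>2"
  obtains A where "\<And>K a f. (\<And>k. norm (a k) \<le> 1) \<Longrightarrow> integrable lborel f \<Longrightarrow>
    norm (fourier_multiplier \<psi> (dist_of f) (test_wave e {- int K..int K} a)
      - of_real c * (LINT x|lborel. f x * test_wave e {- int K..<0} a x))
    \<le> A * (LINT x|lborel. norm (f x))"
proof -
  define W where "W = (LINT z|lborel. norm (of_real (1 + (norm z)\<^sup>2) * cube_bump_hat (z::real^'n)))"
  have C0: "C \<ge> 0" using C norm_ge_zero order_trans by blast
  have W0: "W \<ge> 0" unfolding W_def by (intro Bochner_Integration.integral_nonneg norm_ge_zero)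
  obtain L where L: "\<And>K. (\<Sum>k\<in>{- int K..int K}. 1 / (1 + (real_of_int k)\<^sup>2)) \<le> L"
    using sum_int_interval_inverse_square_bounded by blast
  let ?d = "\<lambda>k::int. if k < 0 then complex_of_real c else 0"
  have mode: "norm (symbol_mean \<psi> (of_int k *\<^sub>R e) x - ?d k * of_real (cube_bump x)) \<le> 2 * C / (1 + (real_of_int k)\<^sup>2) * W"
    for k x
    unfolding W_def
  proof (rule symbol_mean_error[OF \<psi> C])
    fix z :: "real^'n"
    \<comment> \<open>The form \<open>2 C / (1 + k\<^sup>2)\<close> of the bound also covers the frequency 0.\<close>
    have weaken: "C * (1 + (norm z)\<^sup>2) / (real_of_int k)\<^sup>2 \<le> 2 * C / (1 + (real_of_int k)\<^sup>2) * (1 + (norm z)\<^sup>2)"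
      if "k \<noteq> 0"
    proof -
      have k1: "1 \<le> (real_of_int k)\<^sup>2"
        using that by (metis of_int_1_le_iff of_int_power int_one_le_iff_zero_less zero_less_power2)
      then have "C / (real_of_int k)\<^sup>2 \<le> 2 * C / (1 + (real_of_int k)\<^sup>2)"
        using C0 mult_left_mono[OF k1 C0] by (simp add: divide_simps algebra_simps split: if_splits)
      from mult_right_mono[OF this, of "1 + (norm z)\<^sup>2"] show ?thesis by simp
    qed
    consider "k < 0" | "k = 0" | "k > 0" by linarith
    then show "norm (\<psi> (z - of_int k *\<^sub>R e) - ?d k) \<le> 2 * C / (1 + (real_of_int k)\<^sup>2) * (1 + (norm z)\<^sup>2)"
    proof cases
      case 1
      with plus[of "- of_int k" z] weaken show ?thesis by simp
    next
      case 2
      have "norm (\<psi> z) \<le> C * 1" using C[of z] by simp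
      also have "\<dots> \<le> C * (2 * (1 + (norm z)\<^sup>2))" using C0 by (intro mult_left_mono) auto
      finally show ?thesis using 2 by (simp add: mult_ac)
    next
      case 3
      with minus[of "of_int k" z] weaken show ?thesis by simp
    qed
  qed
  define A where "A = 2 * C * W * L"
  show thesis
  proof (rule that[of A])
    fix K and a :: "int \<Rightarrow> complex" and f :: "real^'n \<Rightarrow> complex"
    assume a: "\<And>k. norm (a k) \<le> 1" and f: "integrable lborel f"
    have [measurable]: "f \<in> borel_measurable borel" using f by auto
    let ?I = "{- int K..int K}" and ?M = "test_wave e {- int K..<0} a"
    let ?T = "\<lambda>x. \<Sum>k\<in>?I. a k * (wave e k x * symbol_mean \<psi> (of_int k *\<^sub>R e) x)"
    have cM: "of_real c * ?M x = (\<Sum>k\<in>?I. a k * (wave e k x * (?d k * of_real (cube_bump x))))" for x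
      unfolding test_wave_def wave_sum_def sum_distrib_left
      by (intro sum.mono_neutral_cong_left) auto
    have err: "norm (?T x - of_real c * ?M x) \<le> A" for x
    proof -
      have "?T x - of_real c * ?M x = (\<Sum>k\<in>?I. a k * (wave e k x *
          (symbol_mean \<psi> (of_int k *\<^sub>R e) x - ?d k * of_real (cube_bump x))))"
        unfolding cM sum_subtractf[symmetric] by (intro sum.cong refl) (simp only: right_diff_distrib)
      also have "norm \<dots> \<le> (\<Sum>k\<in>?I. 2 * C / (1 + (real_of_int k)\<^sup>2) * W)"
      proof (rule sum_norm_le)
        fix k
        have "norm (a k * (wave e k x * (symbol_mean \<psi> (of_int k *\<^sub>R e) x - ?d k * of_real (cube_bump x))))
          = norm (a k) * norm (symbol_mean \<psi> (of_int k *\<^sub>R e) x - ?d k * of_real (cube_bump x))"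
          by (simp only: norm_mult norm_wave mult_1)
        also have "\<dots> \<le> 1 * (2 * C / (1 + (real_of_int k)\<^sup>2) * W)"
          by (intro mult_mono a mode) auto
        finally show "norm (a k * (wave e k x * (symbol_mean \<psi> (of_int k *\<^sub>R e) x - ?d k * of_real (cube_bump x))))
          \<le> 2 * C / (1 + (real_of_int k)\<^sup>2) * W" by simp
      qed
      also have "\<dots> = 2 * C * W * (\<Sum>k\<in>?I. 1 / (1 + (real_of_int k)\<^sup>2))"
        unfolding sum_distrib_left by (intro sum.cong refl) simp
      also have "\<dots> \<le> A"
        unfolding A_def using C0 W0 by (intro mult_left_mono L) auto
      finally show ?thesis .
    qed
    have M_bd: "norm (?M x) \<le> real (card {- int K..<0})" for x
      by (rule norm_test_wave_le[OF a])
    have T_meas [measurable]: "?T \<in> borel_measurable borel" by measurable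
    have i1: "integrable lborel (\<lambda>x. (?T x - of_real c * ?M x) * f x)"
      by (rule bounded_phase_integrable[OF f _ err]) measurable
    have i2: "integrable lborel (\<lambda>x. ?M x * f x)"
      by (rule bounded_phase_integrable[OF f _ M_bd]) measurable
    have "integrable lborel (\<lambda>x. (?T x - of_real c * ?M x) * f x + of_real c * (?M x * f x))"
      by (intro Bochner_Integration.integrable_add i1 integrable_mult_right i2)
    then have i3: "integrable lborel (\<lambda>x. f x * ?T x)"
      by (simp add: algebra_simps)
    have "fourier_multiplier \<psi> (dist_of f) (test_wave e ?I a) = (LINT x|lebesgue. f x * ?T x)"
      unfolding fourier_multiplier_def inv_fourier_dist_def mult_dist_def fourier_dist_def dist_of_def
      by (subst fourier_multiplier_test_wave[OF _ \<psi> C]) auto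
    also have "\<dots> = (LINT x|lborel. f x * ?T x)"
      by (intro integral_completion) measurable
    finally have "fourier_multiplier \<psi> (dist_of f) (test_wave e ?I a) - of_real c * (LINT x|lborel. f x * ?M x)
        = (LINT x|lborel. f x * ?T x) - (LINT x|lborel. of_real c * (f x * ?M x))"
      by (simp only: integral_mult_right_zero)
    also have "\<dots> = (LINT x|lborel. f x * ?T x - of_real c * (f x * ?M x))"
      using i2 by (intro Bochner_Integration.integral_diff[symmetric] i3 integrable_mult_right) (simp add: mult.commute)
    also have "norm \<dots> \<le> (LINT x|lborel. A * norm (f x))"
    proof (rule norm_integral_le)
      show "integrable lborel (\<lambda>x. f x * ?T x - of_real c * (f x * ?M x))"
        using i1 by (simp add: algebra_simps)
      show "integrable lborel (\<lambda>x. A * norm (f x))" using f by simp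
      fix x
      have "p * q - r * (p * s) = (q - r * s) * p" for p q r s :: complex
        by (simp add: algebra_simps)
      then have "f x * ?T x - of_real c * (f x * ?M x) = (?T x - of_real c * ?M x) * f x" .
      then show "norm (f x * ?T x - of_real c * (f x * ?M x)) \<le> A * norm (f x)"
        using err[of x] by (simp only: norm_mult) (rule mult_right_mono, simp_all)
    qed
    finally show "norm (fourier_multiplier \<psi> (dist_of f) (test_wave e ?I a) - of_real c * (LINT x|lborel. f x * ?M x))
      \<le> A * (LINT x|lborel. norm (f x))"
      by (simp only: integral_mult_right_zero)
  qed
qed

section \<open>Partial sums of Abel means\<close>

lemma wave_eq_cis: "wave e k x = cis (of_int k * (x \<bullet> e))"
  by (simp add: wave_def cis_conv_exp)

lemma wave_sum_negative:
  "wave_sum e {- int K..<0} a x = (\<Sum>k=1..K. a (- int k) * cis (- (x \<bullet> e)) ^ k)"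
proof (induction K)
  case (Suc K)
  have "{- int (Suc K)..<0} = insert (- int (Suc K)) {- int K..<0}" by auto
  then have "wave_sum e {- int (Suc K)..<0} a x
      = a (- int (Suc K)) * wave e (- int (Suc K)) x + wave_sum e {- int K..<0} a x"
    by (simp add: wave_sum_def)
  also have "wave e (- int (Suc K)) x = cis (- (x \<bullet> e)) ^ Suc K"
    unfolding wave_eq_cis Complex.DeMoivre by (simp add: algebra_simps)
  finally show ?case using Suc by simp
qed (simp add: wave_sum_def)

lemma wave_sum_symmetric:
  "wave_sum e {- int K..int K} a x =
    a 0 + (\<Sum>k=1..K. a (- int k) * cis (- (x \<bullet> e)) ^ k) + (\<Sum>k=1..K. a (int k) * cis (x \<bullet> e) ^ k)"
proof (induction K)
  case (Suc K)
  have "{- int (Suc K)..int (Suc K)} = insert (int (Suc K)) (insert (- int (Suc K)) {- int K..int K})" by auto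
  then have "wave_sum e {- int (Suc K)..int (Suc K)} a x
      = a (int (Suc K)) * wave e (int (Suc K)) x + (a (- int (Suc K)) * wave e (- int (Suc K)) x + wave_sum e {- int K..int K} a x)"
    by (simp add: wave_sum_def)
  also have "wave e (- int (Suc K)) x = cis (- (x \<bullet> e)) ^ Suc K"
    unfolding wave_eq_cis Complex.DeMoivre by (simp add: algebra_simps)
  also have "wave e (int (Suc K)) x = cis (x \<bullet> e) ^ Suc K"
    unfolding wave_eq_cis Complex.DeMoivre by (simp add: algebra_simps)
  finally show ?case using Suc by simp
qed (simp add: wave_sum_def wave_eq_cis)

lemma norm_suminf_diff_partial_sum_le:
  fixes f :: "nat \<Rightarrow> complex"
  assumes r: "0 \<le> r" "r < 1" and f: "\<And>k. norm (f k) \<le> r ^ k"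
  shows "norm (suminf f - (\<Sum>k<N. f k)) \<le> r ^ N / (1 - r)"
proof -
  have sr: "summable (\<lambda>k. r ^ k)" using r by (simp add: summable_geometric)
  have sf: "summable f" by (rule summable_comparison_test'[OF sr]) (rule f)
  have "suminf f - (\<Sum>k<N. f k) = (\<Sum>k. f (k + N))"
    using suminf_minus_initial_segment[OF sf, of N] by simp
  also have "norm \<dots> \<le> (\<Sum>k. r ^ (k + N))"
    using sr by (intro norm_suminf_le f) (simp add: summable_iff_shift)
  also have "\<dots> = r ^ N / (1 - r)"
    using suminf_mult[OF sr, of "r ^ N"] suminf_geometric[of r] r by (simp add: power_add mult.commute)
  finally show ?thesis .
qed

lemma geometric_tail_small:
  assumes "0 \<le> r" "r < (1::real)"
  shows "\<exists>K. r ^ Suc K / (1 - r) \<le> 1"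
proof -
  have "(\<lambda>K. r ^ Suc K) \<longlonglongrightarrow> 0"
    using assms by (intro LIMSEQ_Suc LIMSEQ_realpow_zero)
  then have "\<forall>\<^sub>F K in sequentially. r ^ Suc K < 1 - r"
    using assms by (intro order_tendstoD) auto
  then obtain K where "r ^ Suc K < 1 - r" by (auto simp: eventually_sequentially)
  then show ?thesis using assms by (intro exI[of _ K]) (simp add: divide_simps)
qed

lemma sum_lessThan_Suc_eq: "(\<Sum>k<Suc K. f k) = f 0 + (\<Sum>k=1..K. f k)"
proof -
  have "{..<Suc K} = insert 0 {1..K}" by auto
  then show ?thesis by simp
qed

text \<open>Infinite trigonometric series of Abel type are cut off at a length \<open>K\<close> for which the remainder is at
most 1 uniformly on the disc of radius \<open>r\<close>, so that they can be tested as polynomials.\<close>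

lemma log_partial_sums:
  assumes "0 \<le> r" "r < 1"
  shows "\<exists>K. \<forall>z. norm z \<le> r \<longrightarrow> norm ((\<Sum>k=1..K. z ^ k / of_nat k) + Ln (1 - z)) \<le> 1"
proof -
  obtain K where K: "r ^ Suc K / (1 - r) \<le> 1" using geometric_tail_small[OF assms] by blast
  have "norm ((\<Sum>k=1..K. z ^ k / of_nat k) + Ln (1 - z)) \<le> 1" if z: "norm z \<le> r" for z :: complex
  proof -
    let ?f = "\<lambda>k. z ^ k / of_nat k"
    have "(\<lambda>n. - ((- (- z)) ^ n) / of_nat n) sums ln (1 + (- z))"
      using z assms by (intro Ln_series') simp
    then have "(\<lambda>n. - ?f n) sums Ln (1 - z)" by simp
    then have "suminf ?f = - Ln (1 - z)"
      using sums_minus sums_unique by fastforce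
    moreover have "norm (?f k) \<le> r ^ k" for k
    proof (cases "k = 0")
      case False
      then have "norm (?f k) \<le> norm z ^ k"
        by (simp add: norm_divide norm_power divide_le_eq mult_le_cancel_left1)
      also have "\<dots> \<le> r ^ k" using z by (intro power_mono) auto
      finally show ?thesis .
    qed simp
    ultimately have "norm (- Ln (1 - z) - (\<Sum>k=1..K. ?f k)) \<le> 1"
      using norm_suminf_diff_partial_sum_le[OF assms, of ?f "Suc K"] K
      by (simp only: sum_lessThan_Suc_eq) simp
    then show ?thesis by (metis add.commute minus_add_distrib minus_minus norm_minus_cancel uminus_add_conv_diff)
  qed
  then show ?thesis by blast
qed

lemma geometric_partial_sums:
  assumes "0 \<le> r" "r < 1"
  shows "\<exists>K. \<forall>z::complex. norm z \<le> r \<longrightarrow> norm ((\<Sum>k=1..K. z ^ k) - (1 / (1 - z) - 1)) \<le> 1"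
proof -
  obtain K where K: "r ^ Suc K / (1 - r) \<le> 1" using geometric_tail_small[OF assms] by blast
  have "norm ((\<Sum>k=1..K. z ^ k) - (1 / (1 - z) - 1)) \<le> 1" if z: "norm z \<le> r" for z :: complex
  proof -
    have "suminf (\<lambda>k. z ^ k) = 1 / (1 - z)" using z assms by (intro suminf_geometric) simp
    moreover have "norm (z ^ k) \<le> r ^ k" for k
      using z by (simp add: norm_power power_mono)
    ultimately have "norm (1 / (1 - z) - (1 + (\<Sum>k=1..K. z ^ k))) \<le> 1"
      using norm_suminf_diff_partial_sum_le[OF assms, of "\<lambda>k. z ^ k" "Suc K"] K
      by (simp only: sum_lessThan_Suc_eq) simp
    then show ?thesis by (subst norm_minus_commute) (simp add: algebra_simps)
  qed
  then show ?thesis by blast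
qed

lemma norm_one_minus_cis_le:
  assumes "0 \<le> r" "r \<le> 1"
  shows "norm (1 - of_real r * cis t) \<le> (1 - r) + \<bar>t\<bar>"
proof -
  have c: "norm (1 - cis t) \<le> \<bar>t\<bar>"
    using dist_exp_i_1[of t] abs_sin_x_le_abs_x[of "t / 2"]
    by (simp add: cis_conv_exp norm_minus_commute)
  have "1 - of_real r * cis t = of_real (1 - r) + of_real r * (1 - cis t)"
    by (simp add: algebra_simps)
  also have "norm \<dots> \<le> norm (complex_of_real (1 - r)) + norm (of_real r * (1 - cis t))"
    by (rule norm_triangle_ineq)
  also have "\<dots> = (1 - r) + r * norm (1 - cis t)"
    using assms by (simp only: norm_mult norm_of_real abs_of_nonneg diff_ge_0_iff_ge)
  also have "\<dots> \<le> (1 - r) + 1 * \<bar>t\<bar>"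
    using assms c by (intro add_left_mono mult_mono) auto
  finally show ?thesis by simp
qed

lemma measure_lborel_pos:
  fixes S :: "'a::euclidean_space set"
  assumes "open U" "U \<noteq> {}" "U \<subseteq> S" "bounded S" "S \<in> sets borel"
  shows "0 < measure lborel S"
proof -
  have "\<not> negligible U" using assms by (intro open_not_negligible)
  then have "emeasure lborel U \<noteq> 0"
    using assms(1) by (simp add: negligible_iff_null_sets null_sets_completion_iff null_sets_def)
  moreover have "emeasure lborel U \<le> emeasure lborel S"
    using assms by (intro emeasure_mono) auto
  ultimately have "emeasure lborel S \<noteq> 0" by auto
  moreover have "emeasure lborel S < \<infinity>" using assms(4) by (rule emeasure_bounded_finite)
  ultimately show ?thesis
    by (metis emeasure_eq_ennreal_measure ennreal_0 infinity_ennreal_def less_irrefl measure_nonneg order_less_le)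
qed

section \<open>Logarithmic sums and an integrable function\<close>

definition slab :: "real^'n \<Rightarrow> real \<Rightarrow> (real^'n) set" where
  "slab e d = {x \<in> cball 0 (1/2). \<bar>x \<bullet> e\<bar> \<le> d}"

lemma slab_sets [measurable]: "slab e d \<in> sets borel"
proof -
  have "slab e d = cball 0 (1/2) \<inter> {x. \<bar>x \<bullet> e\<bar> \<le> d}" by (auto simp: slab_def)
  moreover have "closed {x. \<bar>x \<bullet> e\<bar> \<le> d}" by (intro closed_Collect_le continuous_intros)
  ultimately show ?thesis by (simp add: borel_closed closed_Int)
qed

lemma slab_measure:
  assumes "norm e = 1" "d > 0"
  shows "0 < measure lborel (slab e d)" "emeasure lborel (slab e d) < \<infinity>"
proof -
  have bd: "bounded (slab e d)" by (rule bounded_subset[OF bounded_cball[of 0 "1/2"]]) (auto simp: slab_def)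
  show "0 < measure lborel (slab e d)"
  proof (rule measure_lborel_pos)
    show "ball 0 (min (1/2) d) \<subseteq> slab e d"
    proof
      fix x :: "real^'a" assume "x \<in> ball 0 (min (1/2) d)"
      then show "x \<in> slab e d"
        using Cauchy_Schwarz_ineq2[of x e] assms(1) by (simp add: slab_def)
    qed
  qed (use assms(2) bd in auto)
  show "emeasure lborel (slab e d) < \<infinity>" using bd by (rule emeasure_bounded_finite)
qed

lemma AE_not_orthogonal:
  fixes e :: "'a::euclidean_space"
  assumes "e \<noteq> 0" shows "AE x in lborel. x \<bullet> e \<noteq> 0"
proof -
  have "negligible {x. e \<bullet> x = 0}" using assms by (intro negligible_hyperplane) auto
  moreover have "{x. e \<bullet> x = 0} \<in> sets borel" by (intro borel_closed closed_hyperplane)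
  ultimately have "{x. e \<bullet> x = 0} \<in> null_sets lborel"
    by (simp add: negligible_iff_null_sets null_sets_completion_iff)
  from AE_not_in[OF this] show ?thesis by (simp add: inner_commute)
qed

text \<open>Superposing normalised indicators of thinner and thinner slabs with weights \<open>2\<^sup>-\<^sup>j\<close> gives an
integrable function that concentrates at the hyperplane orthogonal to \<open>e\<close>: the \<open>j\<close>-th term has
integral \<open>2\<^sup>-\<^sup>j\<close> however fast the slabs shrink. Off the hyperplane, only finitely many slabs
contain a given point, so the series converges almost everywhere.\<close>

lemma ex_summable_slab_averages:
  fixes e :: "real^'n" and d :: "nat \<Rightarrow> real"
  assumes e: "norm e = 1" and d: "\<And>j. d j > 0" "d \<longlonglongrightarrow> 0"
  obtains f :: "real^'n \<Rightarrow> real" where "integrable lborel f" "\<And>x. 0 \<le> f x"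
    "\<And>x. 1/2 < norm x \<Longrightarrow> f x = 0"
    "\<And>j. AE x in lborel. (1/2) ^ j / measure lborel (slab e (d j)) * indicator (slab e (d j)) x \<le> f x"
proof -
  define g where "g j x = (1/2) ^ j / measure lborel (slab e (d j)) * indicat_real (slab e (d j)) x" for j x
  have g0: "0 \<le> g j x" for j x by (simp add: g_def)
  have int: "integrable lborel (g j)" for j
    unfolding g_def using slab_measure[OF e d(1)] by (intro integrable_mult_right integrable_real_indicator) auto
  have norm_int: "(LINT x|lborel. norm (g j x)) = (1/2) ^ j" for j
    using slab_measure[OF e d(1)[of j]] g0 by (simp add: g_def)
  have e0: "e \<noteq> 0" using e by auto
  have sum: "summable (\<lambda>j. g j x)" if "x \<bullet> e \<noteq> 0" for x
  proof -
    have "\<forall>\<^sub>F j in sequentially. d j < \<bar>x \<bullet> e\<bar>" using d(2) that by (intro order_tendstoD) auto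
    then have "\<forall>\<^sub>F j in sequentially. g j x = 0"
      by eventually_elim (auto simp: g_def slab_def indicator_def)
    then obtain N where "\<And>j. j \<ge> N \<Longrightarrow> g j x = 0" by (auto simp: eventually_sequentially)
    then show ?thesis by (intro summable_finite[of "{..<N}"]) auto
  qed
  have AE: "AE x in lborel. summable (\<lambda>j. g j x)"
    using AE_not_orthogonal[OF e0] by eventually_elim (rule sum)
  \<comment> \<open>The absolute value ensures nonnegativity on the null set where the series diverges.\<close>
  show ?thesis
  proof (rule that[of "\<lambda>x. \<bar>\<Sum>j. g j x\<bar>"])
    have "integrable lborel (\<lambda>x. \<Sum>j. g j x)"
    proof (rule integrable_suminf[OF int])
      show "AE x in lborel. summable (\<lambda>j. norm (g j x))" using AE g0 by simp
      show "summable (\<lambda>j. LINT x|lborel. norm (g j x))" unfolding norm_int by (intro summable_geometric) simp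
    qed
    then show "integrable lborel (\<lambda>x. \<bar>\<Sum>j. g j x\<bar>)" by (rule integrable_abs)
    show "\<bar>\<Sum>j. g j x\<bar> = 0" if "1/2 < norm x" for x
      using that by (simp add: g_def slab_def)
    show "AE x in lborel. (1/2) ^ j / measure lborel (slab e (d j)) * indicator (slab e (d j)) x \<le> \<bar>\<Sum>j. g j x\<bar>" for j
      using AE
    proof eventually_elim
      case (elim x)
      have "g j x \<le> (\<Sum>j. g j x)"
        using sum_le_suminf[OF elim, of "{j}"] g0 by simp
      then show ?case unfolding g_def[symmetric] by linarith
    qed
  qed simp
qed

text \<open>With \<open>z = r exp (i x \<bullet> e)\<close> the polynomial approximates \<open>Ln (1 - z) - Ln (1 - cnj z)\<close>, which is
bounded because it is purely imaginary and arguments are bounded. Its part of negative frequency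
approximates \<open>- Ln (1 - cnj z)\<close>, whose real part \<open>- ln (norm (1 - z))\<close> is bounded below and, where
\<open>\<bar>x \<bullet> e\<bar>\<close> is at most \<open>d = 1 - r\<close>, at least \<open>- ln (2 d)\<close>.\<close>

lemma bounded_wave_sum_with_large_negative_part:
  fixes e :: "real^'n"
  assumes d: "0 < d" "d < 1"
  obtains K a where "\<And>k. norm (a k) \<le> 1" "\<And>x. norm (wave_sum e {- int K..int K} a x) \<le> 10"
    "\<And>x. - 2 \<le> Re (wave_sum e {- int K..<0} a x)"
    "\<And>x. \<bar>x \<bullet> e\<bar> \<le> d \<Longrightarrow> - ln d - 2 \<le> Re (wave_sum e {- int K..<0} a x)"
proof -
  define r where "r = 1 - d"
  have r: "0 \<le> r" "r < 1" using d by (auto simp: r_def)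
  obtain K where K: "\<And>z. norm z \<le> r \<Longrightarrow> norm ((\<Sum>k=1..K. z ^ k / of_nat k) + Ln (1 - z)) \<le> 1"
    using log_partial_sums[OF r] by blast
  define a :: "int \<Rightarrow> complex" where "a k = of_real (- real_of_int (sgn k) * r ^ nat \<bar>k\<bar> / real_of_int \<bar>k\<bar>)" for k :: int
  have a1: "norm (a k) \<le> 1" for k
  proof (cases "k = 0")
    case False
    then have "norm (a k) = r ^ nat \<bar>k\<bar> / real_of_int \<bar>k\<bar>"
      using r by (simp add: a_def norm_divide norm_mult norm_power sgn_if)
    also have "\<dots> \<le> 1"
      using False r power_le_one[of r "nat \<bar>k\<bar>"] by (simp add: divide_le_eq)
    finally show ?thesis .
  qed (simp add: a_def)
  define L where "L z = (\<Sum>k=1..K. z ^ k / of_nat k)" for z :: complex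
  have neg: "wave_sum e {- int K..<0} a x = L (of_real r * cis (- (x \<bullet> e)))" for x
    unfolding wave_sum_negative L_def by (intro sum.cong refl) (simp add: a_def power_mult_distrib)
  have sym: "wave_sum e {- int K..int K} a x = L (of_real r * cis (- (x \<bullet> e))) - L (of_real r * cis (x \<bullet> e))" for x
  proof -
    have "(\<Sum>k=1..K. a (int k) * cis (x \<bullet> e) ^ k) = - L (of_real r * cis (x \<bullet> e))"
      unfolding L_def sum_negf[symmetric] by (intro sum.cong refl) (simp add: a_def power_mult_distrib)
    moreover have "(\<Sum>k=1..K. a (- int k) * cis (- (x \<bullet> e)) ^ k) = L (of_real r * cis (- (x \<bullet> e)))"
      using neg[of x] unfolding wave_sum_negative .
    moreover have "a 0 = 0" by (simp add: a_def)
    ultimately show ?thesis unfolding wave_sum_symmetric by simp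
  qed
  have nz: "norm (of_real r * cis t) \<le> r" for t using r by (simp add: norm_mult)
  have ne: "1 - of_real r * cis t \<noteq> 0" for t
  proof
    assume "1 - of_real r * cis t = 0"
    then have "norm (of_real r * cis t) = 1" by (metis eq_iff_diff_eq_0 norm_one)
    with nz[of t] r show False by simp
  qed
  have Re_L: "- ln (norm (1 - of_real r * cis t)) - 1 \<le> Re (L (of_real r * cis t))" for t
  proof -
    have "\<bar>Re (L (of_real r * cis t) + Ln (1 - of_real r * cis t))\<bar> \<le> 1"
      using abs_Re_le_cmod K[OF nz] unfolding L_def by (rule order_trans)
    then show ?thesis using ne[of t] by simp
  qed
  have ln2: "ln (2::real) \<le> 1" using ln_2_less_1 by simp
  show thesis
  proof (rule that[of a K])
    show "norm (a k) \<le> 1" for k by (rule a1)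
  next
    fix x
    let ?z = "of_real r * cis (x \<bullet> e)" and ?w = "of_real r * cis (- (x \<bullet> e))"
    have "?w = cnj ?z" by (simp add: cis_cnj)
    then have "1 - ?w = cnj (1 - ?z)" by simp
    then have "norm (1 - ?w) = norm (1 - ?z)" by (metis complex_mod_cnj)
    then have "Re (Ln (1 - ?w)) = Re (Ln (1 - ?z))" using ne by simp
    moreover have "\<bar>Im (Ln (1 - ?w)) - Im (Ln (1 - ?z))\<bar> \<le> 8"
      using mpi_less_Im_Ln[OF ne, of "x \<bullet> e"] Im_Ln_le_pi[OF ne, of "x \<bullet> e"]
        mpi_less_Im_Ln[OF ne, of "- (x \<bullet> e)"] Im_Ln_le_pi[OF ne, of "- (x \<bullet> e)"] pi_less_4
      by (simp add: abs_le_iff)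
    ultimately have l: "norm (Ln (1 - ?w) - Ln (1 - ?z)) \<le> 8"
      using cmod_le[of "Ln (1 - ?w) - Ln (1 - ?z)"] by simp
    have tri: "norm (u - v - w) \<le> norm u + norm v + norm w" for u v w :: complex
      using norm_triangle_ineq4[of "u - v" w] norm_triangle_ineq4[of u v] by linarith
    have "L ?w - L ?z = (L ?w + Ln (1 - ?w)) - (L ?z + Ln (1 - ?z)) - (Ln (1 - ?w) - Ln (1 - ?z))" by simp
    also have "norm \<dots> \<le> 1 + 1 + 8"
      using K[OF nz, of "- (x \<bullet> e)"] K[OF nz, of "x \<bullet> e"] l
        tri[of "L ?w + Ln (1 - ?w)" "L ?z + Ln (1 - ?z)" "Ln (1 - ?w) - Ln (1 - ?z)"]
      unfolding L_def by linarith
    finally show "norm (wave_sum e {- int K..int K} a x) \<le> 10" unfolding sym by simp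
  next
    fix x
    let ?n = "norm (1 - of_real r * cis (- (x \<bullet> e)))"
    have pos: "0 < ?n" using ne by simp
    have "?n \<le> 1 + norm (of_real r * cis (- (x \<bullet> e)))"
      using norm_triangle_ineq4[of 1 "of_real r * cis (- (x \<bullet> e))"] by simp
    then have "?n \<le> 2" using nz[of "- (x \<bullet> e)"] r by linarith
    then have "ln ?n \<le> ln 2" using pos by simp
    then show "- 2 \<le> Re (wave_sum e {- int K..<0} a x)"
      using Re_L[of "- (x \<bullet> e)"] ln2 unfolding neg by linarith
    assume "\<bar>x \<bullet> e\<bar> \<le> d"
    then have "?n \<le> 2 * d" using norm_one_minus_cis_le[of r "- (x \<bullet> e)"] r by (simp add: r_def)
    then have "ln ?n \<le> ln (2 * d)" using pos d by simp
    also have "\<dots> = ln 2 + ln d" using d by (simp add: ln_mult)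
    finally show "- ln d - 2 \<le> Re (wave_sum e {- int K..<0} a x)"
      using Re_L[of "- (x \<bullet> e)"] ln2 unfolding neg by linarith
  qed
qed

text \<open>On the \<open>j\<close>-th slab of thickness \<open>exp (- 4\<^sup>j)\<close> the logarithm is of size \<open>4\<^sup>j\<close>, and \<open>f\<close> has mass \<open>2\<^sup>-\<^sup>j\<close>
there; the product \<open>2\<^sup>j\<close> is unbounded. Elsewhere the logarithm is bounded below, so nothing can
cancel this contribution.\<close>

lemma ex_L1_large_negative_pairings:
  fixes e :: "real^'n"
  assumes e: "norm e = 1"
  obtains f :: "real^'n \<Rightarrow> real" where "integrable lborel f" "\<And>x. 1/2 < norm x \<Longrightarrow> f x = 0"
    "\<And>N. \<exists>K a. (\<forall>k. norm (a k) \<le> 1) \<and> (\<forall>x. norm (wave_sum e {- int K..int K} a x) \<le> 10) \<and>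
      N \<le> norm (LINT x|lborel. of_real (f x) * test_wave e {- int K..<0} a x)"
proof -
  define d where "d j = exp (- (4 ^ j :: real))" for j :: nat
  have d0: "d j > 0" for j by (simp add: d_def)
  have d1: "d j < 1" for j by (simp add: d_def)
  have "filterlim (\<lambda>j. (4::real) ^ j) at_top sequentially"
  proof (rule filterlim_at_top_mono[OF filterlim_real_sequentially])
    have "real j \<le> 4 ^ j" for j
      using of_nat_less_two_power[of j, where 'a = real] power_mono[of 2 "4::real" j] by simp
    then show "\<forall>\<^sub>F j in sequentially. real j \<le> 4 ^ j" by simp
  qed
  then have "filterlim (\<lambda>j. - ((4::real) ^ j)) at_bot sequentially"
    by (simp add: filterlim_uminus_at_top)
  then have dlim: "d \<longlonglongrightarrow> 0" unfolding d_def by (rule filterlim_compose[OF exp_at_bot])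
  obtain f :: "real^'n \<Rightarrow> real" where f: "integrable lborel f" "\<And>x. 0 \<le> f x" "\<And>x. 1/2 < norm x \<Longrightarrow> f x = 0"
    and f_ge: "\<And>j. AE x in lborel. (1/2) ^ j / measure lborel (slab e (d j)) * indicator (slab e (d j)) x \<le> f x"
    using ex_summable_slab_averages[OF e d0 dlim] by blast
  have [measurable]: "f \<in> borel_measurable borel" using f(1) by auto
  define q where "q = exp (-4 :: real) ^ CARD('n)"
  have q: "q > 0" by (simp add: q_def)
  show thesis
  proof (rule that[OF f(1,3)])
    fix N :: real
    obtain j where j: "(N + 2 * (LINT x|lborel. f x)) / q < 2 ^ j"
      using real_arch_pow[of 2] by auto
    obtain K a where a: "\<And>k. norm (a k) \<le> 1" "\<And>x. norm (wave_sum e {- int K..int K} a x) \<le> 10"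
      and lower: "\<And>x. - 2 \<le> Re (wave_sum e {- int K..<0} a x)"
      and large: "\<And>x. \<bar>x \<bullet> e\<bar> \<le> d j \<Longrightarrow> - ln (d j) - 2 \<le> Re (wave_sum e {- int K..<0} a x)"
      using bounded_wave_sum_with_large_negative_part[OF d0 d1] by metis
    let ?w = "\<lambda>x. Re (wave_sum e {- int K..<0} a x)"
    let ?S = "slab e (d j)"
    let ?g = "\<lambda>x. (1/2) ^ j / measure lborel ?S * indicat_real ?S x"
    have "integrable lborel (\<lambda>x. test_wave e {- int K..<0} a x * of_real (f x))"
    proof (rule bounded_phase_integrable[OF _ _ norm_test_wave_le[OF a(1)]])
      show "integrable lborel (\<lambda>x. complex_of_real (f x))" using f(1) by simp
      show "test_wave e {- int K..<0} a \<in> borel_measurable lborel" by measurable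
    qed
    then have int: "integrable lborel (\<lambda>x. of_real (f x) * test_wave e {- int K..<0} a x)"
      by (simp only: mult.commute)
    have Re: "Re (of_real (f x) * test_wave e {- int K..<0} a x) = f x * (cube_bump x * ?w x)" for x
      by (simp add: test_wave_def)
    have int': "integrable lborel (\<lambda>x. f x * (cube_bump x * ?w x))"
      using integrable_Re[OF int] unfolding Re .
    have int_g: "integrable lborel ?g"
      using slab_measure[OF e d0] by (intro integrable_mult_right integrable_real_indicator) auto
    have "(LINT x|lborel. (q * 4 ^ j) * ?g x - 2 * f x) = (q * 4 ^ j) * (LINT x|lborel. ?g x) - 2 * (LINT x|lborel. f x)"
      using int_g f(1) by (simp only: integral_mult_right_zero Bochner_Integration.integral_diff integrable_mult_right)
    also have "(LINT x|lborel. ?g x) = (1/2) ^ j"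
      using slab_measure[OF e d0[of j]] by simp
    also have "q * 4 ^ j * (1/2) ^ j = q * 2 ^ j"
    proof -
      have "(4::real) ^ j = 2 ^ j * 2 ^ j" by (simp flip: power_mult_distrib)
      then show ?thesis by (simp add: power_divide)
    qed
    finally have eq: "(LINT x|lborel. (q * 4 ^ j) * ?g x - 2 * f x) = q * 2 ^ j - 2 * (LINT x|lborel. f x)" .
    have "N \<le> q * 2 ^ j - 2 * (LINT x|lborel. f x)"
      using j q by (simp add: divide_less_eq mult.commute)
    also have "\<dots> \<le> (LINT x|lborel. f x * (cube_bump x * ?w x))"
      unfolding eq[symmetric]
    proof (rule integral_mono_AE)
      show "integrable lborel (\<lambda>x. (q * 4 ^ j) * ?g x - 2 * f x)"
        using integrable_mult_right[of "q * 4 ^ j" lborel ?g] integrable_mult_right[of 2 lborel f] int_g f(1)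
        by (intro Bochner_Integration.integrable_diff) blast+
      show "integrable lborel (\<lambda>x. f x * (cube_bump x * ?w x))" by (rule int')
      show "AE x in lborel. (q * 4 ^ j) * ?g x - 2 * f x \<le> f x * (cube_bump x * ?w x)"
        using f_ge[of j]
      proof eventually_elim
        case (elim x)
        have b: "0 \<le> cube_bump x" "cube_bump x \<le> 1" by (rule cube_bump_bounds)+
        have "(q * 4 ^ j) * ?g x \<le> f x * (cube_bump x * (?w x + 2))"
        proof (cases "x \<in> ?S")
          case True
          then have x: "norm x \<le> 1/2" "\<bar>x \<bullet> e\<bar> \<le> d j" by (auto simp: slab_def)
          have "4 ^ j \<le> ?w x + 2" using large[OF x(2)] by (simp add: d_def)
          then have "q * 4 ^ j \<le> cube_bump x * (?w x + 2)"
            using cube_bump_lower[OF x(1)] q b by (intro mult_mono) (auto simp: q_def)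
          moreover have "0 \<le> q * 4 ^ j" using q by simp
          ultimately have "(q * 4 ^ j) * ?g x \<le> (cube_bump x * (?w x + 2)) * f x"
            by (intro mult_mono[OF _ elim]) auto
          then show ?thesis by (simp add: mult.commute)
        next
          case False
          have "0 \<le> f x * (cube_bump x * (?w x + 2))"
            using f(2) b lower[of x] by (intro mult_nonneg_nonneg) auto
          with False show ?thesis by simp
        qed
        moreover have "f x * (cube_bump x * 2) \<le> 2 * f x"
          using b f(2)[of x] mult_left_mono[of "cube_bump x" 1 "2 * f x"] by (simp add: mult.commute)
        moreover have "f x * (cube_bump x * (?w x + 2)) = f x * (cube_bump x * ?w x) + f x * (cube_bump x * 2)"
          by (simp only: distrib_left)
        ultimately show ?case by linarith
      qed
    qed
    also have "\<dots> = Re (LINT x|lborel. of_real (f x) * test_wave e {- int K..<0} a x)"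
      unfolding Re[symmetric] by (rule integral_Re[OF int])
    also have "\<dots> \<le> norm (LINT x|lborel. of_real (f x) * test_wave e {- int K..<0} a x)"
      by (rule complex_Re_le_cmod)
    finally show "\<exists>K a. (\<forall>k. norm (a k) \<le> 1) \<and> (\<forall>x. norm (wave_sum e {- int K..int K} a x) \<le> 10) \<and>
      N \<le> norm (LINT x|lborel. of_real (f x) * test_wave e {- int K..<0} a x)"
      using a by blast
  qed
qed

section \<open>Poisson kernels and a continuous function\<close>

lemma nn_integral_lborel_translate:
  fixes f :: "'a::euclidean_space \<Rightarrow> ennreal"
  assumes "f \<in> borel_measurable borel"
  shows "(\<integral>\<^sup>+x. f x \<partial>lborel) = (\<integral>\<^sup>+x. f (c + x) \<partial>lborel)"
  by (subst lborel_distr_plus[of c, symmetric], subst nn_integral_distr) (use assms in auto)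

text \<open>Averaging over translations by \<open>t e\<close> with \<open>t\<close> in an interval of length \<open>a\<close> reduces the integral of a
ridge function over a ball to a one-dimensional integral, without a rotation of coordinates: by
Tonelli, the average over \<open>t\<close> may be taken first, for each fixed point of a smaller ball.\<close>

lemma nn_integral_ridge_ge:
  fixes e :: "'a::euclidean_space" and H :: "real \<Rightarrow> ennreal"
  assumes e: "norm e = 1" and a: "a > 0" and H [measurable]: "H \<in> borel_measurable borel"
  shows "emeasure lborel (cball (0::'a) (a/4)) * (\<integral>\<^sup>+s. H s * indicator {-a/4..a/4} s \<partial>lborel)
    \<le> ennreal a * (\<integral>\<^sup>+x. H (x \<bullet> e) * indicator (cball 0 a) x \<partial>lborel)"
proof -
  let ?B = "cball (0::'a) (a/4)" and ?T = "{-a/2..a/2}"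
  define I where "I = (\<integral>\<^sup>+x. H (x \<bullet> e) * indicator (cball 0 a) x \<partial>lborel)"
  define J where "J = (\<integral>\<^sup>+s. H s * indicator {-a/4..a/4} s \<partial>lborel)"
  have [measurable]: "cball (0::'a) r \<in> sets borel" for r by simp
  have ee: "e \<bullet> e = 1" using e by (simp add: norm_eq_1)
  have shift: "(\<integral>\<^sup>+x. H (t + x \<bullet> e) * indicator ?B x \<partial>lborel) \<le> I" if t: "t \<in> ?T" for t
  proof -
    have "I = (\<integral>\<^sup>+x. H ((t *\<^sub>R e + x) \<bullet> e) * indicator (cball 0 a) (t *\<^sub>R e + x) \<partial>lborel)"
      unfolding I_def by (rule nn_integral_lborel_translate) measurable
    moreover have "(\<integral>\<^sup>+x. H (t + x \<bullet> e) * indicator ?B x \<partial>lborel) \<le>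
       (\<integral>\<^sup>+x. H ((t *\<^sub>R e + x) \<bullet> e) * indicator (cball 0 a) (t *\<^sub>R e + x) \<partial>lborel)"
    proof (rule nn_integral_mono)
      fix x :: 'a
      have "norm (t *\<^sub>R e + x) \<le> a" if "norm x \<le> a/4"
        using norm_triangle_ineq[of "t *\<^sub>R e" x] t e a that by (auto simp: abs_le_iff)
      then show "H (t + x \<bullet> e) * indicator ?B x \<le> H ((t *\<^sub>R e + x) \<bullet> e) * indicator (cball 0 a) (t *\<^sub>R e + x)"
        by (auto simp: indicator_def inner_add_left ee)
    qed
    ultimately show ?thesis by simp
  qed
  have inner: "J \<le> (\<integral>\<^sup>+t. H (t + s) * indicator ?T t \<partial>lborel)" if s: "\<bar>s\<bar> \<le> a/4" for s
  proof -
    have "J = (\<integral>\<^sup>+t. H (s + t) * indicator {-a/4..a/4} (s + t) \<partial>lborel)"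
      unfolding J_def by (rule nn_integral_lborel_translate) measurable
    also have "\<dots> \<le> (\<integral>\<^sup>+t. H (t + s) * indicator ?T t \<partial>lborel)"
    proof (rule nn_integral_mono)
      fix t
      have "t \<in> ?T" if "s + t \<in> {-a/4..a/4}" using that s by (auto simp: abs_le_iff)
      then show "H (s + t) * indicator {-a/4..a/4} (s + t) \<le> H (t + s) * indicator ?T t"
        by (auto simp: indicator_def add.commute)
    qed
    finally show ?thesis .
  qed
  have "emeasure lborel ?B * J = (\<integral>\<^sup>+x. J * indicator ?B x \<partial>lborel)"
    by (simp add: nn_integral_cmult_indicator mult.commute)
  also have "\<dots> \<le> (\<integral>\<^sup>+x. (\<integral>\<^sup>+t. H (t + x \<bullet> e) * indicator ?T t * indicator ?B x \<partial>lborel) \<partial>lborel)"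
  proof (rule nn_integral_mono)
    fix x :: 'a
    have "\<bar>x \<bullet> e\<bar> \<le> a/4" if "x \<in> ?B"
      using Cauchy_Schwarz_ineq2[of x e] e that by simp
    then show "J * indicator ?B x \<le> (\<integral>\<^sup>+t. H (t + x \<bullet> e) * indicator ?T t * indicator ?B x \<partial>lborel)"
      using inner[of "x \<bullet> e"] by (auto simp: indicator_def)
  qed
  also have "\<dots> = (\<integral>\<^sup>+t. (\<integral>\<^sup>+x. H (t + x \<bullet> e) * indicator ?T t * indicator ?B x \<partial>lborel) \<partial>lborel)"
    by (rule lborel_pair.Fubini') measurable
  also have "\<dots> \<le> (\<integral>\<^sup>+t. I * indicator ?T t \<partial>lborel)"
  proof (rule nn_integral_mono)
    fix t :: real
    show "(\<integral>\<^sup>+x. H (t + x \<bullet> e) * indicator ?T t * indicator ?B x \<partial>lborel) \<le> I * indicator ?T t"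
      using shift[of t] by (auto simp: indicator_def)
  qed
  also have "\<dots> = I * emeasure lborel ?T" by (simp add: nn_integral_cmult_indicator)
  also have "\<dots> = ennreal a * I" using a by (simp add: mult.commute)
  finally show ?thesis unfolding I_def J_def .
qed

text \<open>A bounded continuous odd function whose modulus of continuity at 0 is not Dini: its quotient by \<open>s\<close>
is not integrable near 0. The minimum only keeps the denominator away from 0 for large \<open>s\<close>.\<close>

definition log_modulus :: "real \<Rightarrow> real" where
  "log_modulus s = sgn s / (1 - ln (min 1 \<bar>s\<bar>))"

lemma log_modulus_denominator_ge_1:
  fixes s :: real
  assumes "s \<noteq> 0" shows "1 \<le> 1 - ln (min 1 \<bar>s\<bar>)"
proof -
  have "0 < min 1 \<bar>s\<bar>" "min 1 \<bar>s\<bar> \<le> 1" using assms by auto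
  then have "ln (min 1 \<bar>s\<bar>) \<le> 0" using ln_le_zero_iff by blast
  then show ?thesis by linarith
qed

lemma abs_log_modulus:
  assumes "s \<noteq> 0" shows "\<bar>log_modulus s\<bar> = 1 / (1 - ln (min 1 \<bar>s\<bar>))"
proof -
  have "\<bar>log_modulus s\<bar> = \<bar>sgn s\<bar> / \<bar>1 - ln (min 1 \<bar>s\<bar>)\<bar>"
    by (simp only: log_modulus_def abs_divide)
  moreover have "\<bar>1 - ln (min 1 \<bar>s\<bar>)\<bar> = 1 - ln (min 1 \<bar>s\<bar>)"
    using log_modulus_denominator_ge_1[OF assms] by linarith
  ultimately show ?thesis using assms by (simp add: abs_sgn_eq)
qed

lemma abs_log_modulus_le: "\<bar>log_modulus s\<bar> \<le> 1"
proof (cases "s = 0")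
  case False
  then show ?thesis
    using log_modulus_denominator_ge_1[OF False] unfolding abs_log_modulus[OF False]
    by (subst divide_le_eq_1_pos) linarith+
qed (simp add: log_modulus_def)

lemma log_modulus_isCont: "isCont log_modulus s"
proof (cases "s = 0")
  case False
  have "((\<lambda>s. sgn s / (1 - ln (min 1 \<bar>s\<bar>))) \<longlongrightarrow> sgn s / (1 - ln (min 1 \<bar>s\<bar>))) (at s)"
  proof (intro tendsto_divide tendsto_sgn tendsto_diff tendsto_const tendsto_ln tendsto_min tendsto_rabs tendsto_ident_at)
    show "1 - ln (min 1 \<bar>s\<bar>) \<noteq> 0" using log_modulus_denominator_ge_1[OF False] by linarith
  qed (use False in auto)
  then show ?thesis unfolding isCont_def log_modulus_def .
next
  case True
  have "(log_modulus \<longlongrightarrow> 0) (at 0)"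
  proof (rule tendstoI)
    fix \<epsilon> :: real assume \<epsilon>: "\<epsilon> > 0"
    have "dist (log_modulus t) 0 < \<epsilon>" if t: "t \<noteq> 0" "dist t 0 < exp (- (1 / \<epsilon>))" for t
    proof -
      have "min 1 \<bar>t\<bar> < exp (- (1 / \<epsilon>))" "0 < min 1 \<bar>t\<bar>" using t by auto
      then have "ln (min 1 \<bar>t\<bar>) < - (1 / \<epsilon>)" by (metis exp_less_cancel_iff exp_ln)
      then have *: "1 / \<epsilon> < 1 - ln (min 1 \<bar>t\<bar>)" by linarith
      have "\<bar>log_modulus t\<bar> = 1 / (1 - ln (min 1 \<bar>t\<bar>))"
        by (rule abs_log_modulus[OF t(1)])
      also have "\<dots> < \<epsilon>"
        using * \<epsilon> log_modulus_denominator_ge_1[OF t(1)]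
        by (subst pos_divide_less_eq) (linarith, simp add: pos_divide_less_eq mult.commute)
      finally show ?thesis by simp
    qed
    then show "\<forall>\<^sub>F t in at 0. dist (log_modulus t) 0 < \<epsilon>"
      unfolding eventually_at by (intro exI[of _ "exp (- (1 / \<epsilon>))"]) auto
  qed
  then show ?thesis using True by (simp add: isCont_def log_modulus_def)
qed

text \<open>An antiderivative of \<open>1 / (s (1 - ln s))\<close> is \<open>- ln (1 - ln s)\<close>, which is unbounded as \<open>s\<close> tends to
0.\<close>

lemma nn_integral_log_modulus_over_s:
  assumes "0 < d" "d \<le> b" "b \<le> 1"
  shows "(\<integral>\<^sup>+s. ennreal (1 / (s * (1 - ln s))) * indicator {d..b} s \<partial>lborel)
    = ennreal (ln (1 - ln d) - ln (1 - ln b))"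
proof -
  have pos: "ln s < 1" if "s \<in> {d..b}" for s
  proof -
    have "ln s \<le> 0" using assms that by simp
    then show ?thesis by linarith
  qed
  have "(\<integral>\<^sup>+s. ennreal (1 / (s * (1 - ln s))) * indicator {d..b} s \<partial>lborel)
    = ennreal (- ln (1 - ln b) - (- ln (1 - ln d)))"
  proof (rule nn_integral_FTC_Icc)
    fix s assume s: "s \<in> {d..b}"
    have "0 < s" using s assms by simp
    then show "((\<lambda>s. - ln (1 - ln s)) has_real_derivative 1 / (s * (1 - ln s))) (at s)"
      using pos[OF s] by (auto intro!: derivative_eq_intros simp: field_simps)
    show "0 \<le> 1 / (s * (1 - ln s))" using \<open>0 < s\<close> pos[OF s] by simp
  qed (use assms in auto)
  then show ?thesis by simp
qed

text \<open>The integral of a wave of frequency \<open>k\<close> against the bump is a value of the Fourier transform of the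
bump, hence \<open>O(1 / k\<^sup>2)\<close>.\<close>

lemma integral_test_wave_bounded:
  fixes e :: "real^'n"
  assumes e: "norm e = 1"
  obtains B where "\<And>K a. (\<And>k. norm (a k) \<le> 1) \<Longrightarrow> norm (LINT x|lborel. test_wave e {- int K..int K} a x) \<le> B"
proof -
  obtain C where C: "C \<ge> 0" "\<And>y::real^'n. norm (cube_bump_hat y) \<le> C / (1 + (norm y)\<^sup>2)"
    using cube_bump_hat_decay by blast
  obtain L where L: "\<And>K. (\<Sum>k\<in>{- int K..int K}. 1 / (1 + (real_of_int k)\<^sup>2)) \<le> L"
    using sum_int_interval_inverse_square_bounded by blast
  let ?c = "(2 * pi) ^ CARD('n)"
  let ?E = "\<lambda>k x. exp (\<i> * of_real ((of_int k *\<^sub>R e) \<bullet> x)) * complex_of_real (cube_bump x)"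
  show thesis
  proof (rule that[of "?c * C * L"])
    fix K and a :: "int \<Rightarrow> complex" assume a: "\<And>k. norm (a k) \<le> 1"
    let ?I = "{- int K..int K}"
    have int: "integrable lborel (\<lambda>x. a k * ?E k x)" for k
    proof (intro integrable_mult_right bounded_phase_integrable[where B = 1] cube_bump_integrable)
      show "(\<lambda>x. exp (\<i> * of_real ((of_int k *\<^sub>R e) \<bullet> x))) \<in> borel_measurable lborel" by measurable
    qed (simp only: norm_exp_i_times order_refl)
    have "test_wave e ?I a x = (\<Sum>k\<in>?I. a k * ?E k x)" for x
      unfolding test_wave_def wave_sum_def wave_def sum_distrib_left
      by (intro sum.cong refl) (simp add: inner_commute[of e x] mult_ac)
    then have "(LINT x|lborel. test_wave e ?I a x) = (\<Sum>k\<in>?I. a k * (LINT x|lborel. ?E k x))"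
      by (simp only: Bochner_Integration.integral_sum[OF int] integral_mult_right_zero)
    also have "\<dots> = (\<Sum>k\<in>?I. a k * (of_real ?c * cube_bump_hat (of_int k *\<^sub>R e)))"
      unfolding cube_bump_fourier ..
    also have "norm \<dots> \<le> (\<Sum>k\<in>?I. ?c * C * (1 / (1 + (real_of_int k)\<^sup>2)))"
    proof (rule sum_norm_le)
      fix k
      have "norm (a k * (of_real ?c * cube_bump_hat (of_int k *\<^sub>R e))) = norm (a k) * (?c * norm (cube_bump_hat (of_int k *\<^sub>R e)))"
        by (simp only: norm_mult norm_of_real) simp
      also have "\<dots> \<le> 1 * (?c * (C / (1 + (norm (of_int k *\<^sub>R e))\<^sup>2)))"
        by (intro mult_mono a C(2) order_refl) auto
      also have "\<dots> = ?c * C * (1 / (1 + (real_of_int k)\<^sup>2))" using e by simp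
      finally show "norm (a k * (of_real ?c * cube_bump_hat (of_int k *\<^sub>R e))) \<le> ?c * C * (1 / (1 + (real_of_int k)\<^sup>2))" .
    qed
    also have "\<dots> \<le> ?c * C * L"
      unfolding sum_distrib_left[symmetric] using C(1) by (intro mult_left_mono L) auto
    finally show "norm (LINT x|lborel. test_wave e ?I a x) \<le> ?c * C * L" .
  qed
qed

lemma Re_inverse_one_minus_ge:
  assumes "norm z < 1" shows "1 / 2 \<le> Re (1 / (1 - z))"
proof -
  let ?w = "1 - z"
  have "?w \<noteq> 0" using assms by auto
  then have p: "0 < (norm ?w)\<^sup>2" by simp
  have "(norm z)\<^sup>2 \<le> 1" using assms by (simp add: power_le_one)
  moreover have "(norm ?w)\<^sup>2 = 1 - 2 * Re z + (norm z)\<^sup>2"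
    unfolding cmod_power2 by (simp add: power2_eq_square algebra_simps)
  ultimately have "(norm ?w)\<^sup>2 \<le> 2 * Re ?w" by simp
  moreover have "Re (1 / ?w) = Re ?w / (norm ?w)\<^sup>2"
    by (simp add: Re_divide cmod_power2)
  moreover have "1 / 2 \<le> Re ?w / (norm ?w)\<^sup>2" if "(norm ?w)\<^sup>2 \<le> 2 * Re ?w"
    using p that by (subst pos_le_divide_eq) auto
  ultimately show ?thesis by simp
qed

text \<open>These are truncated Poisson kernels. With \<open>z = r exp (i x \<bullet> e)\<close>, the full sum approximates
\<open>Re ((1 + z) / (1 - z)) \<ge> 0\<close>, so its \<open>L\<^sup>1\<close> norm against the bump is controlled by its integral. The
imaginary part of the negative frequencies approximates minus the conjugate kernel, which
behaves like \<open>1 / (x \<bullet> e)\<close> where \<open>\<bar>x \<bullet> e\<bar>\<close> is small but exceeds \<open>1 - r\<close>.\<close>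

lemma poisson_wave_sum:
  fixes e :: "real^'n"
  assumes r: "0 \<le> r" "r < 1"
  obtains K a where "\<And>k. norm (a k) \<le> 1"
    "\<And>x. norm (wave_sum e {- int K..int K} a x) \<le> Re (wave_sum e {- int K..int K} a x) + 4"
    "\<And>x. \<bar>- Im (wave_sum e {- int K..<0} a x) - r * sin (x \<bullet> e) / (norm (1 - of_real r * cis (- (x \<bullet> e))))\<^sup>2\<bar> \<le> 1"
proof -
  obtain K where K: "\<And>z::complex. norm z \<le> r \<Longrightarrow> norm ((\<Sum>k=1..K. z ^ k) - (1 / (1 - z) - 1)) \<le> 1"
    using geometric_partial_sums[OF r] by blast
  define a :: "int \<Rightarrow> complex" where "a k = of_real (r ^ nat \<bar>k\<bar>)" for k
  define P where "P z = (\<Sum>k=1..K. z ^ k)" for z :: complex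
  have neg: "wave_sum e {- int K..<0} a x = P (of_real r * cis (- (x \<bullet> e)))" for x
    unfolding wave_sum_negative P_def by (intro sum.cong refl) (simp add: a_def power_mult_distrib)
  have sym: "wave_sum e {- int K..int K} a x = 1 + P (of_real r * cis (- (x \<bullet> e))) + P (of_real r * cis (x \<bullet> e))" for x
  proof -
    have "(\<Sum>k=1..K. a (int k) * cis (x \<bullet> e) ^ k) = P (of_real r * cis (x \<bullet> e))"
      unfolding P_def by (intro sum.cong refl) (simp add: a_def power_mult_distrib)
    moreover have "(\<Sum>k=1..K. a (- int k) * cis (- (x \<bullet> e)) ^ k) = P (of_real r * cis (- (x \<bullet> e)))"
      using neg[of x] unfolding wave_sum_negative .
    moreover have "a 0 = 1" by (simp add: a_def)
    ultimately show ?thesis unfolding wave_sum_symmetric by simp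
  qed
  have nz: "norm (of_real r * cis t) \<le> r" for t using r by (simp add: norm_mult)
  show thesis
  proof (rule that[of a K])
    show "norm (a k) \<le> 1" for k using r by (simp add: a_def norm_power power_le_one)
  next
    fix x
    let ?z = "of_real r * cis (x \<bullet> e)" and ?w = "of_real r * cis (- (x \<bullet> e))"
    have w: "?w = cnj ?z" by (simp add: cis_cnj)
    have "P ?w = cnj (P ?z)" unfolding P_def w by simp
    then have eq: "wave_sum e {- int K..int K} a x = of_real (1 + 2 * Re (P ?z))"
      unfolding sym by (simp add: complex_eq_iff)
    have "\<bar>Re (P ?z - (1 / (1 - ?z) - 1))\<bar> \<le> 1"
      using abs_Re_le_cmod K[OF nz] unfolding P_def by (rule order_trans)
    moreover have "1 / 2 \<le> Re (1 / (1 - ?z))"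
      using nz[of "x \<bullet> e"] r by (intro Re_inverse_one_minus_ge) linarith
    ultimately have "- 2 \<le> 1 + 2 * Re (P ?z)"
      unfolding minus_complex.sel one_complex.sel by linarith
    then show "norm (wave_sum e {- int K..int K} a x) \<le> Re (wave_sum e {- int K..int K} a x) + 4"
      unfolding eq norm_of_real Re_complex_of_real by linarith
  next
    fix x
    let ?w = "of_real r * cis (- (x \<bullet> e))"
    have "\<bar>Im (P ?w - (1 / (1 - ?w) - 1))\<bar> \<le> 1"
      using abs_Im_le_cmod K[OF nz] unfolding P_def by (rule order_trans)
    moreover have "Im (1 / (1 - ?w)) = - (r * sin (x \<bullet> e) / (norm (1 - ?w))\<^sup>2)"
      by (simp add: Im_divide cmod_power2)
    ultimately show "\<bar>- Im (wave_sum e {- int K..<0} a x) - r * sin (x \<bullet> e) / (norm (1 - ?w))\<^sup>2\<bar> \<le> 1"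
      unfolding neg minus_complex.sel one_complex.sel by linarith
  qed
qed

lemma sin_ge_half:
  assumes "0 \<le> t" "t \<le> (1::real)" shows "t / 2 \<le> sin t"
proof -
  have "\<bar>sin t - (\<Sum>m<2. sin_coeff m * t ^ m)\<bar> \<le> inverse (fact 2) * \<bar>t\<bar> ^ 2"
    by (rule Maclaurin_sin_bound)
  moreover have "(\<Sum>m<2. sin_coeff m * t ^ m) = t"
    by (simp add: numeral_2_eq_2 sin_coeff_def)
  ultimately have "\<bar>sin t - t\<bar> \<le> t\<^sup>2 / 2" by simp
  then have "t - t\<^sup>2 / 2 \<le> sin t" by linarith
  moreover have "t\<^sup>2 \<le> t" using assms by (simp add: power2_eq_square mult_left_le)
  ultimately show ?thesis by linarith
qed

lemma log_modulus_times_sin_nonneg: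
  assumes "\<bar>t\<bar> \<le> 1" shows "0 \<le> log_modulus t * sin t"
proof -
  have D: "0 \<le> 1 / (1 - ln (min 1 \<bar>t\<bar>))" if "t \<noteq> 0"
    using abs_log_modulus[OF that] abs_ge_zero by metis
  have eq: "log_modulus t * sin t = (sgn t * sin t) * (1 / (1 - ln (min 1 \<bar>t\<bar>)))"
    by (simp add: log_modulus_def)
  have "0 \<le> sgn t * sin t"
    using sin_ge_half[of t] sin_ge_half[of "- t"] assms by (cases "t > 0") (auto simp: sgn_if)
  then show ?thesis
    using D unfolding eq by (cases "t = 0") auto
qed

text \<open>The integrand is the quotient \<open>log_modulus s / s\<close> at \<open>s = x \<bullet> e\<close>, restricted to
\<open>d \<le> s \<le> 1/16\<close>. Its integral over a ball is at least a multiple of \<open>ln (1 - ln d)\<close>, up to a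
constant.\<close>

lemma slice_integral_log_unbounded:
  fixes e :: "real^'n"
  assumes e: "norm e = 1"
  defines "H \<equiv> \<lambda>d s. indicator {d..1/16} s * (1 / (s * (1 - ln s)))"
  shows "\<And>d. 0 < d \<Longrightarrow> integrable lborel (\<lambda>x::real^'n. indicator (cball 0 (1/4)) x * H d (x \<bullet> e))"
    and "\<exists>d. 0 < d \<and> d \<le> 1/16 \<and> M \<le> (LINT x|lborel. indicator (cball 0 (1/4)) (x::real^'n) * H d (x \<bullet> e))"
proof -
  have H_bd: "0 \<le> H d s \<and> H d s \<le> 1 / d" if "0 < d" for d s
  proof (cases "s \<in> {d..1/16}")
    case True
    then have s: "d \<le> s" "0 < s" "s \<le> 1" using that by auto
    then have ln: "1 \<le> 1 - ln s" by simp
    have "d * 1 \<le> s * (1 - ln s)" by (rule mult_mono[OF s(1) ln]) (use s(2) in linarith)+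
    then have ds: "d \<le> s * (1 - ln s)" by simp
    then have "1 / (s * (1 - ln s)) \<le> 1 / d" using that by (simp add: frac_le)
    moreover have "0 \<le> 1 / (s * (1 - ln s))" using ds that by (intro divide_nonneg_nonneg) linarith+
    ultimately show ?thesis using True by (simp add: H_def)
  qed (use that in \<open>simp add: H_def\<close>)
  have [measurable]: "H d \<in> borel_measurable borel" for d unfolding H_def by measurable
  have [measurable]: "cball (0::real^'n) r \<in> sets borel" for r by simp
  show int: "integrable lborel (\<lambda>x::real^'n. indicator (cball 0 (1/4)) x * H d (x \<bullet> e))" if d: "0 < d" for d
  proof (rule Bochner_Integration.integrable_bound)
    show "integrable lborel (\<lambda>x::real^'n. 1 / d * indicator (cball 0 (1/4)) x)"
      using emeasure_bounded_finite[OF bounded_cball] by (intro integrable_mult_right integrable_real_indicator) auto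
    show "AE x in lborel. norm (indicator (cball 0 (1/4)) x * H d (x \<bullet> e)) \<le> norm (1 / d * indicator (cball 0 (1/4)) (x::real^'n))"
      using H_bd[OF d] d by (intro AE_I2) (auto simp: indicator_def)
  qed measurable
  define v where "v = measure lborel (cball (0::real^'n) (1/16))"
  have v: "v > 0" unfolding v_def by (rule measure_lborel_pos[where U = "ball 0 (1/16)"]) auto
  define c where "c = ln (1 - ln (1/16 :: real))"
  \<comment> \<open>By the choice of \<open>d\<close> below, \<open>T\<close> is the value of \<open>ln (1 - ln d)\<close>.\<close>
  define T where "T = max c (max 0 (M / (4 * v) + c))"
  define d where "d = exp (1 - exp T)"
  have d: "0 < d" by (simp add: d_def)
  have ln16: "ln (1/16 :: real) \<le> 0" by simp
  have "exp c \<le> exp T" by (simp add: T_def)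
  moreover have "exp c = 1 - ln (1/16)" unfolding c_def using ln16 by (intro exp_ln) linarith
  ultimately have "ln d \<le> ln (1/16)" by (simp add: d_def)
  then have d16: "d \<le> 1/16" using d by simp
  have lnd: "ln (1 - ln d) = T" by (simp add: d_def)
  have Hc: "ennreal (H d s) * indicator {- (1/4) / 4..(1/4) / 4} s = ennreal (1 / (s * (1 - ln s))) * indicator {d..1/16} s" for s
    using d by (auto simp: H_def indicator_def)
  have em: "emeasure lborel (cball (0::real^'n) ((1/4)/4)) = ennreal v"
    using emeasure_bounded_finite[OF bounded_cball, of "0::real^'n" "1/16"]
    by (simp add: v_def emeasure_eq_ennreal_measure)
  define I where "I = (LINT x|lborel. indicator (cball 0 (1/4)) (x::real^'n) * H d (x \<bullet> e))"
  have I: "(\<integral>\<^sup>+x. ennreal (H d (x \<bullet> e)) * indicator (cball 0 (1/4)) (x::real^'n) \<partial>lborel) = ennreal I"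
  proof -
    have "ennreal (H d (x \<bullet> e)) * indicator (cball 0 (1/4)) (x::real^'n) = ennreal (indicator (cball 0 (1/4)) x * H d (x \<bullet> e))" for x
      by (auto simp: indicator_def)
    then show ?thesis unfolding I_def
      using int[OF d] H_bd[OF d] by (simp add: nn_integral_eq_integral)
  qed
  have "ennreal v * ennreal (T - c) \<le> ennreal (1/4) * ennreal I"
    using nn_integral_ridge_ge[OF e, of "1/4" "\<lambda>s. ennreal (H d s)"]
      nn_integral_log_modulus_over_s[OF d d16] unfolding Hc em I lnd c_def by simp
  moreover have "0 \<le> I" unfolding I_def using H_bd[OF d] by (intro Bochner_Integration.integral_nonneg) auto
  ultimately have "ennreal (v * (T - c)) \<le> ennreal (1/4 * I)"
    using v by (subst (1 2) ennreal_mult) (auto simp: T_def)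
  then have "v * (T - c) \<le> I / 4" using \<open>0 \<le> I\<close> by (subst (asm) ennreal_le_iff) auto
  moreover have "v * (M / (4 * v)) \<le> v * (T - c)"
    using v by (intro mult_left_mono) (auto simp: T_def)
  ultimately have "M \<le> I" using v by simp
  then show "\<exists>d. 0 < d \<and> d \<le> 1/16 \<and> M \<le> (LINT x|lborel. indicator (cball 0 (1/4)) (x::real^'n) * H d (x \<bullet> e))"
    using d d16 unfolding I_def by blast
qed

text \<open>The continuous function of compact support whose image under the multiplier is not locally bounded.\<close>

definition log_ridge :: "real^'n \<Rightarrow> real^'n \<Rightarrow> real" where
  "log_ridge e x = max 0 (1/2 - norm x) * log_modulus (x \<bullet> e)"

lemma log_ridge_continuous: "continuous_on UNIV (log_ridge e)"
proof -
  have "continuous_on UNIV log_modulus"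
    using log_modulus_isCont by (simp add: continuous_on_eq_continuous_at)
  then have "continuous_on UNIV (\<lambda>x. log_modulus (x \<bullet> e))"
    by (rule continuous_on_compose2) (auto intro: continuous_intros)
  then show ?thesis
    unfolding log_ridge_def[abs_def] by (intro continuous_intros)
qed

lemma log_ridge_eq_0: "1/2 < norm x \<Longrightarrow> log_ridge e x = 0"
  by (simp add: log_ridge_def)

lemma log_ridge_bound: "\<bar>log_ridge e x\<bar> \<le> indicator (cball 0 (1/2)) x"
proof (cases "x \<in> cball 0 (1/2)")
  case True
  have "max 0 (1/2 - norm x) \<le> 1"
    by (intro max.boundedI) (use norm_ge_zero[of x] in linarith)+
  then have "\<bar>log_ridge e x\<bar> \<le> 1 * 1"
    unfolding log_ridge_def abs_mult by (intro mult_mono abs_log_modulus_le) auto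
  with True show ?thesis by simp
qed (simp add: log_ridge_eq_0)

lemma integrable_indicator_cball: "integrable lborel (indicat_real (cball (x::'a::euclidean_space) r))"
  using emeasure_bounded_finite[OF bounded_cball] by (intro integrable_real_indicator) auto

lemma log_ridge_integrable: "integrable lborel (log_ridge (e::real^'n))"
proof (rule Bochner_Integration.integrable_bound[OF integrable_indicator_cball])
  show "log_ridge e \<in> borel_measurable lborel"
    using borel_measurable_continuous_onI[OF log_ridge_continuous] by simp
  show "AE x in lborel. norm (log_ridge e x) \<le> norm (indicat_real (cball 0 (1/2)) x)"
    using log_ridge_bound by (intro AE_I2) simp
qed

text \<open>\<open>log_modulus\<close> and the conjugate Poisson kernel have the same sign, so their product is nonnegative
and no cancellation occurs. For \<open>d \<le> x \<bullet> e \<le> 1/16\<close> the denominator of the kernel is at most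
\<open>4 (x \<bullet> e)\<^sup>2\<close>, which makes the kernel at least \<open>1 / (16 (x \<bullet> e))\<close>; a further factor \<open>1/4\<close> comes from
\<open>max 0 (1/2 - norm x)\<close>.\<close>

lemma log_ridge_poisson_lower_bound:
  fixes e x :: "real^'n"
  assumes e: "norm e = 1" and d: "0 < d" "d \<le> 1/16"
    and w: "\<bar>w - (1 - d) * sin (x \<bullet> e) / (norm (1 - of_real (1 - d) * cis (- (x \<bullet> e))))\<^sup>2\<bar> \<le> 1"
  shows "exp (-4) ^ CARD('n) / 64 * (indicator (cball 0 (1/4)) x * (indicator {d..1/16} (x \<bullet> e) * (1 / ((x \<bullet> e) * (1 - ln (x \<bullet> e))))))
      - indicator (cball 0 (1/2)) x \<le> log_ridge e x * (cube_bump x * w)"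
    (is "?q / 64 * ?H - _ \<le> _")
proof (cases "1/2 < norm x")
  case True
  then show ?thesis by (simp add: log_ridge_eq_0)
next
  case False
  let ?s = "x \<bullet> e" and ?n = "norm (1 - of_real (1 - d) * cis (- (x \<bullet> e)))"
  let ?m = "(1 - d) * sin ?s / ?n\<^sup>2"
  have chi: "0 \<le> cube_bump x" "cube_bump x \<le> 1" by (rule cube_bump_bounds)+
  have s: "\<bar>?s\<bar> \<le> 1/2" using Cauchy_Schwarz_ineq2[of x e] e False by simp
  have "0 \<le> max 0 (1/2 - norm x) * (log_modulus ?s * sin ?s) * ((1 - d) / ?n\<^sup>2)"
  proof (rule mult_nonneg_nonneg[OF mult_nonneg_nonneg[OF max.cobounded1]])
    show "0 \<le> log_modulus ?s * sin ?s" using s by (intro log_modulus_times_sin_nonneg) simp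
    show "0 \<le> (1 - d) / ?n\<^sup>2" using d by simp
  qed
  then have nonneg: "0 \<le> log_ridge e x * ?m" by (simp add: log_ridge_def mult_ac)
  have main: "?q / 64 * ?H \<le> (log_ridge e x * ?m) * cube_bump x"
  proof (cases "x \<in> cball 0 (1/4) \<and> ?s \<in> {d..1/16}")
    case True
    then have x: "norm x \<le> 1/4" and t: "d \<le> ?s" "?s \<le> 1/16" "0 < ?s" using d by auto
    have lm: "log_modulus ?s = 1 / (1 - ln ?s)" using t by (simp add: log_modulus_def)
    have "ln ?s \<le> 0" using t by simp
    then have lp: "0 \<le> 1 / (1 - ln ?s)" by simp
    have n: "?n \<le> 2 * ?s" using norm_one_minus_cis_le[of "1 - d" "- ?s"] d t by simp
    have "1 - of_real (1 - d) * cis (- ?s) \<noteq> 0"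
    proof
      assume "1 - of_real (1 - d) * cis (- ?s) = 0"
      then have "norm (of_real (1 - d) * cis (- ?s)) = 1" by (metis eq_iff_diff_eq_0 norm_one)
      then show False using d by (simp only: norm_mult norm_of_real norm_cis) simp
    qed
    then have "0 < ?n" by simp
    have n2: "?n\<^sup>2 \<le> 4 * ?s\<^sup>2" using power_mono[OF n, of 2] by (simp add: power_mult_distrib)
    have "1 / (16 * ?s) = (1/2 * (?s / 2)) / (4 * ?s\<^sup>2)" using t by (simp add: power2_eq_square)
    also have "\<dots> \<le> ?m"
      using sin_ge_half[of ?s] t d n2 \<open>0 < ?n\<close> by (intro frac_le mult_mono mult_nonneg_nonneg) auto
    finally have m: "1 / (16 * ?s) \<le> ?m" .
    have "1/4 * (1 / (1 - ln ?s)) \<le> log_ridge e x"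
      unfolding log_ridge_def lm using x lp by (intro mult_right_mono) auto
    moreover from this have "0 \<le> log_ridge e x" using lp by linarith
    ultimately have "1/4 * (1 / (1 - ln ?s)) * (1 / (16 * ?s)) \<le> log_ridge e x * ?m"
      using t by (intro mult_mono[OF _ m]) auto
    moreover have "?q \<le> cube_bump x" using x by (intro cube_bump_lower) simp
    ultimately have "1/4 * (1 / (1 - ln ?s)) * (1 / (16 * ?s)) * ?q \<le> (log_ridge e x * ?m) * cube_bump x"
      by (rule mult_mono[OF _ _ nonneg]) simp
    then show ?thesis using True by (simp add: mult_ac)
  next
    case False
    then have H0: "?H = 0" by (auto simp: indicator_def)
    show ?thesis unfolding H0 using mult_nonneg_nonneg[OF nonneg chi(1)] by linarith
  qed
  have "\<bar>log_ridge e x * (cube_bump x * (w - ?m))\<bar> \<le> 1 * (1 * 1)"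
    unfolding abs_mult using w chi order_trans[OF log_ridge_bound indicator_le_1, of e x] by (intro mult_mono) auto
  moreover have "log_ridge e x * (cube_bump x * w) = (log_ridge e x * ?m) * cube_bump x + log_ridge e x * (cube_bump x * (w - ?m))"
    by (simp add: algebra_simps)
  moreover have "indicat_real (cball 0 (1/2)) x = 1" using False by simp
  moreover have "a - i \<le> b" if "\<bar>z\<bar> \<le> 1 * (1 * 1)" "b = y + z" "i = 1" "a \<le> y" for a b i y z :: real
    using that by linarith
  ultimately show ?thesis using main by blast
qed

lemma ex_log_ridge_large_negative_pairings:
  fixes e :: "real^'n"
  assumes e: "norm e = 1"
  obtains B where "\<And>N. \<exists>K a. (\<forall>k. norm (a k) \<le> 1) \<and>
      (LINT x|lborel. norm (test_wave e {- int K..int K} a x)) \<le> B \<and>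
      N \<le> norm (LINT x|lborel. of_real (log_ridge e x) * test_wave e {- int K..<0} a x)"
proof -
  obtain B0 where B0: "\<And>K a. (\<And>k. norm (a k) \<le> 1) \<Longrightarrow> norm (LINT x|lborel. test_wave e {- int K..int K} a x) \<le> B0"
    using integral_test_wave_bounded[OF e] by blast
  let ?q = "exp (-4 :: real) ^ CARD('n)"
  let ?b = "(LINT x|lborel. indicat_real (cball (0::real^'n) (1/2)) x)"
  have q: "0 < ?q" by simp
  have chi_int: "integrable lborel (cube_bump :: real^'n \<Rightarrow> real)"
    using cube_bump_integrable by (simp add: complex_of_real_integrable_eq)
  show thesis
  proof (rule that[of "B0 + 4 * (LINT x|lborel. cube_bump (x::real^'n))"])
    fix N :: real
    let ?H = "\<lambda>d x. indicator (cball 0 (1/4)) x * (indicator {d..1/16} (x \<bullet> e) * (1 / ((x \<bullet> e) * (1 - ln (x \<bullet> e)))))"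
    obtain d where d: "0 < d" "d \<le> 1/16" and large: "(N + ?b) * 64 / ?q \<le> (LINT x|lborel. ?H d (x::real^'n))"
      using slice_integral_log_unbounded(2)[OF e] by blast
    have int_H: "integrable lborel (?H d)" using slice_integral_log_unbounded(1)[OF e d(1)] .
    obtain K a where a: "\<And>k. norm (a k) \<le> 1"
      and sym: "\<And>x. norm (wave_sum e {- int K..int K} a x) \<le> Re (wave_sum e {- int K..int K} a x) + 4"
      and neg: "\<And>x. \<bar>- Im (wave_sum e {- int K..<0} a x) - (1 - d) * sin (x \<bullet> e) / (norm (1 - of_real (1 - d) * cis (- (x \<bullet> e))))\<^sup>2\<bar> \<le> 1"
    proof (rule poisson_wave_sum[of "1 - d" e])
      show "0 \<le> 1 - d" "1 - d < 1" using d by auto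
    qed (rule that)
    let ?P = "test_wave e {- int K..int K} a" and ?M = "test_wave e {- int K..<0} a"
    have int_P: "integrable lborel ?P" by (rule test_wave_integrable[OF a])
    have "(LINT x|lborel. norm (?P x)) \<le> (LINT x|lborel. Re (?P x) + 4 * cube_bump x)"
    proof (rule Bochner_Integration.integral_mono)
      show "integrable lborel (\<lambda>x. norm (?P x))" using int_P by (rule integrable_norm)
      show "integrable lborel (\<lambda>x. Re (?P x) + 4 * cube_bump x)"
        using int_P chi_int by (intro Bochner_Integration.integrable_add integrable_mult_right integrable_Re)
      fix x
      have "norm (?P x) = cube_bump x * norm (wave_sum e {- int K..int K} a x)"
        using cube_bump_bounds[of x] by (simp add: test_wave_def norm_mult)
      also have "\<dots> \<le> cube_bump x * (Re (wave_sum e {- int K..int K} a x) + 4)"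
        using cube_bump_bounds[of x] sym[of x] by (intro mult_left_mono)
      also have "\<dots> = Re (?P x) + 4 * cube_bump x"
        by (simp add: test_wave_def algebra_simps)
      finally show "norm (?P x) \<le> Re (?P x) + 4 * cube_bump x" .
    qed
    also have "\<dots> = Re (LINT x|lborel. ?P x) + 4 * (LINT x|lborel. cube_bump (x::real^'n))"
      using int_P chi_int by (simp add: integral_Re)
    also have "\<dots> \<le> B0 + 4 * (LINT x|lborel. cube_bump (x::real^'n))"
      using B0[of a K, OF a] complex_Re_le_cmod[of "LINT x|lborel. ?P x"] by simp
    finally have L1: "(LINT x|lborel. norm (?P x)) \<le> B0 + 4 * (LINT x|lborel. cube_bump (x::real^'n))" .
    have int_M: "integrable lborel (\<lambda>x. of_real (log_ridge e x) * ?M x)"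
    proof (rule bounded_phase_integrable[where B = 1])
      show "integrable lborel ?M" by (rule test_wave_integrable[OF a])
      show "(\<lambda>x. complex_of_real (log_ridge e x)) \<in> borel_measurable lborel"
        using log_ridge_integrable[of e] by auto
      show "norm (complex_of_real (log_ridge e x)) \<le> 1" for x
        using order_trans[OF log_ridge_bound indicator_le_1, of e x] by simp
    qed
    let ?w = "\<lambda>x. - Im (wave_sum e {- int K..<0} a x)"
    have Im: "- Im (of_real (log_ridge e x) * ?M x) = log_ridge e x * (cube_bump x * ?w x)" for x
      by (simp add: test_wave_def)
    have "N \<le> ?q / 64 * (LINT x|lborel. ?H d (x::real^'n)) - ?b"
      using large q by (simp add: divide_le_eq field_simps)
    also have "\<dots> = (LINT x|lborel. ?q / 64 * ?H d x - indicator (cball (0::real^'n) (1/2)) x)"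
      using int_H integrable_indicator_cball[of "0::real^'n" "1/2"]
      by (simp only: Bochner_Integration.integral_diff integral_mult_right_zero integrable_mult_right)
    also have "\<dots> \<le> (LINT x|lborel. log_ridge e x * (cube_bump x * ?w x))"
    proof (rule Bochner_Integration.integral_mono)
      have "integrable lborel (\<lambda>x. ?q / 64 * ?H d x)" using int_H by (rule integrable_mult_right)
      then show "integrable lborel (\<lambda>x. ?q / 64 * ?H d x - indicator (cball (0::real^'n) (1/2)) x)"
        by (intro Bochner_Integration.integrable_diff integrable_indicator_cball)
      show "integrable lborel (\<lambda>x. log_ridge e x * (cube_bump x * ?w x))"
        unfolding Im[symmetric] using int_M by (intro Bochner_Integration.integrable_minus integrable_Im)
      show "?q / 64 * ?H d x - indicator (cball 0 (1/2)) x \<le> log_ridge e x * (cube_bump x * ?w x)" for x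
        by (rule log_ridge_poisson_lower_bound[OF e d neg])
    qed
    also have "\<dots> = - Im (LINT x|lborel. of_real (log_ridge e x) * ?M x)"
      unfolding Im[symmetric] by (simp only: integral_minus integral_Im[OF int_M])
    also have "\<dots> \<le> norm (LINT x|lborel. of_real (log_ridge e x) * ?M x)"
      using abs_Im_le_cmod[of "LINT x|lborel. of_real (log_ridge e x) * ?M x"] by linarith
    finally show "\<exists>K a. (\<forall>k. norm (a k) \<le> 1) \<and>
      (LINT x|lborel. norm (test_wave e {- int K..int K} a x)) \<le> B0 + 4 * (LINT x|lborel. cube_bump (x::real^'n)) \<and>
      N \<le> norm (LINT x|lborel. of_real (log_ridge e x) * test_wave e {- int K..<0} a x)"
      using a L1 by blast
  qed
qed

section \<open>Unboundedness of the multiplier\<close>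

lemma continuous_functions_subset_Linf_loc: "continuous_functions \<subseteq> Linf_loc"
proof
  fix h :: "real^'n \<Rightarrow> complex" assume "h \<in> continuous_functions"
  then have cont: "continuous_on UNIV h" by (simp add: continuous_functions_def)
  have "\<exists>C. AE x in lebesgue. x \<in> K \<longrightarrow> norm (h x) \<le> C" if "compact K" for K
  proof -
    have "bounded (h ` K)"
      using cont that by (intro compact_imp_bounded compact_continuous_image continuous_on_subset[OF cont]) auto
    then obtain C where "\<forall>y\<in>h ` K. norm y \<le> C" unfolding bounded_iff by blast
    then show ?thesis by (intro exI[of _ C] AE_I2) auto
  qed
  moreover have "h \<in> borel_measurable lebesgue"
    using borel_measurable_continuous_onI[OF cont] by (simp add: measurable_completion)
  ultimately show "h \<in> Linf_loc" by (simp add: Linf_loc_def)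
qed

lemma given_by_element_of_mono:
  "X \<subseteq> Y \<Longrightarrow> given_by_element_of u X \<Longrightarrow> given_by_element_of u Y"
  unfolding given_by_element_of_def by blast

text \<open>A locally integrable function pairs boundedly with uniformly bounded test functions that are
supported in a common compact set. The constant 10 matches the bound on the logarithmic sums above.\<close>

lemma given_by_L1_loc_test_wave_bound:
  fixes e :: "real^'n"
  assumes u: "given_by_element_of u L1_loc"
  obtains D where "\<And>K a. (\<And>x. norm (wave_sum e {- int K..int K} a x) \<le> 10) \<Longrightarrow>
    norm (u (test_wave e {- int K..int K} a)) \<le> D"
proof -
  obtain h where h: "h \<in> L1_loc" and eq: "\<And>\<phi>. \<phi> \<in> test_functions \<Longrightarrow> u \<phi> = dist_of h \<phi>"
    using u unfolding given_by_element_of_def by blast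
  let ?K = "cball (0::real^'n) (real CARD('n))"
  have int: "integrable lebesgue (\<lambda>x. 10 * norm (indicat_real ?K x *\<^sub>R h x))"
    using h unfolding L1_loc_def set_integrable_def by (intro integrable_mult_right integrable_norm) auto
  show thesis
  proof (rule that[of "LINT x|lebesgue. 10 * norm (indicat_real ?K x *\<^sub>R h x)"])
    fix K a assume w: "\<And>x. norm (wave_sum e {- int K..int K} a x) \<le> 10"
    let ?P = "test_wave e {- int K..int K} a"
    have "norm (u ?P) \<le> (LINT x|lebesgue. norm (h x * ?P x))"
      unfolding eq[OF test_wave_test_function[OF finite_atLeastAtMost_int]] dist_of_def
      by (rule integral_norm_bound)
    also have "\<dots> \<le> (LINT x|lebesgue. 10 * norm (indicat_real ?K x *\<^sub>R h x))"
    proof (rule integral_mono'[OF int])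
      fix x :: "real^'n"
      show "norm (h x * ?P x) \<le> 10 * norm (indicat_real ?K x *\<^sub>R h x)"
      proof (cases "x \<in> ?K")
        case True
        have "norm (?P x) \<le> 1 * 10"
          unfolding test_wave_def norm_mult using cube_bump_bounds[of x] w by (intro mult_mono) auto
        then show ?thesis using True by (simp add: norm_mult mult.commute mult_left_mono)
      next
        case False
        then show ?thesis by (simp add: test_wave_def cube_bump_eq_0)
      qed
    qed simp
    finally show "norm (u ?P) \<le> (LINT x|lebesgue. 10 * norm (indicat_real ?K x *\<^sub>R h x))" .
  qed
qed

text \<open>Dually, a locally bounded function is controlled by the \<open>L\<^sup>1\<close> norm of the test function.\<close>

lemma given_by_Linf_loc_test_wave_bound:
  fixes e :: "real^'n"
  assumes u: "given_by_element_of u Linf_loc"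
  obtains D where "D \<ge> 0" "\<And>K a. (\<And>k. norm (a k) \<le> 1) \<Longrightarrow>
    norm (u (test_wave e {- int K..int K} a)) \<le> D * (LINT x|lborel. norm (test_wave e {- int K..int K} a x))"
proof -
  obtain h where h: "h \<in> Linf_loc" and eq: "\<And>\<phi>. \<phi> \<in> test_functions \<Longrightarrow> u \<phi> = dist_of h \<phi>"
    using u unfolding given_by_element_of_def by blast
  let ?K = "cball (0::real^'n) (real CARD('n))"
  have "\<forall>K. compact K \<longrightarrow> (\<exists>C. AE x in lebesgue. x \<in> K \<longrightarrow> norm (h x) \<le> C)"
    using h by (simp add: Linf_loc_def)
  from this[rule_format, OF compact_cball]
  obtain C where C: "AE x in lebesgue. x \<in> ?K \<longrightarrow> norm (h x) \<le> C" ..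
  show thesis
  proof (rule that[of "max 0 C"])
    fix K and a :: "int \<Rightarrow> complex" assume a: "\<And>k. norm (a k) \<le> 1"
    let ?P = "test_wave e {- int K..int K} a"
    have int: "integrable lborel ?P" by (rule test_wave_integrable[OF a])
    have int': "integrable lebesgue (\<lambda>x. max 0 C * norm (?P x))"
      using int by (intro integrable_mult_right integrable_norm) (simp add: integrable_completion)
    have "norm (u ?P) \<le> (LINT x|lebesgue. norm (h x * ?P x))"
      unfolding eq[OF test_wave_test_function[OF finite_atLeastAtMost_int]] dist_of_def
      by (rule integral_norm_bound)
    also have "\<dots> \<le> (LINT x|lebesgue. max 0 C * norm (?P x))"
    proof (rule integral_mono_AE'[OF int'])
      show "AE x in lebesgue. norm (h x * ?P x) \<le> max 0 C * norm (?P x)"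
        using C
      proof eventually_elim
        case (elim x)
        show ?case
        proof (cases "x \<in> ?K")
          case True
          with elim show ?thesis by (simp add: norm_mult mult_right_mono)
        next
          case False
          then show ?thesis by (simp add: test_wave_def cube_bump_eq_0)
        qed
      qed
    qed simp
    also have "\<dots> = max 0 C * (LINT x|lborel. norm (?P x))"
      using int by (simp add: integral_completion)
    finally show "norm (u ?P) \<le> max 0 C * (LINT x|lborel. norm (?P x))" .
  qed simp
qed

theorem corollary3p7:
  fixes V\<^sub>0 V :: "(real^'n) set" and \<psi> :: "real^'n \<Rightarrow> complex"
  assumes "pos_cone V\<^sub>0" and "closed V\<^sub>0"
    and "pos_cone V" and "open V"
    and "V\<^sub>0 - {0} \<subseteq> V"
    and "smooth_cutoff V\<^sub>0 V \<psi>"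
    and "V\<^sub>0 - {0} \<noteq> {}"
    and "interior (dual_cone V) \<noteq> {}"
  shows "\<exists>f\<in>L1_comp. \<exists>g\<in>Linf_comp. \<exists>\<phi>\<in>continuous_comp.
    \<not> given_by_element_of (fourier_multiplier \<psi> (dist_of f)) L1_loc \<and>
    \<not> given_by_element_of (fourier_multiplier \<psi> (dist_of g)) Linf_loc \<and>
    \<not> given_by_element_of (fourier_multiplier \<psi> (dist_of \<phi>)) continuous_functions"
proof -
  obtain e c C where e: "norm e = 1" and c: "(c::real) > 0" and C: "\<And>\<xi>. norm (\<psi> \<xi>) \<le> C"
    and plus: "\<And>m \<zeta>. m > 0 \<Longrightarrow> norm (\<psi> (\<zeta> + m *\<^sub>R e) - of_real c) \<le> C * (1 + (norm \<zeta>)\<^sup>2) / m\<^sup>2"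
    and minus: "\<And>m \<zeta>. m > 0 \<Longrightarrow> norm (\<psi> (\<zeta> - m *\<^sub>R e)) \<le> C * (1 + (norm \<zeta>)\<^sup>2) / m\<^sup>2"
    using smooth_cutoff_asymptotics[OF assms(1,7,6,8)] by metis
  have "smooth \<psi>" using assms(6) by (simp add: smooth_cutoff_def)
  then have "continuous_on UNIV \<psi>"
    using smooth_has_derivative by (meson continuous_at_imp_continuous_on has_derivative_continuous)
  then have \<psi>: "\<psi> \<in> borel_measurable borel" by (rule borel_measurable_continuous_onI)
  obtain A where A: "\<And>K a f. (\<And>k. norm (a k) \<le> 1) \<Longrightarrow> integrable lborel f \<Longrightarrow>
    norm (fourier_multiplier \<psi> (dist_of f) (test_wave e {- int K..int K} a)
      - of_real c * (LINT x|lborel. f x * test_wave e {- int K..<0} a x))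
    \<le> A * (LINT x|lborel. norm (f x))"
    by (rule fourier_multiplier_pairing[OF \<psi> C, of e c]) (erule plus, erule minus, rule that, blast)
  have bound: "c * norm (LINT x|lborel. f x * test_wave e {- int K..<0} a x) \<le>
      norm (fourier_multiplier \<psi> (dist_of f) (test_wave e {- int K..int K} a)) + A * (LINT x|lborel. norm (f x))"
    if a: "\<forall>k. norm (a k) \<le> 1" and f: "integrable lborel f" for K a f
  proof -
    let ?u = "fourier_multiplier \<psi> (dist_of f) (test_wave e {- int K..int K} a)"
    let ?v = "LINT x|lborel. f x * test_wave e {- int K..<0} a x"
    have "norm (of_real c * ?v) \<le> norm ?u + norm (?u - of_real c * ?v)"
      using norm_triangle_sub[of "of_real c * ?v" ?u] by (simp add: norm_minus_commute)
    also have "norm (of_real c * ?v) = c * norm ?v" using c by (simp add: norm_mult)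
    finally show ?thesis using A[of a f K] a f by simp
  qed
  have compact_supp: "ae_compact_support f" if "\<And>x. 1/2 < norm x \<Longrightarrow> f x = 0" for f :: "real^'n \<Rightarrow> complex"
    unfolding ae_compact_support_def using that
    by (intro exI[of _ "cball 0 (1/2)"]) auto
  obtain f :: "real^'n \<Rightarrow> real" where f: "integrable lborel f" "\<And>x. 1/2 < norm x \<Longrightarrow> f x = 0"
    and f_large: "\<And>N. \<exists>K a. (\<forall>k. norm (a k) \<le> 1) \<and> (\<forall>x. norm (wave_sum e {- int K..int K} a x) \<le> 10) \<and>
      N \<le> norm (LINT x|lborel. of_real (f x) * test_wave e {- int K..<0} a x)"
    using ex_L1_large_negative_pairings[OF e] by blast
  \<comment> \<open>The function \<open>log_ridge e\<close> serves both as \<open>g\<close> and as \<open>\<phi>\<close>, since continuous functions are locally bounded.\<close>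
  let ?f = "\<lambda>x. complex_of_real (f x)" and ?g = "\<lambda>x. complex_of_real (log_ridge e x)"
  have int_f: "integrable lborel ?f" using f(1) by simp
  then have "integrable lebesgue ?f" by (subst integrable_completion) auto
  then have f_in: "?f \<in> L1_comp"
    using compact_supp[of ?f] f(2) by (simp add: L1_comp_def)
  have not_L1: "\<not> given_by_element_of (fourier_multiplier \<psi> (dist_of ?f)) L1_loc"
  proof
    assume "given_by_element_of (fourier_multiplier \<psi> (dist_of ?f)) L1_loc"
    from given_by_L1_loc_test_wave_bound[OF this, of e]
    obtain D where D: "\<And>K a. (\<And>x. norm (wave_sum e {- int K..int K} a x) \<le> 10) \<Longrightarrow>
      norm (fourier_multiplier \<psi> (dist_of ?f) (test_wave e {- int K..int K} a)) \<le> D" by metis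
    let ?b = "D + A * (LINT x|lborel. norm (?f x))"
    obtain K a where a: "\<forall>k. norm (a k) \<le> 1" "\<forall>x. norm (wave_sum e {- int K..int K} a x) \<le> 10"
      "(?b + 1) / c \<le> norm (LINT x|lborel. ?f x * test_wave e {- int K..<0} a x)"
      using f_large by blast
    have "c * norm (LINT x|lborel. ?f x * test_wave e {- int K..<0} a x) \<le> ?b"
      using bound[OF a(1) int_f, of K] D[of K a] a(2) by simp
    moreover have "?b + 1 \<le> c * norm (LINT x|lborel. ?f x * test_wave e {- int K..<0} a x)"
      using a(3) c by (simp add: divide_le_eq mult.commute)
    ultimately show False by linarith
  qed
  have int_g: "integrable lborel ?g" using log_ridge_integrable[of e] by simp
  have supp_g: "supp ?g \<subseteq> cball 0 (1/2)"
    unfolding supp_def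
  proof (rule closure_minimal)
    have "x \<in> cball 0 (1/2)" if "log_ridge e x \<noteq> 0" for x
      using that log_ridge_eq_0[of x e] by (cases "1/2 < norm x") auto
    then show "{x. ?g x \<noteq> 0} \<subseteq> cball 0 (1/2)" by auto
  qed simp
  have "compact (supp ?g)"
    using bounded_subset[OF bounded_cball supp_g] by (simp add: compact_eq_bounded_closed supp_def)
  then have g_in: "?g \<in> continuous_comp"
    using log_ridge_continuous[of e] by (auto simp: continuous_comp_def intro: continuous_intros)
  have not_Linf: "\<not> given_by_element_of (fourier_multiplier \<psi> (dist_of ?g)) Linf_loc"
  proof
    assume given: "given_by_element_of (fourier_multiplier \<psi> (dist_of ?g)) Linf_loc"
    obtain D where D: "D \<ge> 0" "\<And>K a. (\<And>k. norm (a k) \<le> 1) \<Longrightarrow>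
      norm (fourier_multiplier \<psi> (dist_of ?g) (test_wave e {- int K..int K} a)) \<le>
        D * (LINT x|lborel. norm (test_wave e {- int K..int K} a x))"
      using given_by_Linf_loc_test_wave_bound[OF given, of e] by metis
    obtain B where B: "\<And>N. \<exists>K a. (\<forall>k. norm (a k) \<le> 1) \<and>
      (LINT x|lborel. norm (test_wave e {- int K..int K} a x)) \<le> B \<and>
      N \<le> norm (LINT x|lborel. ?g x * test_wave e {- int K..<0} a x)"
      using ex_log_ridge_large_negative_pairings[OF e] by blast
    let ?b = "D * B + A * (LINT x|lborel. norm (?g x))"
    obtain K a where a: "\<forall>k. norm (a k) \<le> 1" "(LINT x|lborel. norm (test_wave e {- int K..int K} a x)) \<le> B"
      "(?b + 1) / c \<le> norm (LINT x|lborel. ?g x * test_wave e {- int K..<0} a x)"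
      using B by blast
    have "norm (fourier_multiplier \<psi> (dist_of ?g) (test_wave e {- int K..int K} a)) \<le> D * B"
      using D(2)[of a K] a(1) mult_left_mono[OF a(2) D(1)] by (meson order_trans)
    then have "c * norm (LINT x|lborel. ?g x * test_wave e {- int K..<0} a x) \<le> ?b"
      using bound[OF a(1) int_g, of K] by simp
    moreover have "?b + 1 \<le> c * norm (LINT x|lborel. ?g x * test_wave e {- int K..<0} a x)"
      using a(3) c by (simp add: divide_le_eq mult.commute)
    ultimately show False by linarith
  qed
  have "\<not> given_by_element_of (fourier_multiplier \<psi> (dist_of ?g)) continuous_functions"
    using not_Linf given_by_element_of_mono[OF continuous_functions_subset_Linf_loc] by blast
  moreover have "?g \<in> Linf_comp" using g_in continuous_comp_subset_Linf_comp by blast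
  ultimately show ?thesis using f_in g_in not_L1 not_Linf by blast
qed

end
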